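(* Let $(\mathsf{X},\mathsf{A},p,c)$ be a Markov decision process satisfying the assumptions (A1)--(A7) listed in the context, and let $\{K_n\}$, $\{\nu_n\}$ and $\overline{\mathrm{MDP}}_n$ be as described in the context. Then the average-cost value function $\bar V_n^*$ of $\overline{\mathrm{MDP}}_n$ converges to the average-cost value function $V^*$ of the original MDP, i.e. $$|\bar V_n^*-V^*|\to0\quad\text{as }n\to\infty$$ (both value functions are constants for all sufficiently large $n$).
   Context: A Markov decision process (MDP) $(\mathsf{X},\mathsf{A},p,c)$ consists of Borel spaces $\mathsf{X}$ (states) and $\mathsf{A}$ (actions, all admissible in every state), a stochastic kernel $p(dy|x,a)$ on $\mathsf{X}$ given $\mathsf{X}\times\mathsf{A}$, and a measurable one-stage cost $c:\mathsf{X}\times\mathsf{A}\to\mathbb{R}$. A policy is a sequence of stochastic kernels on $\mathsf{A}$ given the histories; $\Pi$ is the set of all policies. The average cost is $V(\pi,x)=\limsup_{T\to\infty}\frac1T\mathbb{E}_x^\pi[\sum_{t=0}^{T-1}c(x_t,a_t)]$ and the value function is $V^*(x)=\inf_{\pi\in\Pi}V(\pi,x)$. Assumptions: (A1) $c$ is continuous. (A2) $\mathsf{X}$ is locally compact (and non-compact) and $\mathsf{A}$ is compact. (A3) There are $M\ge0$ and a continuous $w:\mathsf{X}\to[1,\infty)$ with $\sup_{a}|c(x,a)|\le Mw(x)$ for all $x$, and $\int w(y)p(dy|x,a)$ is continuous in $(x,a)$. Moreover there exist a probability measure $\eta$ on $\mathsf{X}$, a positive measurable function $\phi:\mathsf{X}\times\mathsf{A}\to(0,\infty)$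 and $\alpha\in(0,1)$ such that for all $(x,a)$: (A4) $\int w(y)p(dy|x,a)\le\alpha w(x)+\eta(w)\phi(x,a)$, where $\eta(w)=\int w\,d\eta<\infty$. (A5) $p(D|x,a)\ge\eta(D)\phi(x,a)$ for all Borel $D\subset\mathsf{X}$. (A6) $\inf_{(x,a)\in K_n\times\mathsf{A}}\phi(x,a)>0$ for each $n\ge1$. (A7) $p(\cdot|x,a)$ is continuous in $(x,a)$ with respect to the $w$-norm $\|\vartheta\|_w=\sup\{|\int g\,d\vartheta|:\ |g|\le w\}$ of signed measures. $\{K_n\}$ is a nested sequence of compact subsets of $\mathsf{X}$ with $K_n\subset\operatorname{int}K_{n+1}$, $\mathsf{X}=\bigcup_nK_n$. $\{\nu_n\}$ is a sequence of probability measures with $\nu_n$ concentrated on $K_n^c$, $\gamma_n:=\int_{K_n^c}w\,d\nu_n<\infty$, and with $$\tau_n:=\max\Big\{0,\sup_{(x,a)\in\mathsf{X}\times\mathsf{A}}\int_{K_n^c}(\gamma_n-w(y))\,p(dy|x,a)\Big\},\qquad \varsigma_n:=\int_{K_n^c}w\,d\eta,$$ one has $\sup_n\tau_n<\infty$ and $\lim_{n\to\infty}(\tau_n+\varsigma_n)=0$. $\overline{\mathrm{MDP}}_n$ is the MDP $(\mathsf{X},\mathsf{A},q_n,b_n)$ with $q_n(\cdot|x,a)=p(\cdot|x,a)$, $b_n(x,a)=c(x,a)$ for $x\in K_n$, and $q_n(\cdot|x,a)=\int_{K_n^c}p(\cdot|z,a)\nu_n(dz)$, $b_n(x,a)=\int_{K_n^c}c(z,a)\nu_n(dz)$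 for $x\in K_n^c$. Its average-cost value function is $\bar V_n^*$. *)

theory Defs
  imports "HOL-Probability.Probability"
begin

text \<open>State and action spaces are Borel spaces: Borel subsets \<open>X\<close>, \<open>A\<close> of Polish spaces, carrying
  the trace of the Borel sigma-algebra.\<close>

abbreviation borel_on :: "'b::topological_space set \<Rightarrow> 'b measure" where
  "borel_on S \<equiv> restrict_space borel S"

abbreviation state_action_space ::
    "'x::polish_space set \<Rightarrow> 'a::polish_space set \<Rightarrow> ('x \<times> 'a) measure" where
  "state_action_space X A \<equiv> borel_on X \<Otimes>\<^sub>M borel_on A"

definition mdp ::
    "'x::polish_space set \<Rightarrow> 'a::polish_space set \<Rightarrow> ('x \<Rightarrow> 'a \<Rightarrow> 'x measure) \<Rightarrow> ('x \<Rightarrow> 'a \<Rightarrow> real) \<Rightarrow> bool" where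
  "mdp X A p c \<longleftrightarrow>
     X \<in> sets borel \<and> X \<noteq> {} \<and> A \<in> sets borel \<and> A \<noteq> {} \<and>
     (\<lambda>(x, a). p x a) \<in> state_action_space X A \<rightarrow>\<^sub>M prob_algebra (borel_on X) \<and>
     (\<lambda>(x, a). c x a) \<in> borel_measurable (state_action_space X A)"

text \<open>A history \<open>(x\<^sub>0, a\<^sub>0, \<dots>, x\<^bsub>t-1\<^esub>, a\<^bsub>t-1\<^esub>, x\<^sub>t)\<close> is a pair \<open>(\<omega>, x\<^sub>t)\<close> with
  \<open>\<omega> i = (x\<^sub>i, a\<^sub>i)\<close> for \<open>i < t\<close>.\<close>

definition history_space ::
    "'x::polish_space set \<Rightarrow> 'a::polish_space set \<Rightarrow> nat \<Rightarrow> ((nat \<Rightarrow> 'x \<times> 'a) \<times> 'x) measure" where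
  "history_space X A t = (\<Pi>\<^sub>M i\<in>{0..<t}. state_action_space X A) \<Otimes>\<^sub>M borel_on X"

definition policies ::
    "'x::polish_space set \<Rightarrow> 'a::polish_space set \<Rightarrow> (nat \<Rightarrow> (nat \<Rightarrow> 'x \<times> 'a) \<times> 'x \<Rightarrow> 'a measure) set" where
  "policies X A = {\<pi>. \<forall>t. \<pi> t \<in> history_space X A t \<rightarrow>\<^sub>M prob_algebra (borel_on A)}"

text \<open>\<open>step_kernel X A p \<pi> x t \<omega>\<close> is the conditional law of \<open>(x\<^sub>t, a\<^sub>t)\<close> given
  \<open>(x\<^sub>i, a\<^sub>i) = \<omega> i\<close> for \<open>i < t\<close>, under the policy \<open>\<pi>\<close> and the initial state \<open>x\<close>.\<close>

definition step_kernel ::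
    "'x::polish_space set \<Rightarrow> 'a::polish_space set \<Rightarrow> ('x \<Rightarrow> 'a \<Rightarrow> 'x measure) \<Rightarrow>
     (nat \<Rightarrow> (nat \<Rightarrow> 'x \<times> 'a) \<times> 'x \<Rightarrow> 'a measure) \<Rightarrow> 'x \<Rightarrow> nat \<Rightarrow> (nat \<Rightarrow> 'x \<times> 'a) \<Rightarrow> ('x \<times> 'a) measure" where
  "step_kernel X A p \<pi> x t \<omega> =
     (case t of 0 \<Rightarrow> return (borel_on X) x | Suc s \<Rightarrow> p (fst (\<omega> s)) (snd (\<omega> s))) \<bind>
     (\<lambda>y. distr (\<pi> t (\<omega>, y)) (state_action_space X A) (Pair y))"

text \<open>The law of the state-action process on the infinite product space, by the Ionescu-Tulcea
  theorem. The lemma below discharges the locale assumptions, so that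
  \<open>Ionescu_Tulcea.lim\<close> and \<open>Ionescu_Tulcea.distr_lim\<close> characterise this measure by its
  finite-dimensional marginals.\<close>

definition path_measure ::
    "'x::polish_space set \<Rightarrow> 'a::polish_space set \<Rightarrow> ('x \<Rightarrow> 'a \<Rightarrow> 'x measure) \<Rightarrow>
     (nat \<Rightarrow> (nat \<Rightarrow> 'x \<times> 'a) \<times> 'x \<Rightarrow> 'a measure) \<Rightarrow> 'x \<Rightarrow> (nat \<Rightarrow> 'x \<times> 'a) measure" where
  "path_measure X A p \<pi> x =
     projective_family.lim UNIV
       (Ionescu_Tulcea.CI (step_kernel X A p \<pi> x) (\<lambda>_. state_action_space X A))
       (\<lambda>_. state_action_space X A)"

lemma Ionescu_Tulcea_step_kernel:
  assumes "mdp X A p c" and "\<pi> \<in> policies X A" and "x \<in> X"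
  shows "Ionescu_Tulcea (step_kernel X A p \<pi> x) (\<lambda>_. state_action_space X A)"
proof -
  let ?S = "state_action_space X A"
  have p: "(\<lambda>(x, a). p x a) \<in> ?S \<rightarrow>\<^sub>M prob_algebra (borel_on X)"
    using assms(1) by (simp add: mdp_def)
  have \<pi>: "\<pi> t \<in> (\<Pi>\<^sub>M i\<in>{0..<t}. ?S) \<Otimes>\<^sub>M borel_on X \<rightarrow>\<^sub>M prob_algebra (borel_on A)" for t
    using assms(2) by (simp add: policies_def history_space_def)
  have *: "step_kernel X A p \<pi> x t \<in> (\<Pi>\<^sub>M i\<in>{0..<t}. ?S) \<rightarrow>\<^sub>M prob_algebra ?S" for t
  proof -
    let ?H = "\<Pi>\<^sub>M i\<in>{0..<t}. ?S"
    have 1: "(\<lambda>\<omega>. case t of 0 \<Rightarrow> return (borel_on X) x | Suc s \<Rightarrow> p (fst (\<omega> s)) (snd (\<omega> s)))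
        \<in> ?H \<rightarrow>\<^sub>M prob_algebra (borel_on X)"
    proof (cases t)
      case 0
      have "return (borel_on X) x \<in> space (prob_algebra (borel_on X))"
        using assms(3) by (simp add: space_prob_algebra space_restrict_space prob_space_return)
      then show ?thesis unfolding 0 nat.case by (rule measurable_const)
    next
      case (Suc s)
      have "(\<lambda>\<omega>. \<omega> s) \<in> ?H \<rightarrow>\<^sub>M ?S"
        using Suc by (intro measurable_component_singleton) auto
      from measurable_compose[OF this p] show ?thesis
        unfolding Suc nat.case case_prod_beta .
    qed
    have 2: "(\<lambda>(\<omega>, y). distr (\<pi> t (\<omega>, y)) ?S (Pair y)) \<in> ?H \<Otimes>\<^sub>M borel_on X \<rightarrow>\<^sub>M prob_algebra ?S"
    proof -
      have "(\<lambda>z. distr (\<pi> t z) ?S (Pair (snd z))) \<in> ?H \<Otimes>\<^sub>M borel_on X \<rightarrow>\<^sub>M prob_algebra ?S"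
      proof (rule measurable_distr_prob_space2[OF \<pi>])
        have "(\<lambda>u. (snd (fst u), snd u)) \<in> (?H \<Otimes>\<^sub>M borel_on X) \<Otimes>\<^sub>M borel_on A \<rightarrow>\<^sub>M ?S"
          by (intro measurable_Pair measurable_compose[OF measurable_fst measurable_snd] measurable_snd)
        then show "(\<lambda>(z, a). (snd z, a)) \<in> (?H \<Otimes>\<^sub>M borel_on X) \<Otimes>\<^sub>M borel_on A \<rightarrow>\<^sub>M ?S"
          by (simp only: case_prod_beta')
      qed
      then show ?thesis by (simp only: case_prod_beta' prod.collapse)
    qed
    show ?thesis
      unfolding step_kernel_def by (rule measurable_bind_prob_space2[OF 1 2])
  qed
  show ?thesis
  proof (rule Ionescu_Tulcea.intro)
    show "step_kernel X A p \<pi> x t \<in> (\<Pi>\<^sub>M i\<in>{0..<t}. ?S) \<rightarrow>\<^sub>M subprob_algebra ?S" for t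
      by (rule measurable_prob_algebraD[OF *])
    show "prob_space (step_kernel X A p \<pi> x t \<omega>)" if "\<omega> \<in> space (\<Pi>\<^sub>M i\<in>{0..<t}. ?S)" for t \<omega>
      using measurable_space[OF * that] by (simp add: space_prob_algebra)
  qed
qed

text \<open>The Bochner integral is 0 for a non-integrable cost, so this is the expected cost only when
  the cost is integrable along the process, as under a weighted bound \<open>\<bar>c x a\<bar> \<le> M * w x\<close> with a
  drift condition on \<open>w\<close>.\<close>

definition expected_cost ::
    "'x::polish_space set \<Rightarrow> 'a::polish_space set \<Rightarrow> ('x \<Rightarrow> 'a \<Rightarrow> 'x measure) \<Rightarrow> ('x \<Rightarrow> 'a \<Rightarrow> real) \<Rightarrow>
     (nat \<Rightarrow> (nat \<Rightarrow> 'x \<times> 'a) \<times> 'x \<Rightarrow> 'a measure) \<Rightarrow> 'x \<Rightarrow> nat \<Rightarrow> real" where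
  "expected_cost X A p c \<pi> x T =
     (\<integral>\<omega>. (\<Sum>t<T. c (fst (\<omega> t)) (snd (\<omega> t))) \<partial>path_measure X A p \<pi> x)"

definition average_cost ::
    "'x::polish_space set \<Rightarrow> 'a::polish_space set \<Rightarrow> ('x \<Rightarrow> 'a \<Rightarrow> 'x measure) \<Rightarrow> ('x \<Rightarrow> 'a \<Rightarrow> real) \<Rightarrow>
     (nat \<Rightarrow> (nat \<Rightarrow> 'x \<times> 'a) \<times> 'x \<Rightarrow> 'a measure) \<Rightarrow> 'x \<Rightarrow> ereal" where
  "average_cost X A p c \<pi> x = limsup (\<lambda>T. ereal (1 / real T * expected_cost X A p c \<pi> x T))"

definition value_function ::
    "'x::polish_space set \<Rightarrow> 'a::polish_space set \<Rightarrow> ('x \<Rightarrow> 'a \<Rightarrow> 'x measure) \<Rightarrow> ('x \<Rightarrow> 'a \<Rightarrow> real) \<Rightarrow>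
     'x \<Rightarrow> ereal" where
  "value_function X A p c x = (INF \<pi>\<in>policies X A. average_cost X A p c \<pi> x)"

text \<open>The \<open>w\<close>-norm of the signed measure \<open>\<mu> - \<mu>'\<close>, for finite measures \<open>\<mu>\<close>, \<open>\<mu>'\<close> on \<open>X\<close> that
  integrate \<open>w\<close>.\<close>

definition w_norm_diff ::
    "'x::polish_space set \<Rightarrow> ('x \<Rightarrow> real) \<Rightarrow> 'x measure \<Rightarrow> 'x measure \<Rightarrow> ereal" where
  "w_norm_diff X w \<mu> \<mu>' =
     (SUP g\<in>{g \<in> borel_measurable (borel_on X). \<forall>x\<in>X. \<bar>g x\<bar> \<le> w x}.
        ereal \<bar>(\<integral>x. g x \<partial>\<mu>) - (\<integral>x. g x \<partial>\<mu>')\<bar>)"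

text \<open>The approximating MDP for a compact set \<open>K\<close> and a probability measure \<open>\<nu>\<close> on \<open>X - K\<close>:
  outside \<open>K\<close> the kernel is the mixture of \<open>p z a\<close>, and the cost the average of \<open>c z a\<close>, over
  \<open>z\<close> distributed according to \<open>\<nu>\<close>.\<close>

definition approx_kernel ::
    "'x::polish_space set \<Rightarrow> ('x \<Rightarrow> 'a::polish_space \<Rightarrow> 'x measure) \<Rightarrow> 'x set \<Rightarrow> 'x measure \<Rightarrow>
     'x \<Rightarrow> 'a \<Rightarrow> 'x measure" where
  "approx_kernel X p K \<nu> x a =
     (if x \<in> K then p x a else restrict_space \<nu> (X - K) \<bind> (\<lambda>z. p z a))"

definition approx_cost ::
    "'x::polish_space set \<Rightarrow> ('x \<Rightarrow> 'a::polish_space \<Rightarrow> real) \<Rightarrow> 'x set \<Rightarrow> 'x measure \<Rightarrow>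
     'x \<Rightarrow> 'a \<Rightarrow> real" where
  "approx_cost X c K \<nu> x a = (if x \<in> K then c x a else (LINT z:(X - K)|\<nu>. c z a))"

end

theory Submission
  imports Defs
begin

text \<open>Subtracting the minorant turns \<open>p\<close> into the substochastic kernel \<open>r = p - \<phi> \<eta>\<close>, which by (A4)
  contracts the \<open>w\<close>-norm by the factor \<open>\<alpha>\<close>. For every real \<open>\<rho>\<close> the equation
  \<open>u x = inf\<^sub>a (c x a - \<rho> + r u x a)\<close> therefore has a unique solution \<open>u\<^sub>\<rho>\<close>; its mean \<open>\<eta>(u\<^sub>\<rho>)\<close> is continuous
  and strictly decreasing in \<open>\<rho>\<close>, with slope at most \<open>-1\<close>. At its zero \<open>r u = p u\<close>, so that the equation
  becomes the average-cost optimality equation, and the zero is the value function.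

  The truncated model has the same structure for the weight that equals \<open>w\<close> on \<open>K\<^sub>n\<close> and \<open>\<gamma>\<^sub>n\<close> outside,
  with \<open>\<alpha>\<close> replaced by \<open>\<alpha> + \<tau>\<^sub>n + \<sigma>\<^sub>n\<close>. By the bound on the slope, the two values differ by at most the
  mean, under \<open>\<eta>\<close>, of the truncated solution \<open>f\<^sub>n\<close> belonging to the optimal \<open>\<rho>\<close> of the original model.
  This mean tends to \<open>\<eta>(u\<^sub>\<rho>) = 0\<close>, because \<open>f\<^sub>n\<close> converges to \<open>u\<^sub>\<rho>\<close> pointwise.\<close>

subsection \<open>Integration and weighted bounds\<close>

text \<open>The obstacle lies outside \<open>K n\<close>: the truncated solution \<open>f\<close> is
  bounded uniformly in n only relative to the truncated weight, which equals
  \<open>\<gamma> n\<close> there, and nothing bounds these constants. The error between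
  \<open>u\<close> and \<open>f\<close> is therefore not dominated outside \<open>K n\<close> by one
  multiple of \<open>w\<close>. At a state of \<open>K n\<close>, however, both models have the same
  cost and kernel, and the outer error enters only through an integral of
  \<open>\<gamma> n + w = (\<gamma> n - w) + 2 * w\<close> over the complement. The first summand is
  what \<open>\<tau> n\<close> controls, the second leaves a tail of an integrable function. So the
  error is cut off to \<open>K n\<close>: the remaining part is dominated by a fixed multiple of
  \<open>w\<close>, and at each fixed state, which eventually lies in \<open>K n\<close>, it is
  subinvariant up to a vanishing amount. Under \<eta> the outer part is small by (A5): at a single
  state-action pair it bounds \<open>\<gamma> n\<close> times the \<eta>-mass of the complement by
  the same two quantities. Pointwise convergence is then enough, as only means under \<eta> are
  compared.\<close>

lemma bind_has_integral_nonneg: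
  fixes f :: "'b \<Rightarrow> real"
  assumes N: "N \<in> space (prob_algebra S)" and \<kappa>: "\<kappa> \<in> S \<rightarrow>\<^sub>M prob_algebra B"
    and f: "f \<in> borel_measurable B" "\<And>x. 0 \<le> f x"
    and int: "\<And>z. z \<in> space S \<Longrightarrow> integrable (\<kappa> z) f"
    and int2: "integrable N (\<lambda>z. \<integral>x. f x \<partial>\<kappa> z)"
  shows "has_bochner_integral (N \<bind> \<kappa>) f (\<integral>z. (\<integral>x. f x \<partial>\<kappa> z) \<partial>N)"
proof (rule has_bochner_integral_nn_integral)
  have setsN: "sets N = sets S" and spN: "space N = space S"
    using N sets_eq_imp_space_eq[of N S] by (auto simp: space_prob_algebra)
  show "f \<in> borel_measurable (N \<bind> \<kappa>)"
    using f(1) sets_bind'[OF N \<kappa>] by (simp cong: measurable_cong_sets)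
  have \<kappa>': "\<kappa> \<in> N \<rightarrow>\<^sub>M subprob_algebra B"
    using measurable_prob_algebraD[OF \<kappa>] setsN by (simp cong: measurable_cong_sets)
  have "(\<integral>\<^sup>+x. ennreal (f x) \<partial>(N \<bind> \<kappa>)) = (\<integral>\<^sup>+z. \<integral>\<^sup>+x. ennreal (f x) \<partial>\<kappa> z \<partial>N)"
    by (rule nn_integral_bind[OF _ \<kappa>']) (use f in measurable)
  also have "\<dots> = (\<integral>\<^sup>+z. ennreal (\<integral>x. f x \<partial>\<kappa> z) \<partial>N)"
    by (intro nn_integral_cong nn_integral_eq_integral int) (auto simp: spN f)
  also have "\<dots> = ennreal (\<integral>z. (\<integral>x. f x \<partial>\<kappa> z) \<partial>N)"
    by (intro nn_integral_eq_integral int2) (auto simp: f integral_nonneg_AE)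
  finally show "(\<integral>\<^sup>+x. ennreal (f x) \<partial>(N \<bind> \<kappa>)) = ennreal (\<integral>z. (\<integral>x. f x \<partial>\<kappa> z) \<partial>N)" .
qed (auto simp: f integral_nonneg_AE)

text \<open>Finiteness is the point: \<open>g\<close> dominates the conditional absolute means, so
  the positive and the negative part of \<open>f\<close>, both below its absolute value, have finite
  iterated integrals. Tonelli applies to each, and the results are subtracted.\<close>

lemma bind_integral:
  fixes f :: "'b \<Rightarrow> real"
  assumes N: "N \<in> space (prob_algebra S)" and \<kappa>: "\<kappa> \<in> S \<rightarrow>\<^sub>M prob_algebra B"
    and f: "f \<in> borel_measurable B"
    and int: "\<And>z. z \<in> space S \<Longrightarrow> integrable (\<kappa> z) f"
    and g: "integrable N g" "\<And>z. z \<in> space S \<Longrightarrow> (\<integral>x. \<bar>f x\<bar> \<partial>\<kappa> z) \<le> g z"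
  shows "integrable (N \<bind> \<kappa>) f" "(\<integral>x. f x \<partial>(N \<bind> \<kappa>)) = (\<integral>z. (\<integral>x. f x \<partial>\<kappa> z) \<partial>N)"
    "integrable N (\<lambda>z. \<integral>x. f x \<partial>\<kappa> z)"
proof -
  have setsN: "sets N = sets S" and spN: "space N = space S"
    using N sets_eq_imp_space_eq[of N S] by (auto simp: space_prob_algebra)
  have m: "(\<lambda>z. \<integral>x. h x \<partial>\<kappa> z) \<in> borel_measurable N" if "h \<in> borel_measurable B" for h :: "'b \<Rightarrow> real"
    using measurable_compose[OF measurable_prob_algebraD[OF \<kappa>] integral_measurable_subprob_algebra[OF that]]
      setsN by (simp cong: measurable_cong_sets)
  have dom: "integrable N (\<lambda>z. \<integral>x. h x \<partial>\<kappa> z)"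
    if h: "h \<in> borel_measurable B" "\<And>x. \<bar>h x\<bar> \<le> \<bar>f x\<bar>" for h :: "'b \<Rightarrow> real"
  proof (rule Bochner_Integration.integrable_bound[OF g(1) m[OF h(1)]], rule AE_I2)
    fix z assume "z \<in> space N"
    then have z: "z \<in> space S" by (simp add: spN)
    have "\<bar>\<integral>x. h x \<partial>\<kappa> z\<bar> \<le> (\<integral>x. \<bar>h x\<bar> \<partial>\<kappa> z)" by (rule integral_abs_bound)
    also have "\<dots> \<le> (\<integral>x. \<bar>f x\<bar> \<partial>\<kappa> z)"
    proof (rule integral_mono)
      show "integrable (\<kappa> z) (\<lambda>x. \<bar>f x\<bar>)" using int[OF z] by simp
      show "integrable (\<kappa> z) (\<lambda>x. \<bar>h x\<bar>)"
        by (rule Bochner_Integration.integrable_bound[OF int[OF z]])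
          (use h measurable_space[OF \<kappa> z] in \<open>auto simp: space_prob_algebra cong: measurable_cong_sets\<close>)
    qed (use h in auto)
    also have "\<dots> \<le> g z" by (rule g(2)[OF z])
    finally show "norm (\<integral>x. h x \<partial>\<kappa> z) \<le> norm (g z)" by simp
  qed
  let ?p = "\<lambda>x. max (f x) 0" and ?n = "\<lambda>x. max (- f x) 0"
  have pos: "has_bochner_integral (N \<bind> \<kappa>) ?p (\<integral>z. (\<integral>x. ?p x \<partial>\<kappa> z) \<partial>N)"
    by (rule bind_has_integral_nonneg[OF N \<kappa>]) (use f int in \<open>auto intro!: dom\<close>)
  have neg: "has_bochner_integral (N \<bind> \<kappa>) ?n (\<integral>z. (\<integral>x. ?n x \<partial>\<kappa> z) \<partial>N)"
    by (rule bind_has_integral_nonneg[OF N \<kappa>]) (use f int in \<open>auto intro!: dom\<close>)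
  have eq: "?p x - ?n x = f x" for x by auto
  have *: "has_bochner_integral (N \<bind> \<kappa>) f ((\<integral>z. (\<integral>x. ?p x \<partial>\<kappa> z) \<partial>N) - (\<integral>z. (\<integral>x. ?n x \<partial>\<kappa> z) \<partial>N))"
    using has_bochner_integral_diff[OF pos neg] unfolding eq .
  show "integrable (N \<bind> \<kappa>) f" using * by (rule integrable.intros)
  show "integrable N (\<lambda>z. \<integral>x. f x \<partial>\<kappa> z)" by (rule dom) (use f in auto)
  have "(\<integral>z. (\<integral>x. ?p x \<partial>\<kappa> z) \<partial>N) - (\<integral>z. (\<integral>x. ?n x \<partial>\<kappa> z) \<partial>N)
      = (\<integral>z. (\<integral>x. ?p x \<partial>\<kappa> z) - (\<integral>x. ?n x \<partial>\<kappa> z) \<partial>N)"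
    by (rule Bochner_Integration.integral_diff[symmetric]; rule dom; use f in auto)
  also have "\<dots> = (\<integral>z. (\<integral>x. f x \<partial>\<kappa> z) \<partial>N)"
  proof (rule Bochner_Integration.integral_cong[OF refl])
    fix z assume "z \<in> space N"
    then have z: "z \<in> space S" by (simp add: spN)
    show "(\<integral>x. ?p x \<partial>\<kappa> z) - (\<integral>x. ?n x \<partial>\<kappa> z) = (\<integral>x. f x \<partial>\<kappa> z)"
      by (subst Bochner_Integration.integral_diff[symmetric]) (use int[OF z] eq in auto)
  qed
  finally show "(\<integral>x. f x \<partial>(N \<bind> \<kappa>)) = (\<integral>z. (\<integral>x. f x \<partial>\<kappa> z) \<partial>N)"
    using has_bochner_integral_integral_eq[OF *] by simp
qed

text \<open>The form is dictated by the truncated model, which must satisfy the same axioms. Its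
  weight, cost and kernel may jump in the state at the boundary of the truncation set, so the weight
  is merely measurable and continuity is asked in the action alone, at a fixed state. The
  minorization is stated for functions below \<open>w\<close>, because integrals and not sets are
  compared later.\<close>

locale weighted_mdp =
  fixes X :: "'x::polish_space set" and A :: "'a::polish_space set"
    and p :: "'x \<Rightarrow> 'a \<Rightarrow> 'x measure" and c :: "'x \<Rightarrow> 'a \<Rightarrow> real"
    and w :: "'x \<Rightarrow> real" and M :: real
    and \<eta> :: "'x measure" and \<phi> :: "'x \<Rightarrow> 'a \<Rightarrow> real" and \<alpha> :: real
  assumes mdp: "mdp X A p c"
    and w_measurable: "w \<in> borel_measurable (borel_on X)"
    and w_ge_1: "x \<in> X \<Longrightarrow> 1 \<le> w x"
    and M_nonneg: "0 \<le> M"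
    and cost_bound: "x \<in> X \<Longrightarrow> a \<in> A \<Longrightarrow> \<bar>c x a\<bar> \<le> M * w x"
    and w_integrable: "x \<in> X \<Longrightarrow> a \<in> A \<Longrightarrow> integrable (p x a) w"
    and \<eta>: "\<eta> \<in> space (prob_algebra (borel_on X))"
    and w_integrable_\<eta>: "integrable \<eta> w"
    and \<phi>_measurable: "(\<lambda>(x, a). \<phi> x a) \<in> borel_measurable (state_action_space X A)"
    and \<phi>_nonneg: "x \<in> X \<Longrightarrow> a \<in> A \<Longrightarrow> 0 \<le> \<phi> x a"
    and \<alpha>: "0 \<le> \<alpha>" "\<alpha> < 1"
    and drift: "x \<in> X \<Longrightarrow> a \<in> A \<Longrightarrow> (\<integral>y. w y \<partial>p x a) \<le> \<alpha> * w x + (\<integral>y. w y \<partial>\<eta>) * \<phi> x a"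
    and minorization: "g \<in> borel_measurable (borel_on X) \<Longrightarrow> (\<And>y. y \<in> X \<Longrightarrow> 0 \<le> g y \<and> g y \<le> w y) \<Longrightarrow>
      x \<in> X \<Longrightarrow> a \<in> A \<Longrightarrow> \<phi> x a * (\<integral>y. g y \<partial>\<eta>) \<le> (\<integral>y. g y \<partial>p x a)"
    and continuous_cost: "x \<in> X \<Longrightarrow> continuous_on A (c x)"
    and continuous_\<phi>: "x \<in> X \<Longrightarrow> continuous_on A (\<phi> x)"
    and continuous_kernel: "g \<in> borel_measurable (borel_on X) \<Longrightarrow> (\<And>y. y \<in> X \<Longrightarrow> \<bar>g y\<bar> \<le> w y) \<Longrightarrow>
      x \<in> X \<Longrightarrow> continuous_on A (\<lambda>a. \<integral>y. g y \<partial>p x a)"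
begin

lemma X: "X \<in> sets borel" "X \<noteq> {}" and A: "A \<in> sets borel" "A \<noteq> {}"
  and kernel: "(\<lambda>(x, a). p x a) \<in> state_action_space X A \<rightarrow>\<^sub>M prob_algebra (borel_on X)"
  and cost_measurable: "(\<lambda>(x, a). c x a) \<in> borel_measurable (state_action_space X A)"
  using mdp unfolding mdp_def by auto

lemma space_X [simp]: "space (borel_on X) = X" and space_A [simp]: "space (borel_on A) = A"
  by (simp_all add: space_restrict_space)

lemma space_XA [simp]: "space (state_action_space X A) = X \<times> A"
  by (simp add: space_pair_measure)

lemma p_in: "x \<in> X \<Longrightarrow> a \<in> A \<Longrightarrow> p x a \<in> space (prob_algebra (borel_on X))"
  using measurable_space[OF kernel, of "(x, a)"] by simp

lemma prob_p: "x \<in> X \<Longrightarrow> a \<in> A \<Longrightarrow> prob_space (p x a)"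
  and sets_p: "x \<in> X \<Longrightarrow> a \<in> A \<Longrightarrow> sets (p x a) = sets (borel_on X)"
  using p_in by (auto simp: space_prob_algebra)

lemma space_p: "x \<in> X \<Longrightarrow> a \<in> A \<Longrightarrow> space (p x a) = X"
  using sets_eq_imp_space_eq[OF sets_p] by simp

lemma prob_\<eta>: "prob_space \<eta>" and sets_\<eta>: "sets \<eta> = sets (borel_on X)"
  using \<eta> by (auto simp: space_prob_algebra)

lemma space_\<eta>: "space \<eta> = X"
  using sets_eq_imp_space_eq[OF sets_\<eta>] by simp

lemma w_nonneg: "x \<in> X \<Longrightarrow> 0 \<le> w x"
  using w_ge_1[of x] by simp

section \<open>Functions of finite weighted norm\<close>

definition wbounded :: "('x \<Rightarrow> real) \<Rightarrow> bool" where
  "wbounded g \<longleftrightarrow> g \<in> borel_measurable (borel_on X) \<and> (\<exists>C. \<forall>x\<in>X. \<bar>g x\<bar> \<le> C * w x)"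

lemma wboundedI: "g \<in> borel_measurable (borel_on X) \<Longrightarrow> (\<And>x. x \<in> X \<Longrightarrow> \<bar>g x\<bar> \<le> C * w x) \<Longrightarrow> wbounded g"
  unfolding wbounded_def by auto

lemma wbounded_measurable: "wbounded g \<Longrightarrow> g \<in> borel_measurable (borel_on X)"
  unfolding wbounded_def by auto

lemma wboundedE:
  assumes "wbounded g"
  obtains C where "0 < C" "\<And>x. x \<in> X \<Longrightarrow> \<bar>g x\<bar> \<le> C * w x"
proof -
  obtain C where C: "\<And>x. x \<in> X \<Longrightarrow> \<bar>g x\<bar> \<le> C * w x"
    using assms unfolding wbounded_def by auto
  have "\<bar>g x\<bar> \<le> (\<bar>C\<bar> + 1) * w x" if "x \<in> X" for x
    using C[OF that] w_ge_1[OF that] mult_right_mono[of C "\<bar>C\<bar> + 1" "w x"] by linarith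
  then show ?thesis using that[of "\<bar>C\<bar> + 1"] by auto
qed

lemma wbounded_w: "wbounded w"
  by (rule wboundedI[of _ 1]) (use w_measurable w_nonneg in auto)

lemma wbounded_const: "wbounded (\<lambda>_. k)"
proof (rule wboundedI[of _ "\<bar>k\<bar>"])
  fix x assume "x \<in> X" then show "\<bar>k\<bar> \<le> \<bar>k\<bar> * w x"
    using mult_left_mono[OF w_ge_1, of x "\<bar>k\<bar>"] by simp
qed simp

lemma wbounded_add:
  assumes "wbounded f" "wbounded g" shows "wbounded (\<lambda>x. f x + g x)"
proof -
  obtain C D where C: "\<And>x. x \<in> X \<Longrightarrow> \<bar>f x\<bar> \<le> C * w x" and D: "\<And>x. x \<in> X \<Longrightarrow> \<bar>g x\<bar> \<le> D * w x"
    using assms by (metis wboundedE)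
  have "(\<lambda>x. f x + g x) \<in> borel_measurable (borel_on X)"
    using assms by (intro borel_measurable_add wbounded_measurable)
  then show ?thesis
    by (rule wboundedI[of _ "C + D"])
      (use C D in \<open>auto simp: distrib_right intro!: order_trans[OF abs_triangle_ineq] add_mono\<close>)
qed

lemma wbounded_mult: assumes "wbounded f" shows "wbounded (\<lambda>x. k * f x)"
proof -
  obtain C where C: "\<And>x. x \<in> X \<Longrightarrow> \<bar>f x\<bar> \<le> C * w x"
    using assms by (metis wboundedE)
  have "(\<lambda>x. k * f x) \<in> borel_measurable (borel_on X)"
    using assms by (intro borel_measurable_times borel_measurable_const wbounded_measurable)
  then show ?thesis
    by (rule wboundedI[of _ "\<bar>k\<bar> * C"])
      (use C in \<open>auto simp: abs_mult mult.assoc intro!: mult_left_mono\<close>)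
qed

lemma wbounded_diff: "wbounded f \<Longrightarrow> wbounded g \<Longrightarrow> wbounded (\<lambda>x. f x - g x)"
  using wbounded_add[OF _ wbounded_mult[of g "-1"], of f] by simp

lemma wbounded_le:
  assumes "f \<in> borel_measurable (borel_on X)" "wbounded g" "\<And>x. x \<in> X \<Longrightarrow> \<bar>f x\<bar> \<le> \<bar>g x\<bar>"
  shows "wbounded f"
proof -
  obtain C where C: "\<And>x. x \<in> X \<Longrightarrow> \<bar>g x\<bar> \<le> C * w x"
    using assms(2) by (metis wboundedE)
  show ?thesis by (rule wboundedI[of _ C]) (use assms C in \<open>auto intro: order_trans\<close>)
qed

lemma wbounded_indicator:
  assumes "D \<in> sets (borel_on X)" "wbounded g" shows "wbounded (\<lambda>y. indicator D y * g y)"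
proof (rule wbounded_le[OF _ assms(2)])
  show "(\<lambda>y. indicator D y * g y) \<in> borel_measurable (borel_on X)"
    using assms(1) wbounded_measurable[OF assms(2)] by (intro borel_measurable_times borel_measurable_indicator)
qed (auto simp: indicator_def)

lemma wbounded_abs: "wbounded f \<Longrightarrow> wbounded (\<lambda>x. \<bar>f x\<bar>)"
  by (rule wbounded_le[of _ f]) (auto dest: wbounded_measurable)

lemma wbounded_integrable:
  assumes "wbounded g" and N: "sets N = sets (borel_on X)" "integrable N w"
  shows "integrable N g"
proof -
  obtain C where C: "\<And>x. x \<in> X \<Longrightarrow> \<bar>g x\<bar> \<le> C * w x" using assms(1) by (metis wboundedE)
  have sp: "space N = X" using sets_eq_imp_space_eq[OF N(1)] by simp
  show ?thesis
  proof (rule Bochner_Integration.integrable_bound)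
    show "integrable N (\<lambda>x. C * w x)" using N by simp
    show "g \<in> borel_measurable N"
      using wbounded_measurable[OF assms(1)] N by (simp cong: measurable_cong_sets)
    show "AE x in N. norm (g x) \<le> norm (C * w x)"
      by (rule AE_I2) (use C sp in \<open>auto intro: order_trans[OF C]\<close>)
  qed
qed

lemma wbounded_integrable_p: "wbounded g \<Longrightarrow> x \<in> X \<Longrightarrow> a \<in> A \<Longrightarrow> integrable (p x a) g"
  by (rule wbounded_integrable[OF _ sets_p w_integrable])

lemma wbounded_integrable_\<eta>: "wbounded g \<Longrightarrow> integrable \<eta> g"
  by (rule wbounded_integrable[OF _ sets_\<eta> w_integrable_\<eta>])

lemma integral_p_mono:
  "wbounded f \<Longrightarrow> wbounded g \<Longrightarrow> (\<And>x. x \<in> X \<Longrightarrow> f x \<le> g x) \<Longrightarrow> x \<in> X \<Longrightarrow> a \<in> A \<Longrightarrow>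
    (\<integral>y. f y \<partial>p x a) \<le> (\<integral>y. g y \<partial>p x a)"
  by (rule integral_mono) (auto simp: wbounded_integrable_p space_p)

lemma integral_\<eta>_mono:
  "wbounded f \<Longrightarrow> wbounded g \<Longrightarrow> (\<And>x. x \<in> X \<Longrightarrow> f x \<le> g x) \<Longrightarrow>
    (\<integral>y. f y \<partial>\<eta>) \<le> (\<integral>y. g y \<partial>\<eta>)"
  by (rule integral_mono) (auto simp: wbounded_integrable_\<eta> space_\<eta>)

lemma minorization_wbounded:
  assumes g: "wbounded g" "\<And>y. y \<in> X \<Longrightarrow> 0 \<le> g y" and x: "x \<in> X" "a \<in> A"
  shows "\<phi> x a * (\<integral>y. g y \<partial>\<eta>) \<le> (\<integral>y. g y \<partial>p x a)"
proof -
  obtain C where C: "0 < C" "\<And>x. x \<in> X \<Longrightarrow> \<bar>g x\<bar> \<le> C * w x" using g(1) by (metis wboundedE)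
  have "\<phi> x a * (\<integral>y. g y / C \<partial>\<eta>) \<le> (\<integral>y. g y / C \<partial>p x a)"
  proof (rule minorization[OF _ _ x])
    show "(\<lambda>y. g y / C) \<in> borel_measurable (borel_on X)"
      using wbounded_measurable[OF g(1)] by simp
    show "0 \<le> g y / C \<and> g y / C \<le> w y" if "y \<in> X" for y
      using C(1) C(2)[OF that] g(2)[OF that] by (auto simp: field_simps)
  qed
  then show ?thesis using C(1) by (simp add: field_simps)
qed

text \<open>Both \<eta> and the kernel have mass one, so the minorization of the constant 1 is the
  bound.\<close>

lemma \<phi>_le_1:
  assumes "x \<in> X" "a \<in> A" shows "\<phi> x a \<le> 1"
  using minorization_wbounded[OF wbounded_const[of 1] _ assms]
    prob_space.prob_space[OF prob_\<eta>] prob_space.prob_space[OF prob_p[OF assms]]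
  by simp

lemma integral_w_nonneg: "0 \<le> (\<integral>y. w y \<partial>\<eta>)"
  by (rule integral_nonneg_AE, rule AE_I2) (simp add: space_\<eta> w_nonneg)

text \<open>With \<phi> at most 1 the drift condition becomes affine in \<open>w\<close>; this
  majorant dominates in the interchanges of integrals below.\<close>

lemma kernel_abs_le:
  assumes g: "wbounded g" "\<And>y. y \<in> X \<Longrightarrow> \<bar>g y\<bar> \<le> C * w y" "0 \<le> C" and x: "x \<in> X" "a \<in> A"
  shows "(\<integral>y. \<bar>g y\<bar> \<partial>p x a) \<le> C * (\<alpha> * w x + (\<integral>y. w y \<partial>\<eta>))"
proof -
  have "(\<integral>y. \<bar>g y\<bar> \<partial>p x a) \<le> (\<integral>y. C * w y \<partial>p x a)"
    by (intro integral_p_mono wbounded_abs wbounded_mult wbounded_w g x)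
  also have "\<dots> = C * (\<integral>y. w y \<partial>p x a)" by simp
  also have "(\<integral>y. w y \<partial>p x a) \<le> \<alpha> * w x + (\<integral>y. w y \<partial>\<eta>)"
    using drift[OF x] mult_left_mono[OF \<phi>_le_1[OF x] integral_w_nonneg] by simp
  finally show ?thesis using \<open>0 \<le> C\<close> by (simp add: mult_left_mono)
qed

lemma kernel_integral_measurable:
  assumes "g \<in> borel_measurable (borel_on X)"
  shows "(\<lambda>(x, a). \<integral>y. g y \<partial>p x a :: real) \<in> borel_measurable (state_action_space X A)"
  using measurable_compose[OF measurable_prob_algebraD[OF kernel] integral_measurable_subprob_algebra[OF assms]]
  by (simp add: case_prod_beta')

text \<open>The integral against the substochastic kernel \<open>p - \<phi> \<eta>\<close>; in contrast to \<open>p\<close>, it is a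
  contraction for the \<open>w\<close>-norm.\<close>

definition r :: "('x \<Rightarrow> real) \<Rightarrow> 'x \<Rightarrow> 'a \<Rightarrow> real" where
  "r g x a = (\<integral>y. g y \<partial>p x a) - \<phi> x a * (\<integral>y. g y \<partial>\<eta>)"

lemma r_add:
  "wbounded f \<Longrightarrow> wbounded g \<Longrightarrow> x \<in> X \<Longrightarrow> a \<in> A \<Longrightarrow> r (\<lambda>y. f y + g y) x a = r f x a + r g x a"
  by (simp add: r_def wbounded_integrable_p wbounded_integrable_\<eta> algebra_simps)

lemma r_mult: "r (\<lambda>y. k * f y) x a = k * r f x a"
  by (simp add: r_def algebra_simps)

lemma r_diff:
  "wbounded f \<Longrightarrow> wbounded g \<Longrightarrow> x \<in> X \<Longrightarrow> a \<in> A \<Longrightarrow> r (\<lambda>y. f y - g y) x a = r f x a - r g x a"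
  by (simp add: r_def wbounded_integrable_p wbounded_integrable_\<eta> algebra_simps)

lemma r_nonneg:
  "wbounded g \<Longrightarrow> (\<And>y. y \<in> X \<Longrightarrow> 0 \<le> g y) \<Longrightarrow> x \<in> X \<Longrightarrow> a \<in> A \<Longrightarrow> 0 \<le> r g x a"
  using minorization_wbounded[of g x a] by (simp add: r_def)

lemma r_mono:
  assumes "wbounded f" "wbounded g" "\<And>y. y \<in> X \<Longrightarrow> f y \<le> g y" "x \<in> X" "a \<in> A"
  shows "r f x a \<le> r g x a"
  using r_nonneg[OF wbounded_diff[OF assms(2,1)] _ assms(4,5)] r_diff[OF assms(2,1,4,5)] assms(3) by simp

lemma r_w: "x \<in> X \<Longrightarrow> a \<in> A \<Longrightarrow> r w x a \<le> \<alpha> * w x"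
  using drift[of x a] by (simp add: r_def algebra_simps)

lemma r_le_integral:
  assumes "wbounded g" "\<And>y. y \<in> X \<Longrightarrow> 0 \<le> g y" "x \<in> X" "a \<in> A"
  shows "r g x a \<le> (\<integral>y. g y \<partial>p x a)"
proof -
  have "0 \<le> (\<integral>y. g y \<partial>\<eta>)"
    by (rule integral_nonneg_AE, rule AE_I2) (simp add: assms(2) space_\<eta>)
  then show ?thesis using \<phi>_nonneg[OF assms(3,4)] by (simp add: r_def)
qed

lemma r_le:
  assumes g: "wbounded g" "\<And>y. y \<in> X \<Longrightarrow> g y \<le> C * w y" and "0 \<le> C" and x: "x \<in> X" "a \<in> A"
  shows "r g x a \<le> C * (\<alpha> * w x)"
proof -
  have "r g x a \<le> r (\<lambda>y. C * w y) x a"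
    by (intro r_mono g x wbounded_mult wbounded_w)
  also have "\<dots> \<le> C * (\<alpha> * w x)" unfolding r_mult by (intro mult_left_mono r_w x \<open>0 \<le> C\<close>)
  finally show ?thesis .
qed

lemma abs_r_le:
  assumes g: "wbounded g" "\<And>y. y \<in> X \<Longrightarrow> \<bar>g y\<bar> \<le> C * w y" and "0 \<le> C" and x: "x \<in> X" "a \<in> A"
  shows "\<bar>r g x a\<bar> \<le> C * (\<alpha> * w x)"
proof -
  have "r g x a \<le> C * (\<alpha> * w x)"
    by (rule r_le[OF g(1) _ \<open>0 \<le> C\<close> x]) (use g(2) in force)
  moreover have "r (\<lambda>y. (-1) * g y) x a \<le> C * (\<alpha> * w x)"
    by (rule r_le[OF wbounded_mult[OF g(1)] _ \<open>0 \<le> C\<close> x]) (use g(2) in force)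
  ultimately show ?thesis unfolding r_mult by auto
qed

lemma continuous_integral:
  assumes g: "wbounded g" and x: "x \<in> X"
  shows "continuous_on A (\<lambda>a. \<integral>y. g y \<partial>p x a)"
proof -
  obtain C where C: "0 < C" "\<And>x. x \<in> X \<Longrightarrow> \<bar>g x\<bar> \<le> C * w x" using g by (metis wboundedE)
  have "continuous_on A (\<lambda>a. \<integral>y. g y / C \<partial>p x a)"
  proof (rule continuous_kernel[OF _ _ x])
    show "(\<lambda>y. g y / C) \<in> borel_measurable (borel_on X)"
      using wbounded_measurable[OF g(1)] by simp
    show "\<bar>g y / C\<bar> \<le> w y" if "y \<in> X" for y
      using C(1) C(2)[OF that] by (auto simp: field_simps)
  qed
  then have "continuous_on A (\<lambda>a. C * (\<integral>y. g y / C \<partial>p x a))" by (intro continuous_intros)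
  then show ?thesis using C(1) by simp
qed

lemma continuous_r: "wbounded g \<Longrightarrow> x \<in> X \<Longrightarrow> continuous_on A (r g x)"
  unfolding r_def by (intro continuous_intros continuous_integral continuous_\<phi>)

lemma r_measurable:
  assumes "wbounded g"
  shows "(\<lambda>(x, a). r g x a) \<in> borel_measurable (state_action_space X A)"
proof -
  show ?thesis unfolding r_def case_prod_beta'
    by (intro borel_measurable_diff borel_measurable_times borel_measurable_const
      kernel_integral_measurable[OF wbounded_measurable[OF assms], unfolded case_prod_beta']
      \<phi>_measurable[unfolded case_prod_beta'])
qed

end

subsection \<open>Fixed points of the dynamic programming operator\<close>

text \<open>Turns the infimum over all actions into a countable one. This makes the dynamic
  programming operator preserve measurability and allows near-minimizers to be taken from a
  countable set.\<close>

lemma INF_dense_subset: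
  fixes f :: "'a::metric_space \<Rightarrow> real"
  assumes f: "continuous_on A f" "bdd_below (f ` A)" and D: "D \<subseteq> A" "A \<subseteq> closure D" and "A \<noteq> {}"
  shows "(INF a\<in>D. f a) = (INF a\<in>A. f a)"
proof (rule antisym)
  have "D \<noteq> {}" using D \<open>A \<noteq> {}\<close> by auto
  then show "(INF a\<in>A. f a) \<le> (INF a\<in>D. f a)"
    by (rule cINF_superset_mono) (use f D in auto)
  show "(INF a\<in>D. f a) \<le> (INF a\<in>A. f a)"
  proof (rule cINF_greatest[OF \<open>A \<noteq> {}\<close>])
    fix a assume a: "a \<in> A"
    then obtain s where s: "\<And>n. s n \<in> D" "s \<longlonglongrightarrow> a"
      using D(2) closure_sequential[of a D] by auto
    have "(\<lambda>n. f (s n)) \<longlonglongrightarrow> f a"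
      using f(1) s a D(1) unfolding continuous_on_sequentially comp_def by blast
    moreover have "(INF a\<in>D. f a) \<le> f (s n)" for n
      by (rule cINF_lower) (use f D s in \<open>auto intro: bdd_below_mono[OF _ image_mono]\<close>)
    ultimately show "(INF a\<in>D. f a) \<le> f a" by (intro LIMSEQ_le_const) auto
  qed
qed

context weighted_mdp
begin

definition F :: "real \<Rightarrow> ('x \<Rightarrow> real) \<Rightarrow> 'x \<Rightarrow> real" where
  "F \<rho> u x = (INF a\<in>A. c x a - \<rho> + r u x a)"

lemma abs_cost_r_le:
  assumes u: "wbounded u" "\<And>y. y \<in> X \<Longrightarrow> \<bar>u y\<bar> \<le> C * w y" "0 \<le> C" and x: "x \<in> X" "a \<in> A"
  shows "\<bar>c x a - \<rho> + r u x a\<bar> \<le> (M + \<bar>\<rho>\<bar> + C * \<alpha>) * w x"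
proof -
  have "\<bar>c x a - \<rho> + r u x a\<bar> \<le> \<bar>c x a\<bar> + \<bar>\<rho>\<bar> + \<bar>r u x a\<bar>" by linarith
  also have "\<dots> \<le> M * w x + \<bar>\<rho>\<bar> * w x + C * (\<alpha> * w x)"
    using cost_bound[OF x] abs_r_le[OF u x] mult_left_mono[OF w_ge_1[OF x(1)], of "\<bar>\<rho>\<bar>"] by simp
  finally show ?thesis by (simp add: algebra_simps)
qed

lemma bdd_below_cost_r:
  assumes "wbounded u" "x \<in> X" shows "bdd_below ((\<lambda>a. c x a - \<rho> + r u x a) ` A)"
proof -
  obtain C where C: "0 < C" "\<And>x. x \<in> X \<Longrightarrow> \<bar>u x\<bar> \<le> C * w x" using assms by (metis wboundedE)
  show ?thesis
  proof (rule bdd_belowI2)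
    fix a assume "a \<in> A"
    from abs_cost_r_le[OF assms(1) C(2) less_imp_le[OF C(1)] assms(2) this, of \<rho>]
    show "- ((M + \<bar>\<rho>\<bar> + C * \<alpha>) * w x) \<le> c x a - \<rho> + r u x a" by linarith
  qed
qed

lemma F_le: "wbounded u \<Longrightarrow> x \<in> X \<Longrightarrow> a \<in> A \<Longrightarrow> F \<rho> u x \<le> c x a - \<rho> + r u x a"
  unfolding F_def by (rule cINF_lower[OF bdd_below_cost_r])

lemma F_ge: "(\<And>a. a \<in> A \<Longrightarrow> s \<le> c x a - \<rho> + r u x a) \<Longrightarrow> s \<le> F \<rho> u x"
  unfolding F_def by (rule cINF_greatest[OF A(2)])

lemma continuous_cost_r:
  "wbounded u \<Longrightarrow> x \<in> X \<Longrightarrow> continuous_on A (\<lambda>a. c x a - \<rho> + r u x a)"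
  by (intro continuous_intros continuous_cost continuous_r)

lemma cost_r_measurable:
  assumes "wbounded u" shows "(\<lambda>(x, a). c x a - \<rho> + r u x a) \<in> borel_measurable (state_action_space X A)"
  using cost_measurable r_measurable[OF assms] unfolding case_prod_beta'
  by (intro borel_measurable_diff borel_measurable_add borel_measurable_const)

lemma section_measurable:
  assumes f: "(\<lambda>(x, a). f x a) \<in> borel_measurable (state_action_space X A)" and "a \<in> A"
  shows "(\<lambda>x. f x a :: real) \<in> borel_measurable (borel_on X)"
proof -
  have "(\<lambda>x. (x, a)) \<in> borel_on X \<rightarrow>\<^sub>M state_action_space X A"
    by (intro measurable_Pair measurable_ident measurable_const) (use \<open>a \<in> A\<close> in auto)
  from measurable_compose[OF this f] show ?thesis by simp
qed

lemma F_measurable: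
  assumes u: "wbounded u" shows "F \<rho> u \<in> borel_measurable (borel_on X)"
proof -
  obtain D where D: "countable D" "D \<subseteq> A" "A \<subseteq> closure D" by (rule separable)
  have "(\<lambda>x. INF a\<in>D. c x a - \<rho> + r u x a) \<in> borel_measurable (borel_on X)"
    by (rule borel_measurable_cINF_real[OF D(1) section_measurable[OF cost_r_measurable[OF u]]])
      (use D in auto)
  moreover have "(INF a\<in>D. c x a - \<rho> + r u x a) = F \<rho> u x" if "x \<in> X" for x
    unfolding F_def
    by (rule INF_dense_subset[OF continuous_cost_r[OF u that] bdd_below_cost_r[OF u that] D(2,3) A(2)])
  ultimately show ?thesis by (subst measurable_cong[of _ _ "\<lambda>x. INF a\<in>D. c x a - \<rho> + r u x a"]) auto
qed

lemma abs_F_le: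
  assumes u: "wbounded u" "\<And>y. y \<in> X \<Longrightarrow> \<bar>u y\<bar> \<le> C * w y" "0 \<le> C" and x: "x \<in> X"
  shows "\<bar>F \<rho> u x\<bar> \<le> (M + \<bar>\<rho>\<bar> + C * \<alpha>) * w x"
proof -
  obtain a where a: "a \<in> A" using A by auto
  have "- ((M + \<bar>\<rho>\<bar> + C * \<alpha>) * w x) \<le> F \<rho> u x"
    by (rule F_ge) (use abs_cost_r_le[OF u x, of _ \<rho>] in force)
  moreover have "F \<rho> u x \<le> (M + \<bar>\<rho>\<bar> + C * \<alpha>) * w x"
    using F_le[OF u(1) x a, of \<rho>] abs_cost_r_le[OF u x a, of \<rho>] by linarith
  ultimately show ?thesis by linarith
qed

lemma wbounded_F: "wbounded u \<Longrightarrow> wbounded (F \<rho> u)"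
  by (metis wboundedE wboundedI F_measurable abs_F_le less_imp_le)

text \<open>Contraction in one-sided form: an excess of \<open>\<delta> * w\<close> shrinks by the
  factor \<alpha>. The case of \<delta> = 0 is monotonicity, so the same inequality serves both
  purposes.\<close>

lemma F_shift:
  assumes u: "wbounded u" and v: "wbounded v" and "0 \<le> \<delta>"
    and le: "\<And>y. y \<in> X \<Longrightarrow> u y \<le> v y + \<delta> * w y" and x: "x \<in> X"
  shows "F \<rho> u x \<le> F \<rho> v x + \<delta> * (\<alpha> * w x)"
proof -
  have "F \<rho> u x - \<delta> * (\<alpha> * w x) \<le> F \<rho> v x"
  proof (rule F_ge)
    fix a assume a: "a \<in> A"
    have "r u x a - r v x a \<le> \<delta> * (\<alpha> * w x)"
      using r_le[OF wbounded_diff[OF u v] _ \<open>0 \<le> \<delta>\<close> x a] le r_diff[OF u v x a]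
      by (simp add: diff_le_eq add.commute)
    then show "F \<rho> u x - \<delta> * (\<alpha> * w x) \<le> c x a - \<rho> + r v x a"
      using F_le[OF u x a, of \<rho>] by linarith
  qed
  then show ?thesis by simp
qed

lemma F_mono:
  "wbounded u \<Longrightarrow> wbounded v \<Longrightarrow> (\<And>y. y \<in> X \<Longrightarrow> u y \<le> v y) \<Longrightarrow> x \<in> X \<Longrightarrow> F \<rho> u x \<le> F \<rho> v x"
  using F_shift[of u v 0 x \<rho>] by simp

lemma geometric_bound:
  assumes "\<And>k. (s::real) \<le> t + B * \<alpha> ^ k * b" shows "s \<le> t"
proof -
  have "(\<lambda>k. t + B * \<alpha> ^ k * b) \<longlonglongrightarrow> t + B * 0 * b"
    using \<alpha> by (intro tendsto_intros LIMSEQ_power_zero) auto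
  from LIMSEQ_le_const[OF this] show ?thesis using assms by auto
qed

text \<open>A subsolution lies below a supersolution: an excess of at most
  \<open>C * \<alpha> ^ k * w\<close> of \<open>u\<close> over \<open>v\<close> improves to the next
  power after one application of \<open>F\<close>, as \<open>F\<close> raises \<open>u\<close> and
  lowers \<open>v\<close>. Uniqueness of the fixed point on \<open>X\<close> is contained in
  this.\<close>

lemma F_comparison:
  assumes u: "wbounded u" "\<And>x. x \<in> X \<Longrightarrow> u x \<le> F \<rho> u x"
    and v: "wbounded v" "\<And>x. x \<in> X \<Longrightarrow> F \<rho> v x \<le> v x" and x: "x \<in> X"
  shows "u x \<le> v x"
proof -
  obtain C where C: "0 < C" "\<And>x. x \<in> X \<Longrightarrow> \<bar>u x - v x\<bar> \<le> C * w x"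
    using wboundedE[OF wbounded_diff[OF u(1) v(1)]] by blast
  have *: "\<forall>x\<in>X. u x \<le> v x + C * \<alpha> ^ k * w x" for k
  proof (induction k)
    case 0
    have "u x \<le> v x + C * w x" if "x \<in> X" for x using abs_le_D1[OF C(2)[OF that]] by simp
    then show ?case by simp
  next
    case (Suc k)
    show ?case
    proof
      fix x assume x: "x \<in> X"
      have "F \<rho> u x \<le> F \<rho> v x + C * \<alpha> ^ k * (\<alpha> * w x)"
        by (rule F_shift[OF u(1) v(1)]) (use Suc x C \<alpha> in auto)
      then show "u x \<le> v x + C * \<alpha> ^ Suc k * w x"
        using u(2)[OF x] v(2)[OF x] by (simp add: mult.assoc mult.left_commute)
    qed
  qed
  show ?thesis by (rule geometric_bound) (use * x in blast)
qed

section \<open>Fixed points and their dependence on the parameter \<rho>\<close>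

definition is_fixed :: "real \<Rightarrow> ('x \<Rightarrow> real) \<Rightarrow> bool" where
  "is_fixed \<rho> u \<longleftrightarrow> wbounded u \<and> (\<forall>x\<in>X. F \<rho> u x = u x)"

text \<open>Monotone iteration from the lowest function of an invariant ball: the first iterate
  cannot lie below the start, so the iterates increase and converge pointwise in the reals, while
  the contraction gives a geometric rate.\<close>

lemma fixed_point_exists:
  obtains u where "is_fixed \<rho> u" "\<And>x. x \<in> X \<Longrightarrow> \<bar>u x\<bar> \<le> (M + \<bar>\<rho>\<bar>) / (1 - \<alpha>) * w x"
proof -
  \<comment> \<open>\<open>B\<close> solves
    \<open>M + \<bar>\<rho>\<bar> + B * \<alpha> = B\<close>, which makes the ball of radius
    \<open>B\<close> in the weighted norm invariant under \<open>F\<close>.\<close>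
  define B where "B = (M + \<bar>\<rho>\<bar>) / (1 - \<alpha>)"
  have B: "0 \<le> B" "M + \<bar>\<rho>\<bar> + B * \<alpha> = B"
    using M_nonneg \<alpha> unfolding B_def by (auto simp: field_simps)
  define s where "s k = (F \<rho> ^^ k) (\<lambda>x. - B * w x)" for k
  have s_Suc: "s (Suc k) = F \<rho> (s k)" for k by (simp add: s_def)
  have s: "wbounded (s k) \<and> (\<forall>x\<in>X. \<bar>s k x\<bar> \<le> B * w x)" for k
  proof (induction k)
    case 0 show ?case using B(1) w_nonneg wbounded_mult[OF wbounded_w, of "-B"] by (auto simp: s_def abs_mult)
  next
    case (Suc k)
    then show ?case using wbounded_F[of "s k" \<rho>] abs_F_le[of "s k" B _ \<rho>] B by (auto simp: s_Suc)
  qed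
  have wb: "wbounded (s k)" for k using s by blast
  have inc: "\<forall>x\<in>X. s k x \<le> s (Suc k) x" for k
  proof (induction k)
    case 0
    have "- B * w x \<le> s 1 x" if "x \<in> X" for x using s[of 1] that by (simp add: abs_le_iff minus_le_iff)
    then show ?case by (simp add: s_def)
  next
    case (Suc k)
    have "F \<rho> (s k) x \<le> F \<rho> (s (Suc k)) x" if "x \<in> X" for x
      by (rule F_mono[OF wb wb]) (use Suc that in auto)
    then show ?case by (simp add: s_Suc)
  qed
  \<comment> \<open>The factor 2 comes from the start at the bottom of the ball: later iterates are
    at most \<open>B * w\<close>, which is \<open>2 * B * w\<close> above
    \<open>s 0\<close>.\<close>
  have cauchy: "\<forall>x\<in>X. s (m + k) x \<le> s k x + 2 * B * \<alpha> ^ k * w x" for m k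
  proof (induction k)
    case 0
    show ?case
    proof
      fix x assume "x \<in> X"
      then show "s (m + 0) x \<le> s 0 x + 2 * B * \<alpha> ^ 0 * w x"
        using s[of m] abs_le_D1[of "s m x" "B * w x"] by (simp add: s_def)
    qed
  next
    case (Suc k)
    show ?case
    proof
      fix x assume x: "x \<in> X"
      have "F \<rho> (s (m + k)) x \<le> F \<rho> (s k) x + 2 * B * \<alpha> ^ k * (\<alpha> * w x)"
        by (rule F_shift[OF wb wb]) (use Suc x B \<alpha> in auto)
      then show "s (m + Suc k) x \<le> s (Suc k) x + 2 * B * \<alpha> ^ Suc k * w x"
        by (simp add: s_Suc mult.assoc mult.left_commute)
    qed
  qed
  define u where "u x = lim (\<lambda>k. s k x)" for x
  have mono: "incseq (\<lambda>k. s k x)" if "x \<in> X" for x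
    by (rule incseq_SucI) (use inc that in blast)
  have lim: "(\<lambda>k. s k x) \<longlonglongrightarrow> u x" if x: "x \<in> X" for x
  proof -
    have bd: "s k x \<le> B * w x" for k using s[of k] x by (metis abs_le_D1)
    obtain L where "(\<lambda>k. s k x) \<longlonglongrightarrow> L"
      by (rule incseq_convergent[OF mono[OF x]]) (use bd in blast)
    then show ?thesis unfolding u_def by (simp add: limI)
  qed
  have bound: "\<bar>u x\<bar> \<le> B * w x" if x: "x \<in> X" for x
    by (rule LIMSEQ_le_const2[OF tendsto_rabs[OF lim[OF x]]]) (use s x in auto)
  have "u \<in> borel_measurable (borel_on X)"
    by (rule borel_measurable_LIMSEQ_real[of _ s]) (use lim wb in \<open>auto dest: wbounded_measurable\<close>)
  then have wu: "wbounded u" by (rule wboundedI) (rule bound)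
  have le_u: "s k x \<le> u x" if "x \<in> X" for x k
    by (rule incseq_le[OF mono lim]) (use that in auto)
  have u_le: "u x \<le> s k x + 2 * B * \<alpha> ^ k * w x" if x: "x \<in> X" for x k
  proof (rule LIMSEQ_le_const2)
    show "(\<lambda>m. s (m + k) x) \<longlonglongrightarrow> u x" using lim[OF x] by (rule LIMSEQ_ignore_initial_segment)
  qed (use cauchy x in auto)
  have "F \<rho> u x = u x" if x: "x \<in> X" for x
  proof (rule antisym)
    show "u x \<le> F \<rho> u x"
    proof (rule LIMSEQ_le_const2[OF LIMSEQ_Suc[OF lim[OF x]]])
      show "\<exists>N. \<forall>n\<ge>N. s (Suc n) x \<le> F \<rho> u x"
        using F_mono[OF wb wu le_u x] by (simp add: s_Suc)
    qed
    \<comment> \<open>An infimum need not commute with an increasing limit, so monotonicity yields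
      only the other inequality. Here the geometric rate \<open>u_le\<close> replaces it.\<close>
    show "F \<rho> u x \<le> u x"
    proof (rule geometric_bound)
      fix k
      have "F \<rho> u x \<le> F \<rho> (s k) x + 2 * B * \<alpha> ^ k * (\<alpha> * w x)"
        by (rule F_shift[OF wu wb]) (use u_le x B \<alpha> in auto)
      also have "\<dots> \<le> u x + 2 * B * \<alpha> ^ k * (\<alpha> * w x)"
        using le_u[OF x, of "Suc k"] by (simp add: s_Suc)
      finally show "F \<rho> u x \<le> u x + 2 * B * \<alpha> ^ k * (\<alpha> * w x)" .
    qed
  qed
  then show ?thesis using that[of u] wu bound unfolding is_fixed_def B_def by blast
qed

lemma is_fixedD:
  assumes "is_fixed \<rho> u" shows "wbounded u" "\<And>x. x \<in> X \<Longrightarrow> F \<rho> u x = u x"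
  using assms by (auto simp: is_fixed_def)

text \<open>Both bounds are comparisons at the parameter \<rho>. Adding
  \<open>\<rho>' - \<rho>\<close> to \<open>u'\<close> gives a subsolution; adding
  \<open>\<kappa> * w\<close> gives a supersolution, with \<kappa> chosen to solve
  \<open>(\<rho>' - \<rho>) + \<kappa> * \<alpha> = \<kappa>\<close>.\<close>

lemma fixed_point_slope:
  assumes u: "is_fixed \<rho> u" and u': "is_fixed \<rho>' u'" and le: "\<rho> \<le> \<rho>'" and x: "x \<in> X"
  shows "u' x + (\<rho>' - \<rho>) \<le> u x" "u x \<le> u' x + (\<rho>' - \<rho>) / (1 - \<alpha>) * w x"
proof -
  note wu = is_fixedD(1)[OF u] is_fixedD(1)[OF u']
  define \<kappa> where "\<kappa> = (\<rho>' - \<rho>) / (1 - \<alpha>)"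
  have \<kappa>: "0 \<le> \<kappa>" "(\<rho>' - \<rho>) + \<kappa> * \<alpha> = \<kappa>"
    using le \<alpha> unfolding \<kappa>_def by (auto simp: field_simps)
  have shift: "F \<rho>' u' y + (\<rho>' - \<rho>) = F \<rho> u' y" if y: "y \<in> X" for y
  proof (rule antisym)
    show "F \<rho>' u' y + (\<rho>' - \<rho>) \<le> F \<rho> u' y"
      by (rule F_ge) (use F_le[OF wu(2) y, of _ \<rho>'] in force)
    have "F \<rho> u' y - (\<rho>' - \<rho>) \<le> F \<rho>' u' y"
      by (rule F_ge) (use F_le[OF wu(2) y, of _ \<rho>] in force)
    then show "F \<rho> u' y \<le> F \<rho>' u' y + (\<rho>' - \<rho>)" by simp
  qed
  have low: "wbounded (\<lambda>y. u' y + (\<rho>' - \<rho>))" by (intro wbounded_add wu wbounded_const)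
  have up: "wbounded (\<lambda>y. u' y + \<kappa> * w y)" by (intro wbounded_add wu wbounded_mult wbounded_w)
  show "u' x + (\<rho>' - \<rho>) \<le> u x"
  proof (rule F_comparison[OF low _ wu(1) _ x])
    fix y assume y: "y \<in> X"
    have "F \<rho> u' y \<le> F \<rho> (\<lambda>y. u' y + (\<rho>' - \<rho>)) y"
      by (rule F_mono[OF wu(2) low _ y]) (use le in auto)
    then show "u' y + (\<rho>' - \<rho>) \<le> F \<rho> (\<lambda>y. u' y + (\<rho>' - \<rho>)) y"
      using shift[OF y] is_fixedD(2)[OF u' y] by simp
  qed (use is_fixedD(2)[OF u] in auto)
  show "u x \<le> u' x + (\<rho>' - \<rho>) / (1 - \<alpha>) * w x"
    unfolding \<kappa>_def[symmetric]
  proof (rule F_comparison[OF wu(1) _ up _ x])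
    fix y assume y: "y \<in> X"
    have "F \<rho> (\<lambda>y. u' y + \<kappa> * w y) y \<le> F \<rho> u' y + \<kappa> * (\<alpha> * w y)"
      by (rule F_shift[OF up wu(2) \<kappa>(1) _ y]) simp
    also have "\<dots> = u' y + (\<rho>' - \<rho>) + \<kappa> * (\<alpha> * w y)"
      using shift[OF y] is_fixedD(2)[OF u' y] by simp
    also have "\<dots> \<le> u' y + (\<rho>' - \<rho>) * w y + \<kappa> * (\<alpha> * w y)"
      using mult_left_mono[OF w_ge_1[OF y], of "\<rho>' - \<rho>"] le by simp
    also have "\<dots> = u' y + ((\<rho>' - \<rho>) + \<kappa> * \<alpha>) * w y" by (simp add: algebra_simps)
    finally show "F \<rho> (\<lambda>y. u' y + \<kappa> * w y) y \<le> u' y + \<kappa> * w y" unfolding \<kappa>(2) .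
  qed (use is_fixedD(2)[OF u] in auto)
qed

text \<open>The first bound forces a sign change of the mean and makes its zero stable, the second
  makes the mean Lipschitz in \<rho>.\<close>

lemma integral_fixed_point_slope:
  assumes u: "is_fixed \<rho> u" and u': "is_fixed \<rho>' u'" and le: "\<rho> \<le> \<rho>'"
  shows "(\<integral>y. u' y \<partial>\<eta>) + (\<rho>' - \<rho>) \<le> (\<integral>y. u y \<partial>\<eta>)"
    "(\<integral>y. u y \<partial>\<eta>) \<le> (\<integral>y. u' y \<partial>\<eta>) + (\<rho>' - \<rho>) / (1 - \<alpha>) * (\<integral>y. w y \<partial>\<eta>)"
proof -
  note wu = is_fixedD(1)[OF u] is_fixedD(1)[OF u']
  have "(\<integral>y. u' y + (\<rho>' - \<rho>) \<partial>\<eta>) \<le> (\<integral>y. u y \<partial>\<eta>)"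
    by (intro integral_\<eta>_mono wbounded_add wu wbounded_const fixed_point_slope(1)[OF u u' le])
  then show "(\<integral>y. u' y \<partial>\<eta>) + (\<rho>' - \<rho>) \<le> (\<integral>y. u y \<partial>\<eta>)"
    using prob_space.prob_space[OF prob_\<eta>] wbounded_integrable_\<eta>[OF wu(2)]
      wbounded_integrable_\<eta>[OF wbounded_const]
    by simp
  have "(\<integral>y. u y \<partial>\<eta>) \<le> (\<integral>y. u' y + (\<rho>' - \<rho>) / (1 - \<alpha>) * w y \<partial>\<eta>)"
    by (intro integral_\<eta>_mono wbounded_add wu wbounded_mult wbounded_w fixed_point_slope(2)[OF u u' le])
  then show "(\<integral>y. u y \<partial>\<eta>) \<le> (\<integral>y. u' y \<partial>\<eta>) + (\<rho>' - \<rho>) / (1 - \<alpha>) * (\<integral>y. w y \<partial>\<eta>)"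
    using wbounded_integrable_\<eta>[OF wu(2)] w_integrable_\<eta> by simp
qed

lemma root_exists:
  obtains \<rho> u where "is_fixed \<rho> u" "(\<integral>y. u y \<partial>\<eta>) = 0"
proof -
  define U where "U \<rho> = (SOME u. is_fixed \<rho> u)" for \<rho>
  have U: "is_fixed \<rho> (U \<rho>)" for \<rho>
    unfolding U_def by (rule fixed_point_exists[of \<rho>]) (metis someI)
  define G where "G \<rho> = (\<integral>y. U \<rho> y \<partial>\<eta>)" for \<rho>
  define L where "L = (\<integral>y. w y \<partial>\<eta>) / (1 - \<alpha>)"
  have G: "G \<rho>' + (\<rho>' - \<rho>) \<le> G \<rho>" "G \<rho> \<le> G \<rho>' + (\<rho>' - \<rho>) * L" if "\<rho> \<le> \<rho>'" for \<rho> \<rho>'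
    using integral_fixed_point_slope[OF U U that] by (auto simp: G_def L_def)
  have "L \<ge> 0" unfolding L_def
    using \<alpha> by (intro divide_nonneg_pos integral_nonneg_AE AE_I2) (auto simp: space_\<eta> w_nonneg)
  have "L-lipschitz_on UNIV G"
  proof (rule lipschitz_onI[OF _ \<open>L \<ge> 0\<close>])
    fix \<rho> \<rho>' :: real
    show "dist (G \<rho>) (G \<rho>') \<le> L * dist \<rho> \<rho>'"
    proof (cases "\<rho> \<le> \<rho>'")
      case True then show ?thesis using G[OF True] by (simp add: dist_real_def mult.commute)
    next
      case False then show ?thesis using G[of \<rho>' \<rho>] by (simp add: dist_real_def mult.commute)
    qed
  qed
  then have cont: "continuous_on UNIV G" by (rule lipschitz_on_continuous_on)
  \<comment> \<open>Since \<open>G\<close> falls with slope at most -1, moving by the absolute value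
    of \<open>G 0\<close> in either direction is enough to reach or cross zero.\<close>
  have "\<exists>\<rho>\<ge>-\<bar>G 0\<bar>. \<rho> \<le> \<bar>G 0\<bar> \<and> G \<rho> = 0"
    by (rule IVT2') (use G[of 0 "\<bar>G 0\<bar>"] G[of "-\<bar>G 0\<bar>" 0] cont in \<open>auto intro: continuous_on_subset\<close>)
  then show ?thesis using that U unfolding G_def by blast
qed

text \<open>The mean at any parameter bounds the distance from this parameter to the zero. In the
  truncated model it is applied at the optimal \<rho> of the original one, so solutions at two
  different parameters need not be compared across the models.\<close>

lemma root_perturbation:
  assumes u: "is_fixed \<rho> u" "(\<integral>y. u y \<partial>\<eta>) = 0" and v: "is_fixed \<rho>' v"
  shows "\<bar>\<rho> - \<rho>'\<bar> \<le> \<bar>\<integral>y. v y \<partial>\<eta>\<bar>"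
  using integral_fixed_point_slope(1)[OF u(1) v] integral_fixed_point_slope(1)[OF v u(1)] u(2)
  by linarith

end

subsection \<open>The controlled process\<close>

locale controlled_process =
  fixes X :: "'x::polish_space set" and A :: "'a::polish_space set"
    and p :: "'x \<Rightarrow> 'a \<Rightarrow> 'x measure" and c :: "'x \<Rightarrow> 'a \<Rightarrow> real"
    and \<pi> :: "nat \<Rightarrow> (nat \<Rightarrow> 'x \<times> 'a) \<times> 'x \<Rightarrow> 'a measure" and x :: 'x
  assumes mdp: "mdp X A p c" and policy: "\<pi> \<in> policies X A" and x: "x \<in> X"
begin

sublocale IT: Ionescu_Tulcea "step_kernel X A p \<pi> x" "\<lambda>_. state_action_space X A"
  by (rule Ionescu_Tulcea_step_kernel[OF mdp policy x])

abbreviation S :: "('x \<times> 'a) measure" where "S \<equiv> state_action_space X A"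
abbreviation H :: "nat \<Rightarrow> (nat \<Rightarrow> 'x \<times> 'a) measure" where "H t \<equiv> \<Pi>\<^sub>M i\<in>{0..<t}. S"

text \<open>The empty history is \<open>\<lambda>_. undefined\<close>, the only point of
  \<open>H 0\<close>; \<open>IT.C 0 t\<close> appends the first t pairs to it.\<close>

definition history_law :: "nat \<Rightarrow> (nat \<Rightarrow> 'x \<times> 'a) measure" where
  "history_law t = IT.C 0 t (\<lambda>_. undefined)"

definition pair_law :: "nat \<Rightarrow> ('x \<times> 'a) measure" where
  "pair_law t = distr (path_measure X A p \<pi> x) S (\<lambda>\<omega>. \<omega> t)"

definition state_law :: "nat \<Rightarrow> 'x measure" where
  "state_law t = distr (pair_law t) (borel_on X) fst"

lemma spaces [simp]: "space (borel_on X) = X" "space (borel_on A) = A" "space S = X \<times> A"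
  by (simp_all add: space_restrict_space space_pair_measure)

lemma kernel: "(\<lambda>(x, a). p x a) \<in> S \<rightarrow>\<^sub>M prob_algebra (borel_on X)"
  using mdp by (simp add: mdp_def)

lemma policy_kernel: "\<pi> t \<in> H t \<Otimes>\<^sub>M borel_on X \<rightarrow>\<^sub>M prob_algebra (borel_on A)"
  using policy by (simp add: policies_def history_space_def)

lemma empty_in_H [simp]: "(\<lambda>_. undefined) \<in> space (H 0)"
  by (simp add: space_PiM)

lemma sets_history_law: "sets (history_law t) = sets (H t)"
  unfolding history_law_def using IT.sets_C[of "\<lambda>_. undefined" 0 t] by simp

lemma space_history_law: "space (history_law t) = space (H t)"
  using sets_history_law by (rule sets_eq_imp_space_eq)

lemma prob_history_law: "prob_space (history_law t)"
  unfolding history_law_def by (rule IT.prob_space_C) simp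

lemma history_law_nonempty: "space (history_law t) \<noteq> {}"
  by (rule prob_space.not_empty[OF prob_history_law])

lemma sets_path: "sets (path_measure X A p \<pi> x) = sets (\<Pi>\<^sub>M i\<in>UNIV. S)"
  unfolding path_measure_def by (rule IT.PF.sets_lim)

lemma coordinate_measurable: "(\<lambda>\<omega>. \<omega> t) \<in> path_measure X A p \<pi> x \<rightarrow>\<^sub>M S"
  unfolding measurable_cong_sets[OF sets_path refl] by (rule measurable_component_singleton) simp

lemma sets_pair_law [simp]: "sets (pair_law t) = sets S"
  by (simp add: pair_law_def)

lemma space_pair_law: "space (pair_law t) = X \<times> A"
  using sets_eq_imp_space_eq[OF sets_pair_law] by simp

text \<open>The path measure is accessible only through finite-dimensional marginals, so coordinate
  t is read off the marginal on the shortest initial segment that contains it.\<close>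

lemma pair_law_history: "pair_law t = distr (history_law (Suc t)) S (\<lambda>\<omega>. \<omega> t)"
proof -
  let ?J = "{0..<Suc t}"
  \<comment> \<open>\<open>IT.CI\<close> goes through the least bound of its index set. For an
    initial segment this is its length, so that the projection in \<open>IT.CI\<close> changes
    nothing.\<close>
  have up: "IT.up_to ?J = Suc t"
    by (rule antisym; rule ccontr)
      (use IT.up_to_iff_Ico[of ?J "Suc t"] IT.up_to[of ?J] in auto)
  have m: "(\<lambda>\<omega>. \<omega> t) \<in> H (Suc t) \<rightarrow>\<^sub>M S"
    by (rule measurable_component_singleton) simp
  have restr: "(\<lambda>\<omega>. restrict \<omega> ?J) \<in> path_measure X A p \<pi> x \<rightarrow>\<^sub>M H (Suc t)"
    unfolding measurable_cong_sets[OF sets_path refl] by (rule measurable_restrict_subset) simp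
  have "pair_law t = distr (distr (path_measure X A p \<pi> x) (H (Suc t)) (\<lambda>\<omega>. restrict \<omega> ?J)) S (\<lambda>\<omega>. \<omega> t)"
    unfolding pair_law_def by (subst distr_distr[OF m restr]) (simp add: comp_def)
  also have "distr (path_measure X A p \<pi> x) (H (Suc t)) (\<lambda>\<omega>. restrict \<omega> ?J) = IT.CI ?J"
    unfolding path_measure_def by (rule IT.distr_lim) simp
  also have "\<dots> = history_law (Suc t)"
    unfolding IT.CI_def up history_law_def
    using IT.distr_C[of "Suc t" "Suc t" "\<lambda>_. undefined" 0] by simp
  finally show ?thesis .
qed

text \<open>\<open>IT.eP t\<close> extends a history by a pair drawn from the step kernel;
  coordinate t of the extension is just that pair.\<close>

lemma pair_law_bind: "pair_law t = history_law t \<bind> step_kernel X A p \<pi> x t"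
proof -
  have m: "(\<lambda>\<omega>. \<omega> t) \<in> H (Suc t) \<rightarrow>\<^sub>M S"
    by (rule measurable_component_singleton) simp
  have eP: "IT.eP t \<in> history_law t \<rightarrow>\<^sub>M subprob_algebra (H (Suc t))"
    using IT.measurable_eP[of t] by (simp add: measurable_cong_sets[OF sets_history_law refl])
  have "pair_law t = distr (history_law t \<bind> IT.eP t) S (\<lambda>\<omega>. \<omega> t)"
    unfolding pair_law_history by (simp add: history_law_def)
  also have "\<dots> = history_law t \<bind> (\<lambda>\<omega>. distr (IT.eP t \<omega>) S (\<lambda>\<omega>. \<omega> t))"
    by (rule distr_bind[OF eP history_law_nonempty m])
  also have "\<dots> = history_law t \<bind> step_kernel X A p \<pi> x t"
  proof (rule bind_cong[OF refl])
    fix \<omega> assume "\<omega> \<in> space (history_law t)"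
    then have \<omega>: "\<omega> \<in> space (H t)" by (simp add: space_history_law)
    have u: "fun_upd \<omega> t \<in> step_kernel X A p \<pi> x t \<omega> \<rightarrow>\<^sub>M H (Suc t)"
      unfolding measurable_cong_sets[OF IT.sets_P[OF \<omega>] refl]
      by (rule measurable_fun_upd[where J="{0..<t}"]) (use \<omega> in auto)
    show "distr (IT.eP t \<omega>) S (\<lambda>\<omega>. \<omega> t) = step_kernel X A p \<pi> x t \<omega>"
      unfolding IT.eP_def by (subst distr_distr[OF m u])
        (simp add: comp_def distr_id2[OF IT.sets_P[OF \<omega>, symmetric]])
  qed
  finally show ?thesis .
qed

text \<open>The first factor of \<open>step_kernel\<close>: the conditional law of the state at time
  t, before an action is drawn.\<close>

definition next_law :: "nat \<Rightarrow> (nat \<Rightarrow> 'x \<times> 'a) \<Rightarrow> 'x measure" where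
  "next_law t \<omega> = (case t of 0 \<Rightarrow> return (borel_on X) x | Suc s \<Rightarrow> p (fst (\<omega> s)) (snd (\<omega> s)))"

lemma next_law_in:
  assumes \<omega>: "\<omega> \<in> space (H t)" shows "next_law t \<omega> \<in> space (prob_algebra (borel_on X))"
proof (cases t)
  case 0 then show ?thesis using x by (simp add: next_law_def space_prob_algebra prob_space_return)
next
  case (Suc s)
  have "\<omega> s \<in> space S" using \<omega> Suc by (auto simp: space_PiM PiE_iff)
  from measurable_space[OF kernel this] show ?thesis by (simp add: next_law_def Suc case_prod_beta)
qed

lemma policy_section:
  assumes \<omega>: "\<omega> \<in> space (H t)"
  shows "(\<lambda>y. \<pi> t (\<omega>, y)) \<in> borel_on X \<rightarrow>\<^sub>M prob_algebra (borel_on A)"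
  by (rule measurable_compose[OF _ policy_kernel]) (use \<omega> in measurable)

lemma action_kernel:
  assumes \<omega>: "\<omega> \<in> space (H t)"
  shows "(\<lambda>y. distr (\<pi> t (\<omega>, y)) S (Pair y)) \<in> borel_on X \<rightarrow>\<^sub>M prob_algebra S"
  by (rule measurable_distr_prob_space2[OF policy_section[OF \<omega>]]) simp

lemma next_law_nonempty_sets:
  assumes \<omega>: "\<omega> \<in> space (H t)"
  shows "sets (next_law t \<omega>) = sets (borel_on X)" "space (next_law t \<omega>) = X" "space (next_law t \<omega>) \<noteq> {}"
  using next_law_in[OF \<omega>] sets_eq_imp_space_eq[of "next_law t \<omega>" "borel_on X"] x
  by (auto simp: space_prob_algebra)

text \<open>The policy kernel has mass one, so drawing an action and forgetting it leaves the law of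
  the state unchanged.\<close>

lemma distr_step_kernel_fst:
  assumes \<omega>: "\<omega> \<in> space (H t)"
  shows "distr (step_kernel X A p \<pi> x t \<omega>) (borel_on X) fst = next_law t \<omega>"
proof -
  note c = next_law_nonempty_sets[OF \<omega>]
  have "distr (step_kernel X A p \<pi> x t \<omega>) (borel_on X) fst =
      next_law t \<omega> \<bind> (\<lambda>y. distr (distr (\<pi> t (\<omega>, y)) S (Pair y)) (borel_on X) fst)"
    unfolding step_kernel_def next_law_def[symmetric]
    by (rule distr_bind[where K=S])
      (use action_kernel[OF \<omega>] c in \<open>auto intro!: measurable_prob_algebraD simp: measurable_cong_sets[OF c(1) refl]\<close>)
  also have "\<dots> = next_law t \<omega> \<bind> return (borel_on X)"
  proof (rule bind_cong[OF refl])
    fix y assume "y \<in> space (next_law t \<omega>)"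
    then have y: "y \<in> X" using c by simp
    have \<pi>: "sets (\<pi> t (\<omega>, y)) = sets (borel_on A)" "prob_space (\<pi> t (\<omega>, y))"
      using measurable_space[OF policy_section[OF \<omega>], of y] y by (auto simp: space_prob_algebra)
    have "distr (distr (\<pi> t (\<omega>, y)) S (Pair y)) (borel_on X) fst = distr (\<pi> t (\<omega>, y)) (borel_on X) (\<lambda>_. y)"
      by (subst distr_distr) (use y in \<open>simp_all add: comp_def measurable_cong_sets[OF \<pi>(1) refl]\<close>)
    also have "\<dots> = return (borel_on X) y"
      by (rule prob_space.distr_const[OF \<pi>(2)]) (use y in simp)
    finally show "distr (distr (\<pi> t (\<omega>, y)) S (Pair y)) (borel_on X) fst = return (borel_on X) y" .
  qed
  also have "\<dots> = next_law t \<omega>" by (rule bind_return''[OF c(1)])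
  finally show ?thesis .
qed

lemma step_kernel_measurable: "step_kernel X A p \<pi> x t \<in> history_law t \<rightarrow>\<^sub>M subprob_algebra S"
  unfolding measurable_cong_sets[OF sets_history_law refl] by (rule IT.P)

lemma state_law_bind: "state_law t = history_law t \<bind> next_law t"
proof -
  have "state_law t = history_law t \<bind> (\<lambda>\<omega>. distr (step_kernel X A p \<pi> x t \<omega>) (borel_on X) fst)"
    unfolding state_law_def pair_law_bind
    by (rule distr_bind[OF step_kernel_measurable history_law_nonempty measurable_fst])
  also have "\<dots> = history_law t \<bind> next_law t"
    by (rule bind_cong[OF refl]) (simp add: distr_step_kernel_fst space_history_law)
  finally show ?thesis .
qed

lemma state_law_0: "state_law 0 = return (borel_on X) x"
  unfolding state_law_bind next_law_def nat.case
  by (rule bind_const'[OF prob_history_law])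
    (use x in \<open>simp add: prob_space_return prob_space_imp_subprob_space\<close>)

text \<open>A policy may use the whole history, but \<open>next_law\<close> reads only its last
  pair. The one-dimensional laws thus obey this recursion for every policy, and no joint law is
  needed for expected costs.\<close>

lemma state_law_Suc: "state_law (Suc t) = pair_law t \<bind> (\<lambda>(x, a). p x a)"
proof -
  have m: "(\<lambda>\<omega>. \<omega> t) \<in> history_law (Suc t) \<rightarrow>\<^sub>M S"
    unfolding measurable_cong_sets[OF sets_history_law refl] by (rule measurable_component_singleton) simp
  show ?thesis
    unfolding state_law_bind pair_law_history
      bind_distr[OF m measurable_prob_algebraD[OF kernel] history_law_nonempty]
    by (simp add: next_law_def[abs_def] case_prod_beta)
qed

lemma path_prob: "prob_space (path_measure X A p \<pi> x)"
proof -
  \<comment> \<open>Projection to the empty index set preserves the total mass, and there the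
    marginal is known to be a probability measure.\<close>
  have "prob_space (distr (path_measure X A p \<pi> x) (H 0) (\<lambda>\<omega>. restrict \<omega> {0..<0}))"
    unfolding path_measure_def by (subst IT.distr_lim) (auto intro: IT.PF.prob_space_P)
  then show ?thesis
    by (rule prob_space_distrD[rotated])
      (unfold measurable_cong_sets[OF sets_path refl], rule measurable_restrict_subset, simp)
qed

lemma pair_law_in: "pair_law t \<in> space (prob_algebra S)"
  using prob_space.prob_space_distr[OF path_prob coordinate_measurable]
  by (simp add: space_prob_algebra pair_law_def)

lemma sets_state_law: "sets (state_law t) = sets (borel_on X)"
  by (simp add: state_law_def)

lemma prob_state_law: "prob_space (state_law t)"
  unfolding state_law_def
  by (rule prob_space.prob_space_distr)
    (use pair_law_in[of t] in \<open>auto simp: space_prob_algebra measurable_cong_sets[OF sets_pair_law refl]\<close>)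

text \<open>Under a stationary deterministic policy the pairs live on the graph of \<open>f\<close>,
  and near-optimality of the chosen actions is available only there.\<close>

lemma pair_law_deterministic:
  assumes \<pi>: "\<And>t \<omega> y. y \<in> X \<Longrightarrow> \<pi> t (\<omega>, y) = return (borel_on A) (f y)"
    and f: "f \<in> borel_on X \<rightarrow>\<^sub>M borel_on A"
  shows "pair_law t = distr (state_law t) S (\<lambda>y. (y, f y))"
proof -
  have g: "(\<lambda>y. (y, f y)) \<in> borel_on X \<rightarrow>\<^sub>M S" using f by measurable
  have "step_kernel X A p \<pi> x t \<omega> = distr (next_law t \<omega>) S (\<lambda>y. (y, f y))" if \<omega>: "\<omega> \<in> space (H t)" for \<omega>
  proof -
    note c = next_law_nonempty_sets[OF \<omega>]
    have "step_kernel X A p \<pi> x t \<omega> = next_law t \<omega> \<bind> (\<lambda>y. return S (y, f y))"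
      unfolding step_kernel_def next_law_def[symmetric]
    proof (rule bind_cong[OF refl])
      fix y assume "y \<in> space (next_law t \<omega>)"
      then have y: "y \<in> X" using c by simp
      show "distr (\<pi> t (\<omega>, y)) S (Pair y) = return S (y, f y)"
        unfolding \<pi>[OF y] by (rule distr_return) (use y measurable_space[OF f, of y] in auto)
    qed
    also have "\<dots> = distr (next_law t \<omega>) S (\<lambda>y. (y, f y))"
      by (rule bind_return_distr'[OF c(3)]) (use g in \<open>simp add: measurable_cong_sets[OF c(1) refl]\<close>)
    finally show ?thesis .
  qed
  then have "pair_law t = history_law t \<bind> (\<lambda>\<omega>. distr (next_law t \<omega>) S (\<lambda>y. (y, f y)))"
    unfolding pair_law_bind by (intro bind_cong[OF refl]) (simp add: space_history_law)
  \<comment> \<open>Expressing \<open>next_law\<close> as the state marginal of the step kernel lets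
    the map onto the graph be pulled out of the mixture over histories.\<close>
  also have "\<dots> = history_law t \<bind> (\<lambda>\<omega>. distr (distr (step_kernel X A p \<pi> x t \<omega>) (borel_on X) fst) S (\<lambda>y. (y, f y)))"
    by (intro bind_cong[OF refl]) (simp add: space_history_law distr_step_kernel_fst)
  also have "\<dots> = history_law t \<bind> (\<lambda>\<omega>. distr (step_kernel X A p \<pi> x t \<omega>) S (\<lambda>z. (fst z, f (fst z))))"
  proof (rule bind_cong[OF refl])
    fix \<omega> assume "\<omega> \<in> space (history_law t)"
    then have \<omega>: "\<omega> \<in> space (H t)" by (simp add: space_history_law)
    show "distr (distr (step_kernel X A p \<pi> x t \<omega>) (borel_on X) fst) S (\<lambda>y. (y, f y)) =
        distr (step_kernel X A p \<pi> x t \<omega>) S (\<lambda>z. (fst z, f (fst z)))"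
      by (subst distr_distr[OF g]) (simp_all add: comp_def measurable_cong_sets[OF IT.sets_P[OF \<omega>] refl])
  qed
  also have "\<dots> = distr (pair_law t) S (\<lambda>z. (fst z, f (fst z)))"
    unfolding pair_law_bind
    by (rule distr_bind[OF step_kernel_measurable history_law_nonempty, symmetric])
      (rule measurable_compose[OF measurable_fst g])
  also have "\<dots> = distr (state_law t) S (\<lambda>y. (y, f y))"
    unfolding state_law_def
    by (subst distr_distr[OF g]) (simp_all add: comp_def measurable_cong_sets[OF sets_pair_law refl])
  finally show ?thesis .
qed

lemma expected_cost_sum:
  assumes "\<And>t. integrable (pair_law t) (\<lambda>(x, a). c x a)"
  shows "expected_cost X A p c \<pi> x T = (\<Sum>t<T. \<integral>(x, a). c x a \<partial>pair_law t)"
proof -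
  have c: "(\<lambda>(x, a). c x a) \<in> borel_measurable S" using mdp by (simp add: mdp_def)
  have "integrable (path_measure X A p \<pi> x) (\<lambda>\<omega>. c (fst (\<omega> t)) (snd (\<omega> t)))" for t
    using assms[of t] integrable_distr_eq[OF coordinate_measurable c] by (simp add: pair_law_def case_prod_beta)
  moreover have "(\<integral>(x, a). c x a \<partial>pair_law t) = (\<integral>\<omega>. c (fst (\<omega> t)) (snd (\<omega> t)) \<partial>path_measure X A p \<pi> x)" for t
    unfolding pair_law_def by (subst integral_distr[OF coordinate_measurable c]) (simp add: case_prod_beta)
  ultimately show ?thesis unfolding expected_cost_def by (subst Bochner_Integration.integral_sum) auto
qed

end

subsection \<open>The optimality equation\<close>

context weighted_mdp
begin

text \<open>Everything rests on one induction: integrability of \<open>w\<close> at time t gives all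
  identities at t and integrability at t + 1. With L for the \<eta>-mean of \<open>w\<close>, the
  map from s to \<open>\<alpha> * s + L\<close> keeps values below
  \<open>w x + L / (1 - \<alpha>)\<close> in this range, so the bound is uniform in time.\<close>

lemma process_integrals:
  assumes \<pi>: "\<pi> \<in> policies X A" and x: "x \<in> X" and h: "wbounded h"
    and m: "m = controlled_process.state_law X A p \<pi> x" and \<mu>: "\<mu> = controlled_process.pair_law X A p \<pi> x"
  shows "(\<integral>y. w y \<partial>m t) \<le> w x + (\<integral>y. w y \<partial>\<eta>) / (1 - \<alpha>)"
    and "integrable (m t) w"
    and "integrable (\<mu> t) (\<lambda>z. h (fst z))" "(\<integral>z. h (fst z) \<partial>\<mu> t) = (\<integral>y. h y \<partial>m t)"
    and "integrable (\<mu> t) (\<lambda>z. \<integral>y. h y \<partial>p (fst z) (snd z))"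
    and "(\<integral>z. (\<integral>y. h y \<partial>p (fst z) (snd z)) \<partial>\<mu> t) = (\<integral>y. h y \<partial>m (Suc t))"
    and "integrable (\<mu> t) (\<lambda>z. c (fst z) (snd z))"
proof -
  interpret P: controlled_process X A p c \<pi> x by unfold_locales (use mdp \<pi> x in auto)
  define L where "L = (\<integral>y. w y \<partial>\<eta>)"
  have L: "0 \<le> L" unfolding L_def by (rule integral_w_nonneg)
  have fst: "fst \<in> \<mu> t \<rightarrow>\<^sub>M borel_on X" for t
    unfolding \<mu> measurable_cong_sets[OF P.sets_pair_law refl] by (rule measurable_fst)
  have mt: "m t = distr (\<mu> t) (borel_on X) fst" for t unfolding m \<mu> by (rule P.state_law_def)
  have pair: "integrable (\<mu> t) (\<lambda>z. g (fst z))" "(\<integral>z. g (fst z) \<partial>\<mu> t) = (\<integral>y. g y \<partial>m t)"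
    if "integrable (m t) w" "wbounded g" for t g
  proof -
    have g: "integrable (m t) g"
      by (rule wbounded_integrable[OF that(2) _ that(1)]) (simp add: m P.sets_state_law)
    show "integrable (\<mu> t) (\<lambda>z. g (fst z))"
      using g unfolding mt integrable_distr_eq[OF fst wbounded_measurable[OF that(2)]] .
    show "(\<integral>z. g (fst z) \<partial>\<mu> t) = (\<integral>y. g y \<partial>m t)"
      unfolding mt by (rule integral_distr[OF fst wbounded_measurable[OF that(2)], symmetric])
  qed
  have step: "integrable (m (Suc t)) g" "(\<integral>y. g y \<partial>m (Suc t)) = (\<integral>z. (\<integral>y. g y \<partial>p (fst z) (snd z)) \<partial>\<mu> t)"
    "integrable (\<mu> t) (\<lambda>z. \<integral>y. g y \<partial>p (fst z) (snd z))"
    if w: "integrable (m t) w" and g: "wbounded g" for t g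
  proof -
    obtain C where C: "0 < C" "\<And>x. x \<in> X \<Longrightarrow> \<bar>g x\<bar> \<le> C * w x" using g by (metis wboundedE)
    have "wbounded (\<lambda>y. C * (\<alpha> * w y + L))"
      by (intro wbounded_mult wbounded_add wbounded_w wbounded_const)
    note int = pair(1)[OF w this]
    have *: "(case z of (x, a) \<Rightarrow> p x a) = p (fst z) (snd z)" for z by (simp add: case_prod_beta)
    have le: "(\<integral>y. \<bar>g y\<bar> \<partial>(case z of (x, a) \<Rightarrow> p x a)) \<le> C * (\<alpha> * w (fst z) + L)"
      if "z \<in> space (state_action_space X A)" for z
      unfolding * L_def by (rule kernel_abs_le[OF g C(2)]) (use C that in auto)
    have gi: "integrable (case z of (x, a) \<Rightarrow> p x a) g" if "z \<in> space (state_action_space X A)" for z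
      using that wbounded_integrable_p[OF g] by auto
    note b = bind_integral[OF P.pair_law_in kernel wbounded_measurable[OF g] gi int[unfolded \<mu>] le]
    show "integrable (m (Suc t)) g" "(\<integral>y. g y \<partial>m (Suc t)) = (\<integral>z. (\<integral>y. g y \<partial>p (fst z) (snd z)) \<partial>\<mu> t)"
      "integrable (\<mu> t) (\<lambda>z. \<integral>y. g y \<partial>p (fst z) (snd z))"
      using b unfolding m \<mu> P.state_law_Suc * by auto
  qed
  have main: "integrable (m t) w \<and> (\<integral>y. w y \<partial>m t) \<le> w x + L / (1 - \<alpha>)" for t
  proof (induction t)
    case 0
    have m0: "m 0 = return (borel_on X) x" unfolding m by (rule P.state_law_0)
    have "integrable (return (borel_on X) x) w"
      using x w_measurable by (simp add: integrable_iff_bounded nn_integral_return)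
    moreover have "(\<integral>y. w y \<partial>return (borel_on X) x) = w x"
      by (rule integral_return) (use x w_measurable in auto)
    ultimately show ?case using L \<alpha> by (simp add: m0)
  next
    case (Suc t)
    have "(\<integral>y. w y \<partial>m (Suc t)) = (\<integral>z. (\<integral>y. w y \<partial>p (fst z) (snd z)) \<partial>\<mu> t)"
      using step(2)[OF _ wbounded_w] Suc by blast
    also have "\<dots> \<le> (\<integral>z. \<alpha> * w (fst z) + L \<partial>\<mu> t)"
    proof (rule integral_mono)
      show "integrable (\<mu> t) (\<lambda>z. \<integral>y. w y \<partial>p (fst z) (snd z))" using step(3)[OF _ wbounded_w] Suc by blast
      show "integrable (\<mu> t) (\<lambda>z. \<alpha> * w (fst z) + L)"
        using Suc by (intro pair(1)[of t "\<lambda>y. \<alpha> * w y + L"] wbounded_mult wbounded_add wbounded_w wbounded_const) auto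
      fix z assume "z \<in> space (\<mu> t)"
      then have z: "fst z \<in> X" "snd z \<in> A" by (auto simp: \<mu> P.space_pair_law)
      show "(\<integral>y. w y \<partial>p (fst z) (snd z)) \<le> \<alpha> * w (fst z) + L"
        using drift[OF z] mult_left_mono[OF \<phi>_le_1[OF z] L] by (simp add: L_def)
    qed
    also have "\<dots> = (\<integral>y. \<alpha> * w y + L \<partial>m t)"
      using Suc by (intro pair(2)[of t "\<lambda>y. \<alpha> * w y + L"] wbounded_mult wbounded_add wbounded_w wbounded_const) auto
    also have "\<dots> = \<alpha> * (\<integral>y. w y \<partial>m t) + L"
    proof -
      interpret prob_space "m t" unfolding m by (rule P.prob_state_law)
      show ?thesis using Suc by (simp add: prob_space)
    qed
    also have "\<dots> \<le> \<alpha> * (w x + L / (1 - \<alpha>)) + L" using Suc \<alpha> by (intro add_right_mono mult_left_mono) auto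
    also have "\<dots> = \<alpha> * w x + L / (1 - \<alpha>)" using \<alpha> by (simp add: field_simps)
    also have "\<dots> \<le> w x + L / (1 - \<alpha>)" using \<alpha> w_nonneg[OF x] by (simp add: mult_left_le_one_le)
    finally show ?case using step(1)[OF _ wbounded_w] Suc by blast
  qed
  then have w: "integrable (m t) w" for t by blast
  then show "integrable (m t) w" .
  show "(\<integral>y. w y \<partial>m t) \<le> w x + (\<integral>y. w y \<partial>\<eta>) / (1 - \<alpha>)" using main unfolding L_def by blast
  show "integrable (\<mu> t) (\<lambda>z. h (fst z))" "(\<integral>z. h (fst z) \<partial>\<mu> t) = (\<integral>y. h y \<partial>m t)"
    using pair[OF w h] by auto
  show "integrable (\<mu> t) (\<lambda>z. \<integral>y. h y \<partial>p (fst z) (snd z))"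
    "(\<integral>z. (\<integral>y. h y \<partial>p (fst z) (snd z)) \<partial>\<mu> t) = (\<integral>y. h y \<partial>m (Suc t))"
    using step[OF w h] by auto
  show "integrable (\<mu> t) (\<lambda>z. c (fst z) (snd z))"
  proof (rule Bochner_Integration.integrable_bound)
    show "integrable (\<mu> t) (\<lambda>z. M * w (fst z))" using pair(1)[OF w wbounded_w] by simp
    show "(\<lambda>z. c (fst z) (snd z)) \<in> borel_measurable (\<mu> t)"
      using cost_measurable unfolding \<mu> measurable_cong_sets[OF P.sets_pair_law refl] case_prod_beta' .
    show "AE z in \<mu> t. norm (c (fst z) (snd z)) \<le> norm (M * w (fst z))"
    proof (rule AE_I2)
      fix z assume "z \<in> space (\<mu> t)"
      then have "fst z \<in> X" "snd z \<in> A" by (auto simp: \<mu> P.space_pair_law)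
      then show "norm (c (fst z) (snd z)) \<le> norm (M * w (fst z))"
        using cost_bound[of "fst z" "snd z"] abs_ge_self[of "M * w (fst z)"] by simp
    qed
  qed
qed

text \<open>One-stage cost corrected by the drift of \<open>u\<close>; the identity
  \<open>gap u = \<rho>\<close> is the Poisson equation. For the solution of the optimality
  equation, the excess over \<rho> is the loss caused by an action.\<close>

definition gap :: "('x \<Rightarrow> real) \<Rightarrow> 'x \<times> 'a \<Rightarrow> real" where
  "gap u z = c (fst z) (snd z) + (\<integral>y. u y \<partial>p (fst z) (snd z)) - u (fst z)"

text \<open>The corrections telescope to the means of \<open>u\<close> under the first and the last
  state law. The weighted bound keeps these bounded in T, so they disappear from the
  average.\<close>

lemma expected_cost_telescope:
  assumes \<pi>: "\<pi> \<in> policies X A" and x: "x \<in> X" and u: "wbounded u"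
    and \<mu>: "\<mu> = controlled_process.pair_law X A p \<pi> x"
  shows "integrable (\<mu> t) (gap u)"
    and "\<exists>D. \<forall>T. \<bar>expected_cost X A p c \<pi> x T - (\<Sum>t<T. \<integral>z. gap u z \<partial>\<mu> t)\<bar> \<le> D"
proof -
  interpret P: controlled_process X A p c \<pi> x by unfold_locales (use mdp \<pi> x in auto)
  note I = process_integrals[OF \<pi> x u refl \<mu>]
  define U where "U t = (\<integral>y. u y \<partial>P.state_law t)" for t
  define Q where "Q t = (\<integral>z. c (fst z) (snd z) \<partial>\<mu> t)" for t
  have E: "expected_cost X A p c \<pi> x T = (\<Sum>t<T. Q t)" for T
    unfolding Q_def by (subst P.expected_cost_sum) (use I(7) in \<open>auto simp: \<mu> case_prod_beta'\<close>)
  have R: "integrable (\<mu> t) (gap u)" "(\<integral>z. gap u z \<partial>\<mu> t) = Q t + U (Suc t) - U t" for t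
    unfolding gap_def[abs_def] Q_def U_def using I(3,4,5,6,7) by simp_all
  show "integrable (\<mu> t) (gap u)" by (rule R)
  have sum: "(\<Sum>t<T. Q t) = (\<Sum>t<T. \<integral>z. gap u z \<partial>\<mu> t) + U 0 - U T" for T
    by (induction T) (auto simp: R(2))
  obtain C where C: "0 < C" "\<And>x. x \<in> X \<Longrightarrow> \<bar>u x\<bar> \<le> C * w x" using u by (metis wboundedE)
  define D where "D = C * (w x + (\<integral>y. w y \<partial>\<eta>) / (1 - \<alpha>))"
  have U: "\<bar>U t\<bar> \<le> D" for t
  proof -
    have "\<bar>U t\<bar> \<le> (\<integral>y. \<bar>u y\<bar> \<partial>P.state_law t)" unfolding U_def by (rule integral_abs_bound)
    also have "\<dots> \<le> (\<integral>y. C * w y \<partial>P.state_law t)"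
    proof (rule integral_mono)
      show "integrable (P.state_law t) (\<lambda>y. \<bar>u y\<bar>)"
        by (rule wbounded_integrable[OF wbounded_abs[OF u] P.sets_state_law I(2)])
    qed (use I(2) C sets_eq_imp_space_eq[OF P.sets_state_law] in auto)
    also have "\<dots> \<le> D" using I(1) C(1) by (simp add: D_def)
    finally show ?thesis .
  qed
  have "\<bar>U 0 - U T\<bar> \<le> 2 * D" for T using U[of 0] U[of T] by linarith
  moreover have "expected_cost X A p c \<pi> x T - (\<Sum>t<T. \<integral>z. gap u z \<partial>\<mu> t) = U 0 - U T" for T
    unfolding E sum by simp
  ultimately show "\<exists>D. \<forall>T. \<bar>expected_cost X A p c \<pi> x T - (\<Sum>t<T. \<integral>z. gap u z \<partial>\<mu> t)\<bar> \<le> D"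
    by metis
qed

lemma limsup_average: "limsup (\<lambda>T. ereal (\<rho> + D / real T)) = ereal \<rho>"
proof -
  have "(\<lambda>T. \<rho> + D / real T) \<longlonglongrightarrow> \<rho> + 0" by (intro tendsto_intros lim_const_over_n)
  then show ?thesis by (intro lim_imp_Limsup) auto
qed

section \<open>From the optimality equation to the value function\<close>

lemma average_cost_ge:
  assumes \<pi>: "\<pi> \<in> policies X A" and x: "x \<in> X" and u: "wbounded u"
    and le: "\<And>y a. y \<in> X \<Longrightarrow> a \<in> A \<Longrightarrow> \<rho> \<le> gap u (y, a)"
  shows "ereal \<rho> \<le> average_cost X A p c \<pi> x"
proof -
  interpret P: controlled_process X A p c \<pi> x by unfold_locales (use mdp \<pi> x in auto)
  note E = expected_cost_telescope[OF \<pi> x u refl]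
  obtain D where D: "\<And>T. \<bar>expected_cost X A p c \<pi> x T - (\<Sum>t<T. \<integral>z. gap u z \<partial>P.pair_law t)\<bar> \<le> D"
    using E(2) by blast
  have prob: "prob_space (P.pair_law t)" for t using P.pair_law_in[of t] by (simp add: space_prob_algebra)
  have "\<rho> \<le> (\<integral>z. gap u z \<partial>P.pair_law t)" for t
    by (rule prob_space.integral_ge_const[OF prob E(1)], rule AE_I2)
      (auto simp: P.space_pair_law intro: le)
  then have sum: "\<rho> * real T \<le> (\<Sum>t<T. \<integral>z. gap u z \<partial>P.pair_law t)" for T
    using sum_mono[of "{..<T}" "\<lambda>_. \<rho>"] by (simp add: mult.commute)
  then have low: "\<rho> * real T - D \<le> expected_cost X A p c \<pi> x T" for T
    using D[of T] sum[of T] by linarith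
  have "ereal \<rho> = limsup (\<lambda>T. ereal (\<rho> + (- D) / real T))" by (rule limsup_average[symmetric])
  also have "\<dots> \<le> average_cost X A p c \<pi> x"
    unfolding average_cost_def
  proof (rule Limsup_mono, rule eventually_sequentiallyI[of 1])
    fix T :: nat assume "1 \<le> T"
    then show "ereal (\<rho> + (- D) / real T) \<le> ereal (1 / real T * expected_cost X A p c \<pi> x T)"
      using divide_right_mono[OF low[of T], of "real T"] by (simp add: diff_divide_distrib)
  qed
  finally show ?thesis .
qed

lemma average_cost_le:
  assumes \<pi>: "\<pi> \<in> policies X A" and x: "x \<in> X" and u: "wbounded u"
    and f: "f \<in> borel_on X \<rightarrow>\<^sub>M borel_on A" "\<And>t \<omega> y. y \<in> X \<Longrightarrow> \<pi> t (\<omega>, y) = return (borel_on A) (f y)"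
    and le: "\<And>y. y \<in> X \<Longrightarrow> gap u (y, f y) \<le> \<rho>"
  shows "average_cost X A p c \<pi> x \<le> ereal \<rho>"
proof -
  interpret P: controlled_process X A p c \<pi> x by unfold_locales (use mdp \<pi> x in auto)
  note E = expected_cost_telescope[OF \<pi> x u refl]
  obtain D where D: "\<And>T. \<bar>expected_cost X A p c \<pi> x T - (\<Sum>t<T. \<integral>z. gap u z \<partial>P.pair_law t)\<bar> \<le> D"
    using E(2) by blast
  have prob: "prob_space (P.pair_law t)" for t using P.pair_law_in[of t] by (simp add: space_prob_algebra)
  have det: "P.pair_law t = distr (P.state_law t) (state_action_space X A) (\<lambda>y. (y, f y))" for t
    by (rule P.pair_law_deterministic[OF f(2,1)])
  have m: "(\<lambda>y. (y, f y)) \<in> P.state_law t \<rightarrow>\<^sub>M state_action_space X A" for t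
    unfolding measurable_cong_sets[OF P.sets_state_law refl] using f(1) by measurable
  \<comment> \<open>The bound on \<open>gap u\<close> holds only on the graph of \<open>f\<close>,
    so it is carried to the pair law as an almost-sure statement, which requires a measurable
    sublevel set.\<close>
  have "gap u \<in> borel_measurable (state_action_space X A)"
    using borel_measurable_integrable[OF E(1)] unfolding measurable_cong_sets[OF P.sets_pair_law refl] .
  then have "{z \<in> space (state_action_space X A). gap u z \<le> \<rho>} \<in> sets (state_action_space X A)"
    by measurable
  note AE_distr_iff[OF m this]
  moreover have "AE y in P.state_law t. gap u (y, f y) \<le> \<rho>" for t
    by (rule AE_I2) (use sets_eq_imp_space_eq[OF P.sets_state_law, of t] in \<open>simp add: le\<close>)
  ultimately have "AE z in P.pair_law t. gap u z \<le> \<rho>" for t unfolding det[of t] by simp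
  then have "(\<integral>z. gap u z \<partial>P.pair_law t) \<le> \<rho>" for t
    by (rule prob_space.integral_le_const[OF prob E(1)])
  then have sum: "(\<Sum>t<T. \<integral>z. gap u z \<partial>P.pair_law t) \<le> \<rho> * real T" for T
    using sum_mono[of "{..<T}" _ "\<lambda>_. \<rho>"] by (simp add: mult.commute)
  then have up: "expected_cost X A p c \<pi> x T \<le> \<rho> * real T + D" for T
    using D[of T] sum[of T] by linarith
  have "average_cost X A p c \<pi> x \<le> limsup (\<lambda>T. ereal (\<rho> + D / real T))"
    unfolding average_cost_def
  proof (rule Limsup_mono, rule eventually_sequentiallyI[of 1])
    fix T :: nat assume "1 \<le> T"
    then show "ereal (1 / real T * expected_cost X A p c \<pi> x T) \<le> ereal (\<rho> + D / real T)"
      using divide_right_mono[OF up[of T], of "real T"] by (simp add: add_divide_distrib)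
  qed
  also have "\<dots> = ereal \<rho>" by (rule limsup_average)
  finally show ?thesis .
qed

text \<open>Takes the first near-optimal action in an enumeration of a countable dense set.
  Measurability then reduces to that of a least index, and an error of \<epsilon> is harmless for an
  infimum over policies.\<close>

lemma near_optimal_selector:
  assumes u: "is_fixed \<rho> u" and "0 < \<epsilon>"
  obtains f where "f \<in> borel_on X \<rightarrow>\<^sub>M borel_on A"
    "\<And>y. y \<in> X \<Longrightarrow> c y (f y) - \<rho> + r u y (f y) < u y + \<epsilon>"
proof -
  note wu = is_fixedD(1)[OF u]
  obtain D where D: "countable D" "D \<subseteq> A" "A \<subseteq> closure D" by (rule separable)
  have ne: "D \<noteq> {}" using D A by auto
  define d where "d = from_nat_into D"
  have d: "d k \<in> D" "d k \<in> A" for k using from_nat_into[OF ne] D by (auto simp: d_def)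
  define Q where "Q k y \<longleftrightarrow> c y (d k) - \<rho> + r u y (d k) < u y + \<epsilon>" for k y
  have ex: "\<exists>k. Q k y" if y: "y \<in> X" for y
  proof -
    have "(INF a\<in>D. c y a - \<rho> + r u y a) = u y"
      using INF_dense_subset[OF continuous_cost_r[OF wu y] bdd_below_cost_r[OF wu y] D(2,3) A(2)]
        is_fixedD(2)[OF u y] by (simp add: F_def)
    then have "(INF a\<in>D. c y a - \<rho> + r u y a) < u y + \<epsilon>" using \<open>0 < \<epsilon>\<close> by simp
    then obtain a where a: "a \<in> D" "c y a - \<rho> + r u y a < u y + \<epsilon>"
      using cInf_lessD[of "(\<lambda>a. c y a - \<rho> + r u y a) ` D"] ne by blast
    then show ?thesis using from_nat_into_surj[OF D(1) a(1)] unfolding Q_def d_def by metis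
  qed
  define f where "f y = d (LEAST k. Q k y)" for y
  have "Measurable.pred (borel_on X) (Q k)" for k
    unfolding Q_def
    by (intro borel_measurable_pred_less section_measurable[OF cost_r_measurable[OF wu]]
      borel_measurable_add borel_measurable_const wbounded_measurable[OF wu] d)
  then have "(\<lambda>y. LEAST k. Q k y) \<in> borel_on X \<rightarrow>\<^sub>M count_space UNIV" by (rule measurable_Least)
  then have "f \<in> borel_on X \<rightarrow>\<^sub>M borel_on A"
    unfolding f_def by (rule measurable_compose) (simp add: measurable_count_space_eq1 d)
  moreover have "c y (f y) - \<rho> + r u y (f y) < u y + \<epsilon>" if "y \<in> X" for y
    using LeastI_ex[OF ex[OF that]] unfolding f_def Q_def .
  ultimately show ?thesis using that by blast
qed

text \<open>No optimal policy is constructed. Every policy costs at least \<rho>, because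
  \<open>gap u\<close> is at least \<rho> at every pair; the stationary policies of near-optimal
  selectors come within any \<epsilon> of it.\<close>

theorem value_function_constant:
  assumes u: "is_fixed \<rho> u" "(\<integral>y. u y \<partial>\<eta>) = 0" and x: "x \<in> X"
  shows "value_function X A p c x = ereal \<rho>"
proof (rule antisym)
  note wu = is_fixedD(1)[OF u(1)]
  have r: "gap u (y, a) - \<rho> = c y a - \<rho> + r u y a - u y" for y a
    using u(2) by (simp add: r_def gap_def)
  show "ereal \<rho> \<le> value_function X A p c x"
    unfolding value_function_def
  proof (rule INF_greatest, rule average_cost_ge[OF _ x wu])
    fix y a assume "y \<in> X" "a \<in> A"
    then show "\<rho> \<le> gap u (y, a)"
      using F_le[OF wu, of y a \<rho>] is_fixedD(2)[OF u(1)] r[of y a] by simp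
  qed
  show "value_function X A p c x \<le> ereal \<rho>"
  proof (rule ereal_le_epsilon2)
    fix \<epsilon> :: real assume "0 < \<epsilon>"
    obtain f where f: "f \<in> borel_on X \<rightarrow>\<^sub>M borel_on A"
      "\<And>y. y \<in> X \<Longrightarrow> c y (f y) - \<rho> + r u y (f y) < u y + \<epsilon>"
      using near_optimal_selector[OF u(1) \<open>0 < \<epsilon>\<close>] by blast
    define \<pi> :: "nat \<Rightarrow> (nat \<Rightarrow> 'x \<times> 'a) \<times> 'x \<Rightarrow> 'a measure"
      where "\<pi> t z = return (borel_on A) (f (snd z))" for t z
    have \<pi>: "\<pi> \<in> policies X A"
      unfolding policies_def history_space_def \<pi>_def
      by (intro CollectI allI measurable_compose[OF measurable_compose[OF measurable_snd f(1)]
        measurable_return_prob_space])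
    have "value_function X A p c x \<le> average_cost X A p c \<pi> x"
      unfolding value_function_def by (rule INF_lower[OF \<pi>])
    also have "\<dots> \<le> ereal (\<rho> + \<epsilon>)"
    proof (rule average_cost_le[OF \<pi> x wu f(1)])
      fix y assume "y \<in> X"
      then show "gap u (y, f y) \<le> \<rho> + \<epsilon>" using f(2)[of y] r[of y "f y"] by simp
    qed (simp add: \<pi>_def)
    finally show "value_function X A p c x \<le> ereal \<rho> + ereal \<epsilon>" by simp
  qed
qed

end

subsection \<open>The truncated model\<close>

text \<open>Needed for the states outside the truncation set, where cost, minorant and kernel are
  averages over a fixed measure and must remain continuous in the action.\<close>

lemma continuous_on_integral_dominated:
  fixes f :: "'a::metric_space \<Rightarrow> 'b \<Rightarrow> real"
  assumes f: "\<And>a. a \<in> A \<Longrightarrow> f a \<in> borel_measurable N" "\<And>z. z \<in> space N \<Longrightarrow> continuous_on A (\<lambda>a. f a z)"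
    and h: "integrable N h" "\<And>a z. a \<in> A \<Longrightarrow> z \<in> space N \<Longrightarrow> \<bar>f a z\<bar> \<le> h z"
  shows "continuous_on A (\<lambda>a. \<integral>z. f a z \<partial>N)"
  unfolding continuous_on_sequentially
proof (intro allI ballI impI, elim conjE)
  fix s a assume a: "a \<in> A" and s: "\<forall>n. s n \<in> A" "s \<longlonglongrightarrow> a"
  have "(\<lambda>n. \<integral>z. f (s n) z \<partial>N) \<longlonglongrightarrow> (\<integral>z. f a z \<partial>N)"
  proof (rule integral_dominated_convergence[where w=h])
    show "AE z in N. (\<lambda>n. f (s n) z) \<longlonglongrightarrow> f a z"
    proof (rule AE_I2)
      fix z assume "z \<in> space N"
      from f(2)[OF this] show "(\<lambda>n. f (s n) z) \<longlonglongrightarrow> f a z"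
        unfolding continuous_on_sequentially comp_def using a s by blast
    qed
  qed (use f h a s in auto)
  then show "((\<lambda>a. \<integral>z. f a z \<partial>N) \<circ> s) \<longlonglongrightarrow> (\<integral>z. f a z \<partial>N)" by (simp add: comp_def)
qed

definition truncated_weight :: "'x set \<Rightarrow> real \<Rightarrow> ('x \<Rightarrow> real) \<Rightarrow> 'x \<Rightarrow> real" where
  "truncated_weight K \<gamma> w y = (if y \<in> K then w y else \<gamma>)"

text \<open>Outside \<open>K\<close> the minorization is averaged over \<nu> together with the
  kernel, so that the same \<eta> minorizes both models and the means of their solutions are
  comparable.\<close>

definition truncated_minorant ::
    "'x::topological_space set \<Rightarrow> 'x set \<Rightarrow> 'x measure \<Rightarrow> ('x \<Rightarrow> 'a \<Rightarrow> real) \<Rightarrow> 'x \<Rightarrow> 'a \<Rightarrow> real" where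
  "truncated_minorant X K \<nu> \<phi> x a =
     (if x \<in> K then \<phi> x a else (\<integral>z. \<phi> z a \<partial>restrict_space \<nu> (X - K)))"

text \<open>A single truncation level. Here \<tau> is any nonnegative upper bound of the excess
  integrals, and \<beta> is a contraction factor that can be shared by all levels, which makes the
  bounds on their fixed points uniform.\<close>

locale truncated_mdp = weighted_mdp X A p c w M \<eta> \<phi> \<alpha>
  for X :: "'x::polish_space set" and A :: "'a::polish_space set" and p c w M \<eta> \<phi> \<alpha> +
  fixes K :: "'x set" and \<nu> :: "'x measure" and \<gamma> \<tau> \<sigma> \<beta> :: real
  assumes K: "K \<in> sets (borel_on X)"
    and \<nu>: "\<nu> \<in> space (prob_algebra (borel_on X))" "measure \<nu> (X - K) = 1"
      "set_integrable \<nu> (X - K) w"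
    and \<gamma>: "\<gamma> = (LINT y:(X - K)|\<nu>. w y)"
    and \<tau>: "\<And>x a. x \<in> X \<Longrightarrow> a \<in> A \<Longrightarrow> (LINT y:(X - K)|p x a. \<gamma> - w y) \<le> \<tau>" "0 \<le> \<tau>"
    and \<sigma>: "\<sigma> = (LINT y:(X - K)|\<eta>. w y)"
    and \<beta>: "\<alpha> + \<tau> + \<sigma> \<le> \<beta>" "\<beta> < 1"
begin

abbreviation "N \<equiv> restrict_space \<nu> (X - K)"
abbreviation "BN \<equiv> restrict_space (borel_on X) (X - K)"
abbreviation "q \<equiv> approx_kernel X p K \<nu>"
abbreviation "b \<equiv> approx_cost X c K \<nu>"
abbreviation "v \<equiv> truncated_weight K \<gamma> w"
abbreviation "\<psi> \<equiv> truncated_minorant X K \<nu> \<phi>"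

lemma sets_\<nu>: "sets \<nu> = sets (borel_on X)" and prob_\<nu>: "prob_space \<nu>"
  using \<nu>(1) by (auto simp: space_prob_algebra)

lemma space_\<nu>: "space \<nu> = X"
  using sets_eq_imp_space_eq[OF sets_\<nu>] by simp

lemma outside_sets: "X - K \<in> sets (borel_on X)"
  using sets.compl_sets[OF K] by simp

lemma outside_sets_\<nu>: "(X - K) \<inter> space \<nu> \<in> sets \<nu>"
  using outside_sets by (simp add: sets_\<nu> space_\<nu> Int_absorb2)

lemma space_N: "space N = X - K"
  by (auto simp: space_restrict_space space_\<nu>)

lemma sets_N: "sets N = sets BN"
  by (rule sets_restrict_space_cong[OF sets_\<nu>])

lemma prob_N: "prob_space N"
proof (rule prob_spaceI)
  interpret prob_space \<nu> by (rule prob_\<nu>)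
  have "emeasure N (X - K) = emeasure \<nu> (X - K)"
    by (rule emeasure_restrict_space[OF outside_sets_\<nu>]) simp
  then show "emeasure N (space N) = 1"
    using \<nu>(2) by (simp add: space_N emeasure_eq_measure)
qed

lemma N_in: "N \<in> space (prob_algebra BN)"
  using prob_N sets_N by (simp add: space_prob_algebra)

lemma space_BN [simp]: "space BN = X - K"
  by (auto simp: space_restrict_space)

lemma integral_N: "(LINT y:(X - K)|\<nu>. f y) = (\<integral>y. f y \<partial>N)" for f :: "'x \<Rightarrow> real"
  unfolding set_lebesgue_integral_def
  using integral_restrict_space[OF outside_sets_\<nu>, of f] by simp

lemma measurable_N: "f \<in> borel_measurable (borel_on X) \<Longrightarrow> f \<in> borel_measurable N"
  unfolding measurable_cong_sets[OF sets_N refl] by (rule measurable_restrict_space1)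

lemma w_integrable_N: "integrable N w"
  using \<nu>(3) integrable_restrict_space[OF outside_sets_\<nu>, of w] by (simp add: set_integrable_def)

lemma \<gamma>_eq: "\<gamma> = (\<integral>y. w y \<partial>N)"
  unfolding \<gamma> by (rule integral_N)

lemma \<gamma>_ge_1: "1 \<le> \<gamma>"
  unfolding \<gamma>_eq
  by (rule prob_space.integral_ge_const[OF prob_N w_integrable_N], rule AE_I2)
    (simp add: space_N w_ge_1)

lemma wbounded_integrable_N: assumes "wbounded g" shows "integrable N g"
proof -
  obtain C where C: "\<And>x. x \<in> X \<Longrightarrow> \<bar>g x\<bar> \<le> C * w x" using assms by (metis wboundedE)
  show ?thesis
  proof (rule Bochner_Integration.integrable_bound)
    show "integrable N (\<lambda>x. C * w x)" using w_integrable_N by simp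
    show "g \<in> borel_measurable N" by (rule measurable_N[OF wbounded_measurable[OF assms]])
    show "AE x in N. norm (g x) \<le> norm (C * w x)"
      by (rule AE_I2) (use C space_N in \<open>auto intro: order_trans[OF C]\<close>)
  qed
qed

lemma v_measurable: "v \<in> borel_measurable (borel_on X)"
  unfolding truncated_weight_def[abs_def]
  by (rule measurable_If_set) (use w_measurable sets.Int[OF K sets.top] in auto)

lemma v_ge_1: "x \<in> X \<Longrightarrow> 1 \<le> v x"
  using w_ge_1 \<gamma>_ge_1 by (simp add: truncated_weight_def)

text \<open>Ensures that functions bounded by multiples of \<open>v\<close> are integrable. The
  factor \<gamma> may grow with the level, so this comparison serves integrability and not the error
  estimates.\<close>

lemma v_le: "x \<in> X \<Longrightarrow> v x \<le> \<gamma> * w x"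
  using mult_mono[of 1 \<gamma> "w x" "w x"] mult_mono[of \<gamma> \<gamma> 1 "w x"] w_ge_1[of x] \<gamma>_ge_1
  by (auto simp: truncated_weight_def)

lemma wbounded_v: "wbounded v"
  by (rule wboundedI[OF v_measurable, of \<gamma>]) (use v_le v_ge_1 in force)

lemma wbounded_truncated:
  assumes "g \<in> borel_measurable (borel_on X)" "\<And>y. y \<in> X \<Longrightarrow> \<bar>g y\<bar> \<le> C * v y"
  shows "wbounded g"
proof (rule wbounded_le[OF assms(1) wbounded_mult[OF wbounded_v, of C]])
  fix x assume "x \<in> X"
  then show "\<bar>g x\<bar> \<le> \<bar>C * v x\<bar>" using assms(2)[of x] abs_ge_self[of "C * v x"] by linarith
qed

section \<open>Integration against the truncated kernel\<close>

lemma q_inside: "x \<in> K \<Longrightarrow> q x a = p x a" and q_outside: "x \<notin> K \<Longrightarrow> q x a = N \<bind> (\<lambda>z. p z a)"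
  by (simp_all add: approx_kernel_def)

lemma b_inside: "x \<in> K \<Longrightarrow> b x a = c x a" and b_outside: "x \<notin> K \<Longrightarrow> b x a = (\<integral>z. c z a \<partial>N)"
  by (simp_all add: approx_cost_def integral_N)

lemma p_section: "a \<in> A \<Longrightarrow> (\<lambda>z. p z a) \<in> BN \<rightarrow>\<^sub>M prob_algebra (borel_on X)"
  using measurable_compose[OF _ kernel, of "\<lambda>z. (z, a)" BN]
  by (simp add: measurable_restrict_space1)

lemma outside_integral:
  assumes g: "wbounded g" and x: "x \<notin> K" "a \<in> A"
  shows "integrable (q x a) g" "(\<integral>y. g y \<partial>q x a) = (\<integral>z. (\<integral>y. g y \<partial>p z a) \<partial>N)"
    "integrable N (\<lambda>z. \<integral>y. g y \<partial>p z a)"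
proof -
  obtain C where C: "0 < C" "\<And>x. x \<in> X \<Longrightarrow> \<bar>g x\<bar> \<le> C * w x" using g by (metis wboundedE)
  have int: "integrable N (\<lambda>z. C * (\<alpha> * w z + (\<integral>y. w y \<partial>\<eta>)))"
    by (intro wbounded_integrable_N wbounded_mult wbounded_add wbounded_w wbounded_const)
  have gi: "integrable (p z a) g" if "z \<in> space BN" for z
    using that wbounded_integrable_p[OF g _ x(2)] by auto
  have le: "(\<integral>y. \<bar>g y\<bar> \<partial>p z a) \<le> C * (\<alpha> * w z + (\<integral>y. w y \<partial>\<eta>))" if "z \<in> space BN" for z
    by (rule kernel_abs_le[OF g C(2)]) (use C x that in auto)
  show "integrable (q x a) g" "(\<integral>y. g y \<partial>q x a) = (\<integral>z. (\<integral>y. g y \<partial>p z a) \<partial>N)"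
    "integrable N (\<lambda>z. \<integral>y. g y \<partial>p z a)"
    unfolding q_outside[OF x(1)]
    using bind_integral[OF N_in p_section[OF x(2)] wbounded_measurable[OF g] gi int le] by auto
qed

lemma \<phi>_section: "a \<in> A \<Longrightarrow> (\<lambda>z. \<phi> z a) \<in> borel_measurable (borel_on X)"
  using measurable_compose[OF _ \<phi>_measurable, of "\<lambda>z. (z, a)" "borel_on X"] by simp

lemma wbounded_\<phi>: "a \<in> A \<Longrightarrow> wbounded (\<lambda>z. \<phi> z a)"
  by (rule wbounded_le[OF \<phi>_section wbounded_const[of 1]]) (use \<phi>_nonneg \<phi>_le_1 in auto)

lemma wbounded_cost: "a \<in> A \<Longrightarrow> wbounded (\<lambda>z. c z a)"
  using measurable_compose[OF _ cost_measurable, of "\<lambda>z. (z, a)" "borel_on X"] cost_bound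
  by (intro wboundedI[of _ M]) auto

lemma inside_sets:
  "{z \<in> space (state_action_space X A). fst z \<in> K} \<in> sets (state_action_space X A)"
proof -
  have "Measurable.pred (state_action_space X A) (\<lambda>z. fst z \<in> K)"
    by (rule measurable_compose[OF measurable_fst]) (use K in simp)
  then show ?thesis by (simp only: pred_def)
qed

lemma parameter_integral_measurable:
  assumes f: "(\<lambda>(x, a). f x a) \<in> borel_measurable (state_action_space X A)"
  shows "(\<lambda>z. \<integral>y. f y (snd z) \<partial>N :: real) \<in> borel_measurable (state_action_space X A)"
proof -
  interpret N: sigma_finite_measure N
    using prob_N by (simp add: prob_space_imp_sigma_finite)
  have "(\<lambda>(z, y). f y (snd z)) \<in> borel_measurable (state_action_space X A \<Otimes>\<^sub>M N)"
  proof -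
    have "snd \<in> state_action_space X A \<Otimes>\<^sub>M N \<rightarrow>\<^sub>M borel_on X"
      unfolding measurable_cong_sets[OF sets_pair_measure_cong[OF refl sets_N] refl]
      by (rule measurable_compose[OF measurable_snd measurable_restrict_space1]) simp
    then have "(\<lambda>u. (snd u, snd (fst u))) \<in> state_action_space X A \<Otimes>\<^sub>M N \<rightarrow>\<^sub>M state_action_space X A"
      by (intro measurable_Pair measurable_compose[OF measurable_fst measurable_snd])
    from measurable_compose[OF this f] show ?thesis by (simp add: case_prod_beta')
  qed
  then show ?thesis by (rule N.borel_measurable_lebesgue_integral)
qed

lemma truncated_is_mdp: "mdp X A q b"
  unfolding mdp_def
proof (intro conjI X A)
  have "(\<lambda>z. N \<bind> (\<lambda>y. p y (snd z))) \<in> state_action_space X A \<rightarrow>\<^sub>M prob_algebra (borel_on X)"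
  proof (rule measurable_bind_prob_space2[OF measurable_const[OF N_in]])
    have "(\<lambda>u. (snd u, snd (fst u))) \<in> state_action_space X A \<Otimes>\<^sub>M BN \<rightarrow>\<^sub>M state_action_space X A"
      by (intro measurable_Pair measurable_compose[OF measurable_fst measurable_snd]
        measurable_compose[OF measurable_snd measurable_restrict_space1]) simp
    from measurable_compose[OF this kernel]
    show "(\<lambda>(z, y). p y (snd z)) \<in> state_action_space X A \<Otimes>\<^sub>M BN \<rightarrow>\<^sub>M prob_algebra (borel_on X)"
      by (simp add: case_prod_beta')
  qed
  then show "(\<lambda>(x, a). q x a) \<in> state_action_space X A \<rightarrow>\<^sub>M prob_algebra (borel_on X)"
    unfolding approx_kernel_def case_prod_beta' using inside_sets kernel[unfolded case_prod_beta']
    by (intro measurable_If)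
  show "(\<lambda>(x, a). b x a) \<in> borel_measurable (state_action_space X A)"
    unfolding approx_cost_def case_prod_beta' integral_N
    using inside_sets cost_measurable[unfolded case_prod_beta'] parameter_integral_measurable[OF cost_measurable]
    by (intro measurable_If)
qed

lemma \<sigma>_nonneg: "0 \<le> \<sigma>"
  unfolding \<sigma> set_lebesgue_integral_def
  by (rule integral_nonneg_AE, rule AE_I2) (auto simp: space_\<eta> w_nonneg indicator_def)

lemma wbounded_outside: "wbounded g \<Longrightarrow> wbounded (\<lambda>y. indicator (X - K) y * g y)"
  by (rule wbounded_indicator[OF outside_sets])

lemma wbounded_decomposition: "wbounded (\<lambda>y. indicator (X - K) y * (\<gamma> - w y))"
  by (intro wbounded_outside wbounded_diff wbounded_const wbounded_w)

text \<open>Write \<open>v\<close> as \<open>w\<close> plus \<open>\<gamma> - w\<close> on the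
  complement of \<open>K\<close>. The integral of this correction under the kernel is at most
  \<tau>. Replacing the \<eta>-mean of \<open>w\<close> by that of \<open>v\<close> costs at most
  \<sigma>, since \<open>w\<close> is at most \<open>v\<close> plus its own restriction to the
  complement and \<phi> is at most 1.\<close>

lemma v_drift:
  assumes x: "x \<in> X" "a \<in> A"
  shows "(\<integral>y. v y \<partial>p x a) \<le> \<alpha> * w x + (\<integral>y. v y \<partial>\<eta>) * \<phi> x a + (\<tau> + \<sigma>)"
proof -
  have "(\<integral>y. v y \<partial>p x a) = (\<integral>y. w y + indicator (X - K) y * (\<gamma> - w y) \<partial>p x a)"
    by (rule Bochner_Integration.integral_cong[OF refl])
      (auto simp: truncated_weight_def space_p[OF x] indicator_def)
  also have "\<dots> = (\<integral>y. w y \<partial>p x a) + (LINT y:(X - K)|p x a. \<gamma> - w y)"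
    using wbounded_integrable_p[OF wbounded_decomposition x] w_integrable[OF x]
    by (simp add: set_lebesgue_integral_def)
  also have "\<dots> \<le> \<alpha> * w x + (\<integral>y. w y \<partial>\<eta>) * \<phi> x a + \<tau>"
    using drift[OF x] \<tau>(1)[OF x] by linarith
  also have "(\<integral>y. w y \<partial>\<eta>) * \<phi> x a \<le> ((\<integral>y. v y \<partial>\<eta>) + \<sigma>) * \<phi> x a"
  proof (rule mult_right_mono[OF _ \<phi>_nonneg[OF x]])
    have "(\<integral>y. w y \<partial>\<eta>) \<le> (\<integral>y. v y + indicator (X - K) y * w y \<partial>\<eta>)"
      by (intro integral_\<eta>_mono wbounded_add wbounded_v wbounded_outside wbounded_w)
        (use \<gamma>_ge_1 in \<open>auto simp: truncated_weight_def indicator_def\<close>)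
    also have "\<dots> = (\<integral>y. v y \<partial>\<eta>) + \<sigma>"
      using wbounded_integrable_\<eta>[OF wbounded_v] wbounded_integrable_\<eta>[OF wbounded_outside[OF wbounded_w]]
      by (simp add: \<sigma> set_lebesgue_integral_def)
    finally show "(\<integral>y. w y \<partial>\<eta>) \<le> (\<integral>y. v y \<partial>\<eta>) + \<sigma>" .
  qed
  also have "((\<integral>y. v y \<partial>\<eta>) + \<sigma>) * \<phi> x a \<le> (\<integral>y. v y \<partial>\<eta>) * \<phi> x a + \<sigma>"
    using mult_left_mono[OF \<phi>_le_1[OF x] \<sigma>_nonneg] by (simp add: distrib_right)
  finally show ?thesis by simp
qed

text \<open>Inside \<open>K\<close> the drift condition is \<open>v_drift\<close>. Outside,
  \<open>v_drift\<close> is averaged over \<open>N\<close>; the average of \<open>w\<close> is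
  \<gamma>, which is exactly the value of \<open>v\<close> there, and this is why the weight is
  truncated at this constant.\<close>

lemma truncated_weighted: "weighted_mdp X A q b v M \<eta> \<psi> \<beta>"
proof (unfold_locales)
  show "mdp X A q b" by (rule truncated_is_mdp)
  show "v \<in> borel_measurable (borel_on X)" by (rule v_measurable)
  show "1 \<le> v x" if "x \<in> X" for x using that by (rule v_ge_1)
  show "\<bar>b x a\<bar> \<le> M * v x" if x: "x \<in> X" "a \<in> A" for x a
  proof (cases "x \<in> K")
    case False
    have "\<bar>b x a\<bar> \<le> (\<integral>z. \<bar>c z a\<bar> \<partial>N)" unfolding b_outside[OF False] by (rule integral_abs_bound)
    also have "\<dots> \<le> (\<integral>z. M * w z \<partial>N)"
      by (rule integral_mono)
        (use x w_integrable_N cost_bound space_N in \<open>auto intro!: wbounded_integrable_N wbounded_abs wbounded_cost\<close>)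
    finally show ?thesis using False by (simp add: truncated_weight_def \<gamma>_eq)
  qed (use x cost_bound in \<open>simp add: b_inside truncated_weight_def\<close>)
  show "integrable (q x a) v" if x: "x \<in> X" "a \<in> A" for x a
    by (cases "x \<in> K")
      (use x in \<open>simp_all add: q_inside wbounded_integrable_p outside_integral(1) wbounded_v\<close>)
  show "integrable \<eta> v" by (rule wbounded_integrable_\<eta>[OF wbounded_v])
  show "(\<lambda>(x, a). \<psi> x a) \<in> borel_measurable (state_action_space X A)"
    unfolding truncated_minorant_def case_prod_beta'
    using inside_sets \<phi>_measurable[unfolded case_prod_beta'] parameter_integral_measurable[OF \<phi>_measurable]
    by (intro measurable_If)
  show "0 \<le> \<psi> x a" if x: "x \<in> X" "a \<in> A" for x a
    using x by (auto simp: truncated_minorant_def \<phi>_nonneg space_N intro!: integral_nonneg_AE AE_I2)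
  show "0 \<le> \<beta>" using \<alpha> \<tau> \<sigma>_nonneg \<beta> by linarith
  show "(\<integral>y. v y \<partial>q x a) \<le> \<beta> * v x + (\<integral>y. v y \<partial>\<eta>) * \<psi> x a" if x: "x \<in> X" "a \<in> A" for x a
  proof -
    \<comment> \<open>A weight of at least 1 absorbs the additive error into the contraction
      factor.\<close>
    have *: "\<alpha> * s + (\<tau> + \<sigma>) \<le> \<beta> * s" if "1 \<le> s" for s
    proof -
      have "\<alpha> * s + (\<tau> + \<sigma>) \<le> \<alpha> * s + (\<tau> + \<sigma>) * s"
        using mult_left_mono[OF that, of "\<tau> + \<sigma>"] \<tau>(2) \<sigma>_nonneg by simp
      also have "\<dots> = (\<alpha> + \<tau> + \<sigma>) * s" by (simp add: algebra_simps)
      also have "\<dots> \<le> \<beta> * s" using \<beta> that by (intro mult_right_mono) auto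
      finally show ?thesis .
    qed
    show ?thesis
    proof (cases "x \<in> K")
      case True
      then show ?thesis using v_drift[OF x] *[OF w_ge_1[OF x(1)]]
        by (simp add: q_inside truncated_weight_def truncated_minorant_def)
    next
      case False
      note \<phi>i = wbounded_integrable_N[OF wbounded_\<phi>[OF x(2)]]
      have "(\<integral>y. v y \<partial>q x a) = (\<integral>z. (\<integral>y. v y \<partial>p z a) \<partial>N)"
        by (rule outside_integral(2)[OF wbounded_v False x(2)])
      also have "\<dots> \<le> (\<integral>z. \<alpha> * w z + (\<integral>y. v y \<partial>\<eta>) * \<phi> z a + (\<tau> + \<sigma>) \<partial>N)"
        by (intro integral_mono outside_integral(3)[OF wbounded_v False x(2)] v_drift
          wbounded_integrable_N wbounded_add wbounded_mult wbounded_w wbounded_\<phi> wbounded_const x)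
          (simp add: space_N)
      also have "\<dots> = \<alpha> * \<gamma> + (\<integral>y. v y \<partial>\<eta>) * \<psi> x a + (\<tau> + \<sigma>)"
        using False prob_space.prob_space[OF prob_N]
        by (subst Bochner_Integration.integral_add)
          (auto simp: \<gamma>_eq[symmetric] truncated_minorant_def w_integrable_N \<phi>i
            intro!: wbounded_integrable_N[OF wbounded_const])
      finally show ?thesis using *[OF \<gamma>_ge_1] False by (simp add: truncated_weight_def)
    qed
  qed
  show "\<psi> x a * (\<integral>y. g y \<partial>\<eta>) \<le> (\<integral>y. g y \<partial>q x a)"
    if g: "g \<in> borel_measurable (borel_on X)" "\<And>y. y \<in> X \<Longrightarrow> 0 \<le> g y \<and> g y \<le> v y"
      and x: "x \<in> X" "a \<in> A" for g x a
  proof -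
    have wg: "wbounded g" by (rule wbounded_truncated[OF g(1), of 1]) (use g(2) in auto)
    show ?thesis
    proof (cases "x \<in> K")
      case True
      then show ?thesis using minorization_wbounded[OF wg _ x] g(2)
        by (simp add: q_inside truncated_minorant_def)
    next
      case False
      have "\<psi> x a * (\<integral>y. g y \<partial>\<eta>) = (\<integral>z. \<phi> z a * (\<integral>y. g y \<partial>\<eta>) \<partial>N)"
        using False by (simp add: truncated_minorant_def)
      also have "\<dots> \<le> (\<integral>z. (\<integral>y. g y \<partial>p z a) \<partial>N)"
      proof (rule integral_mono)
        show "integrable N (\<lambda>z. \<phi> z a * (\<integral>y. g y \<partial>\<eta>))"
          using wbounded_integrable_N[OF wbounded_\<phi>[OF x(2)]] by simp
        show "integrable N (\<lambda>z. \<integral>y. g y \<partial>p z a)" by (rule outside_integral(3)[OF wg False x(2)])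
      qed (use minorization_wbounded[OF wg _ _ x(2)] g(2) space_N in auto)
      also have "\<dots> = (\<integral>y. g y \<partial>q x a)" by (rule outside_integral(2)[OF wg False x(2), symmetric])
      finally show ?thesis .
    qed
  qed
  show "continuous_on A (b x)" if x: "x \<in> X" for x
  proof (cases "x \<in> K")
    case False
    have "continuous_on A (\<lambda>a. \<integral>z. c z a \<partial>N)"
    proof (rule continuous_on_integral_dominated[where h = "\<lambda>z. M * w z"])
      show "(\<lambda>z. c z a) \<in> borel_measurable N" if "a \<in> A" for a
        by (rule measurable_N[OF wbounded_measurable[OF wbounded_cost[OF that]]])
    qed (use space_N continuous_cost cost_bound w_integrable_N in auto)
    then show ?thesis using False by (simp add: b_outside)
  qed (use x continuous_cost in \<open>simp add: b_inside\<close>)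
  show "continuous_on A (\<psi> x)" if x: "x \<in> X" for x
  proof (cases "x \<in> K")
    case False
    have "continuous_on A (\<lambda>a. \<integral>z. \<phi> z a \<partial>N)"
    proof (rule continuous_on_integral_dominated[where h = "\<lambda>z. 1"])
      show "(\<lambda>z. \<phi> z a) \<in> borel_measurable N" if "a \<in> A" for a
        by (rule measurable_N[OF \<phi>_section[OF that]])
      show "integrable N (\<lambda>z. 1 :: real)" by (rule wbounded_integrable_N[OF wbounded_const])
    qed (use space_N continuous_\<phi> \<phi>_nonneg \<phi>_le_1 in auto)
    then show ?thesis using False by (simp add: truncated_minorant_def)
  qed (use x continuous_\<phi> in \<open>simp add: truncated_minorant_def\<close>)
  show "continuous_on A (\<lambda>a. \<integral>y. g y \<partial>q x a)"
    if g: "g \<in> borel_measurable (borel_on X)" "\<And>y. y \<in> X \<Longrightarrow> \<bar>g y\<bar> \<le> v y" and x: "x \<in> X" for g x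
  proof -
    have wg: "wbounded g" by (rule wbounded_truncated[OF g(1), of 1]) (use g(2) in auto)
    then obtain C where C: "0 < C" "\<And>x. x \<in> X \<Longrightarrow> \<bar>g x\<bar> \<le> C * w x" by (metis wboundedE)
    show ?thesis
    proof (cases "x \<in> K")
      case False
      have "continuous_on A (\<lambda>a. \<integral>z. (\<integral>y. g y \<partial>p z a) \<partial>N)"
      proof (rule continuous_on_integral_dominated[where h = "\<lambda>z. C * (\<alpha> * w z + (\<integral>y. w y \<partial>\<eta>))"])
        show "(\<lambda>z. \<integral>y. g y \<partial>p z a) \<in> borel_measurable N" if "a \<in> A" for a
          by (rule borel_measurable_integrable[OF outside_integral(3)[OF wg False that]])
        show "continuous_on A (\<lambda>a. \<integral>y. g y \<partial>p z a)" if "z \<in> space N" for z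
          using that by (intro continuous_integral[OF wg]) (simp add: space_N)
        show "integrable N (\<lambda>z. C * (\<alpha> * w z + (\<integral>y. w y \<partial>\<eta>)))"
          by (intro wbounded_integrable_N wbounded_mult wbounded_add wbounded_w wbounded_const)
        show "\<bar>\<integral>y. g y \<partial>p z a\<bar> \<le> C * (\<alpha> * w z + (\<integral>y. w y \<partial>\<eta>))" if "a \<in> A" "z \<in> space N" for a z
          using that C
          by (intro order_trans[OF integral_abs_bound] kernel_abs_le[OF wg C(2)]) (auto simp: space_N)
      qed
      then show ?thesis
        by (subst continuous_on_cong[OF refl outside_integral(2)[OF wg False]])
    qed (use x continuous_integral[OF wg] in \<open>simp add: q_inside\<close>)
  qed
qed (use M_nonneg \<eta> \<beta> in auto)

end

subsection \<open>Convergence of the fixed points\<close>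

text \<open>Were every \<open>G n\<close> above \<open>s + \<epsilon>\<close> somewhere, these
  points would accumulate at some \<open>l\<close>. By monotonicity and continuity each
  \<open>G m\<close> would be at least \<open>s + \<epsilon>\<close> at \<open>l\<close>, and so
  would the limit.\<close>

lemma Dini_upper_bound:
  fixes G :: "nat \<Rightarrow> 'a::metric_space \<Rightarrow> real"
  assumes A: "compact A" and G: "\<And>n. continuous_on A (G n)"
    and dec: "\<And>n a. a \<in> A \<Longrightarrow> G (Suc n) a \<le> G n a"
    and lim: "\<And>a. a \<in> A \<Longrightarrow> (\<lambda>n. G n a) \<longlonglongrightarrow> L a" "\<And>a. a \<in> A \<Longrightarrow> L a \<le> s"
    and "0 < \<epsilon>"
  obtains n where "\<And>a. a \<in> A \<Longrightarrow> G n a \<le> s + \<epsilon>"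
proof (rule ccontr)
  assume "\<not> thesis"
  then have "\<exists>a\<in>A. s + \<epsilon> < G n a" for n using that[of n] not_le by blast
  then obtain a where a: "\<And>n. a n \<in> A" "\<And>n. s + \<epsilon> < G n (a n)" by metis
  obtain l f where l: "l \<in> A" "strict_mono f" "(a \<circ> f) \<longlonglongrightarrow> l"
    using A[unfolded compact_def, rule_format, of a] a(1) by blast
  have mono: "G n b \<le> G m b" if "m \<le> n" "b \<in> A" for m n b
    using lift_Suc_antimono_le[of "\<lambda>n. G n b", OF dec[OF that(2)] that(1)] .
  have "s + \<epsilon> \<le> G m l" for m
  proof (rule LIMSEQ_le_const)
    show "(\<lambda>n. G m (a (f n))) \<longlonglongrightarrow> G m l"
      using continuous_on_tendsto_compose[OF G[of m] l(3) l(1)] a(1) by (simp add: comp_def)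
    have "s + \<epsilon> \<le> G m (a (f n))" if "m \<le> n" for n
      using mono[of m "f n" "a (f n)"] seq_suble[OF l(2), of n] that a(1,2)[of "f n"] by linarith
    then show "\<exists>N. \<forall>n\<ge>N. s + \<epsilon> \<le> G m (a (f n))" by blast
  qed
  then have "s + \<epsilon> \<le> L l" by (intro LIMSEQ_le_const[OF lim(1)[OF l(1)]]) blast
  then show False using lim(2)[OF l(1)] \<open>0 < \<epsilon>\<close> by simp
qed

context weighted_mdp
begin

lemma integral_tendsto_wbounded:
  assumes N: "sets N = sets (borel_on X)" "integrable N w"
    and f: "\<And>n. f n \<in> borel_measurable (borel_on X)" "\<And>n y. y \<in> X \<Longrightarrow> \<bar>f n y\<bar> \<le> C * w y"
    and g: "g \<in> borel_measurable (borel_on X)" "\<And>y. y \<in> X \<Longrightarrow> (\<lambda>n. f n y) \<longlonglongrightarrow> g y"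
  shows "(\<lambda>n. \<integral>y. f n y \<partial>N) \<longlonglongrightarrow> (\<integral>y. g y \<partial>N)"
proof (rule integral_dominated_convergence[where w = "\<lambda>y. C * w y"])
  have sp: "space N = X" using sets_eq_imp_space_eq[OF N(1)] by simp
  show "integrable N (\<lambda>y. C * w y)" using N(2) by simp
  show "AE y in N. (\<lambda>n. f n y) \<longlonglongrightarrow> g y" by (rule AE_I2) (simp add: sp g)
  show "AE y in N. norm (f n y) \<le> C * w y" for n by (rule AE_I2) (simp add: sp f)
qed (use f g N in \<open>simp_all cong: measurable_cong_sets\<close>)

lemma r_tendsto:
  assumes "\<And>n. f n \<in> borel_measurable (borel_on X)" "\<And>n y. y \<in> X \<Longrightarrow> \<bar>f n y\<bar> \<le> C * w y"
    and "g \<in> borel_measurable (borel_on X)" "\<And>y. y \<in> X \<Longrightarrow> (\<lambda>n. f n y) \<longlonglongrightarrow> g y"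
    and x: "x \<in> X" "a \<in> A"
  shows "(\<lambda>n. r (f n) x a) \<longlonglongrightarrow> r g x a"
  unfolding r_def
  by (intro tendsto_intros integral_tendsto_wbounded[OF _ _ assms(1-4)] sets_p sets_\<eta> w_integrable w_integrable_\<eta> x)

text \<open>The upper limit \<open>e\<close> of the errors \<open>g n\<close> satisfies \<open>e x \<le> (SUP a. r e x a)\<close> and hence vanishes,
  because \<open>r\<close> is a contraction. Passing to the limit under the supremum over the actions is possible
  by Dini's theorem, applied to the decreasing sequence of the tail suprema of \<open>g n\<close>.\<close>

lemma subinvariant_errors_vanish:
  assumes A: "compact A" and C: "0 \<le> C"
    and g: "\<And>n. g n \<in> borel_measurable (borel_on X)"
      "\<And>n y. y \<in> X \<Longrightarrow> 0 \<le> g n y" "\<And>n y. y \<in> X \<Longrightarrow> g n y \<le> C * w y"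
    and sub: "\<And>x \<epsilon>. x \<in> X \<Longrightarrow> 0 < \<epsilon> \<Longrightarrow>
      \<exists>m. \<forall>n\<ge>m. \<forall>s. (\<forall>a\<in>A. r (g n) x a + \<epsilon> \<le> s) \<longrightarrow> g n x \<le> s"
  shows "(\<lambda>n. \<integral>y. g n y \<partial>\<eta>) \<longlonglongrightarrow> 0"
proof -
  define E where "E m y = (SUP n\<in>{m..}. g n y)" for m y
  have bdd: "bdd_above ((\<lambda>n. g n y) ` {m..})" if "y \<in> X" for m y
    by (rule bdd_aboveI2) (rule g(3)[OF that])
  have g_le_E: "g n y \<le> E m y" if "y \<in> X" "m \<le> n" for m n y
    unfolding E_def by (rule cSUP_upper) (use that bdd in auto)
  have E_le: "E m y \<le> s" if "\<And>n. m \<le> n \<Longrightarrow> g n y \<le> s" for m y s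
    unfolding E_def by (rule cSUP_least) (use that in auto)
  have E_nonneg: "0 \<le> E m y" if "y \<in> X" for m y
    using g(2)[OF that, of m] g_le_E[OF that, of m m] by simp
  have E_meas: "E m \<in> borel_measurable (borel_on X)" for m
    unfolding E_def[abs_def] by (rule borel_measurable_cSUP) (use g bdd in auto)
  have E_abs: "\<bar>E m y\<bar> \<le> C * w y" if "y \<in> X" for m y
    using E_nonneg[OF that, of m] E_le[of m y, OF g(3)[OF that]] by simp
  have E_wb: "wbounded (E m)" for m by (rule wboundedI[OF E_meas E_abs])
  have E_dec: "E (Suc m) y \<le> E m y" if "y \<in> X" for m y
    by (rule E_le, rule g_le_E) (use that in auto)
  define e where "e y = lim (\<lambda>m. E m y)" for y
  have dec: "decseq (\<lambda>m. E m y)" if "y \<in> X" for y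
    by (rule decseq_SucI) (rule E_dec[OF that])
  have e: "(\<lambda>m. E m y) \<longlonglongrightarrow> e y" if y: "y \<in> X" for y
  proof -
    obtain l where "(\<lambda>m. E m y) \<longlonglongrightarrow> l"
      by (rule decseq_convergent[OF dec[OF y], of 0]) (use E_nonneg[OF y] in auto)
    then show ?thesis unfolding e_def by (simp add: limI)
  qed
  have e_meas: "e \<in> borel_measurable (borel_on X)"
    by (rule borel_measurable_LIMSEQ_real[of _ E]) (use e E_meas in auto)
  have e_nonneg: "0 \<le> e y" if "y \<in> X" for y
    by (rule LIMSEQ_le_const[OF e[OF that]]) (use E_nonneg that in auto)
  have e_le_E: "e y \<le> E m y" if "y \<in> X" for m y
    by (rule decseq_ge[OF dec e]) (use that in auto)
  have e_wb: "wbounded e"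
  proof (rule wboundedI[OF e_meas])
    fix y assume y: "y \<in> X"
    then show "\<bar>e y\<bar> \<le> C * w y" using e_nonneg[OF y] e_le_E[OF y, of 0] E_abs[OF y, of 0] by simp
  qed
  have contract: "e x \<le> \<kappa> * (\<alpha> * w x)" if \<kappa>: "0 \<le> \<kappa>" "\<And>y. y \<in> X \<Longrightarrow> e y \<le> \<kappa> * w y" and x: "x \<in> X" for \<kappa> x
  proof (rule field_le_epsilon)
    fix \<epsilon> :: real assume "0 < \<epsilon>"
    then have \<epsilon>: "0 < \<epsilon> / 2" by simp
    obtain m where m: "\<And>a. a \<in> A \<Longrightarrow> r (E m) x a \<le> \<kappa> * (\<alpha> * w x) + \<epsilon> / 2"
    proof (rule Dini_upper_bound[OF A _ _ _ _ \<epsilon>])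
      show "continuous_on A (r (E n) x)" for n by (rule continuous_r[OF E_wb x])
      show "r (E (Suc n)) x a \<le> r (E n) x a" if "a \<in> A" for n a
        by (rule r_mono[OF E_wb E_wb E_dec x that])
      show "(\<lambda>n. r (E n) x a) \<longlonglongrightarrow> r e x a" if "a \<in> A" for a
        by (rule r_tendsto[OF E_meas E_abs e_meas e x that])
      show "r e x a \<le> \<kappa> * (\<alpha> * w x)" if "a \<in> A" for a
        by (rule r_le[OF e_wb \<kappa>(2,1) x that])
    qed blast
    \<comment> \<open>In \<open>sub\<close>, the quantifier over upper bounds \<open>s\<close>
      stands for the supremum over actions. It is used with \<open>s\<close> equal to
      \<open>\<kappa> * (\<alpha> * w x) + \<epsilon>\<close>: one half of \<epsilon> pays for Dini,
      the other for the defect in \<open>sub\<close>. As \<open>E m\<close> dominates all later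
      errors, one choice of m serves them all.\<close>
    obtain m' where m': "\<And>n s. m' \<le> n \<Longrightarrow> (\<And>a. a \<in> A \<Longrightarrow> r (g n) x a + \<epsilon> / 2 \<le> s) \<Longrightarrow> g n x \<le> s"
      using sub[OF x \<epsilon>] by blast
    have "E (max m m') x \<le> \<kappa> * (\<alpha> * w x) + \<epsilon>"
    proof (rule E_le, rule m')
      fix n a assume n: "max m m' \<le> n" and a: "a \<in> A"
      have "r (g n) x a \<le> r (E m) x a"
        by (rule r_mono[OF _ E_wb _ x a])
          (use n g_le_E g in \<open>auto intro!: wboundedI[of _ C]\<close>)
      then show "r (g n) x a + \<epsilon> / 2 \<le> \<kappa> * (\<alpha> * w x) + \<epsilon>" using m[OF a] by simp
    qed simp
    then show "e x \<le> \<kappa> * (\<alpha> * w x) + \<epsilon>" using e_le_E[OF x, of "max m m'"] by simp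
  qed
  have iterate: "\<forall>x\<in>X. e x \<le> C * \<alpha> ^ k * w x" for k
  proof (induction k)
    case 0
    have "e x \<le> C * w x" if "x \<in> X" for x using e_le_E[OF that, of 0] E_abs[OF that, of 0] by linarith
    then show ?case by simp
  next
    case (Suc k)
    show ?case
    proof
      fix x assume x: "x \<in> X"
      have "e x \<le> (C * \<alpha> ^ k) * (\<alpha> * w x)" by (rule contract) (use Suc C \<alpha> x in auto)
      then show "e x \<le> C * \<alpha> ^ Suc k * w x" by (simp add: mult.assoc mult.left_commute)
    qed
  qed
  have e_0: "e x = 0" if x: "x \<in> X" for x
  proof (rule antisym[OF _ e_nonneg[OF x]])
    show "e x \<le> 0" by (rule geometric_bound[of _ _ C "w x"]) (use iterate x in auto)
  qed
  have "(\<lambda>m. \<integral>y. E m y \<partial>\<eta>) \<longlonglongrightarrow> (\<integral>y. 0 \<partial>\<eta>)"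
    by (rule integral_tendsto_wbounded[OF sets_\<eta> w_integrable_\<eta> E_meas E_abs]) (use e e_0 in auto)
  then have lim: "(\<lambda>m. \<integral>y. E m y \<partial>\<eta>) \<longlonglongrightarrow> 0" by simp
  have wg: "wbounded (g n)" for n by (rule wboundedI[of _ C]) (use g in auto)
  show ?thesis
  proof (rule tendsto_sandwich[OF _ _ tendsto_const lim])
    show "\<forall>\<^sub>F n in sequentially. 0 \<le> (\<integral>y. g n y \<partial>\<eta>)"
      by (intro always_eventually allI integral_nonneg_AE AE_I2) (simp add: space_\<eta> g)
    show "\<forall>\<^sub>F n in sequentially. (\<integral>y. g n y \<partial>\<eta>) \<le> (\<integral>y. E n y \<partial>\<eta>)"
      by (intro always_eventually allI integral_\<eta>_mono wg E_wb g_le_E) auto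
  qed
qed

end

section \<open>Error of a single truncation\<close>

context truncated_mdp
begin

sublocale T: weighted_mdp X A q b v M \<eta> \<psi> \<beta>
  by (rule truncated_weighted)

text \<open>The error is split into its part \<open>g\<close> on \<open>K\<close> and a part outside
  that is at most \<open>B * (\<gamma> + w)\<close>. The third claim is the approximate
  subinvariance of \<open>g\<close>, with a universally quantified \<open>s\<close> in place of a
  supremum over actions; the last one bounds the outer part under \<eta>.\<close>

lemma truncated_fixed_point_error:
  assumes u: "is_fixed \<rho> u" and f: "T.is_fixed \<rho> f" and B: "0 \<le> B"
    "\<And>y. y \<in> X \<Longrightarrow> \<bar>u y\<bar> \<le> B * w y" "\<And>y. y \<in> X \<Longrightarrow> \<bar>f y\<bar> \<le> B * v y"
    and g: "g = (\<lambda>y. indicator K y * \<bar>u y - f y\<bar>)"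
  shows "g \<in> borel_measurable (borel_on X)" "\<And>y. y \<in> X \<Longrightarrow> g y \<le> 2 * B * w y"
    and "\<And>x s. x \<in> K \<Longrightarrow>
      (\<And>a. a \<in> A \<Longrightarrow> r g x a + B * (\<tau> + 2 * (\<integral>y. indicator (X - K) y * w y \<partial>p x a)) \<le> s) \<Longrightarrow> g x \<le> s"
    and "\<bar>\<integral>y. f y \<partial>\<eta>\<bar> \<le> \<bar>\<integral>y. u y \<partial>\<eta>\<bar> + (\<integral>y. g y \<partial>\<eta>) + B * (\<gamma> * measure \<eta> (X - K) + \<sigma>)"
proof -
  have KX: "K \<subseteq> X" using sets.sets_into_space[OF K] by simp
  note wu = is_fixedD(1)[OF u]
  have wf: "wbounded f"
    by (rule wbounded_truncated[OF T.wbounded_measurable[OF T.is_fixedD(1)[OF f]] B(3)])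
  define e where "e y = \<bar>u y - f y\<bar>" for y
  have we: "wbounded e" unfolding e_def by (intro wbounded_abs wbounded_diff wu wf)
  have g_eq: "g y = indicator K y * e y" for y by (simp add: g e_def)
  have e_inside: "e y \<le> 2 * B * w y" if "y \<in> K" for y
    using B(2)[of y] B(3)[of y] that KX by (auto simp: e_def truncated_weight_def)
  have e_outside: "e y \<le> B * (\<gamma> + w y)" if "y \<in> X - K" for y
    using B(2)[of y] B(3)[of y] that by (auto simp: e_def truncated_weight_def distrib_left)
  show g_meas: "g \<in> borel_measurable (borel_on X)"
    using K wbounded_measurable[OF we] unfolding g_eq[abs_def]
    by (intro borel_measurable_times borel_measurable_indicator)
  show g_le: "g y \<le> 2 * B * w y" if "y \<in> X" for y
    using e_inside[of y] B(1) w_nonneg[OF that] by (auto simp: g_eq indicator_def)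
  have wg: "wbounded g"
    by (rule wbounded_le[OF g_meas we]) (auto simp: g_eq indicator_def)
  define h where "h y = B * (indicator (X - K) y * (\<gamma> + w y))" for y
  have wh: "wbounded h"
    unfolding h_def by (intro wbounded_mult wbounded_outside wbounded_add wbounded_const wbounded_w)
  have h_nonneg: "0 \<le> h y" if "y \<in> X" for y
    using B(1) \<gamma>_ge_1 w_nonneg[OF that] by (auto simp: h_def indicator_def)
  have e_le: "e y \<le> g y + h y" if "y \<in> X" for y
    using e_outside[of y] that by (auto simp: g_eq h_def indicator_def)
  have h_int: "(\<integral>y. h y \<partial>p x a) \<le> B * (\<tau> + 2 * (\<integral>y. indicator (X - K) y * w y \<partial>p x a))"
    if x: "x \<in> X" "a \<in> A" for x a
  proof -
    \<comment> \<open>Since \<gamma> is not bounded along the levels, it is kept together with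
      \<open>-w\<close>, where \<tau> controls it; the price is a second copy of the tail of
      \<open>w\<close>.\<close>
    have "(\<integral>y. h y \<partial>p x a) = B * (\<integral>y. indicator (X - K) y * (\<gamma> - w y) + 2 * (indicator (X - K) y * w y) \<partial>p x a)"
      unfolding integral_mult_right_zero[symmetric]
      by (rule Bochner_Integration.integral_cong[OF refl]) (simp add: h_def algebra_simps)
    also have "(\<integral>y. indicator (X - K) y * (\<gamma> - w y) + 2 * (indicator (X - K) y * w y) \<partial>p x a)
        = (LINT y:(X - K)|p x a. \<gamma> - w y) + 2 * (\<integral>y. indicator (X - K) y * w y \<partial>p x a)"
      using wbounded_integrable_p[OF wbounded_decomposition x]
        wbounded_integrable_p[OF wbounded_mult[OF wbounded_outside[OF wbounded_w], of 2] x]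
      by (simp add: set_lebesgue_integral_def)
    finally show ?thesis using \<tau>(1)[OF x] B(1) by (simp add: mult_left_mono)
  qed
  show "g x \<le> s" if x: "x \<in> K"
    and s: "\<And>a. a \<in> A \<Longrightarrow> r g x a + B * (\<tau> + 2 * (\<integral>y. indicator (X - K) y * w y \<partial>p x a)) \<le> s" for x s
  proof -
    have xX: "x \<in> X" using x KX by blast
    \<comment> \<open>On \<open>K\<close> the two models agree in cost, kernel and minorant, and
      they share \<eta>; their equations differ only in the function inserted.\<close>
    have Tr: "b x a - \<rho> + T.r f x a = c x a - \<rho> + r f x a" for a
      using x by (simp add: T.r_def r_def q_inside b_inside truncated_minorant_def)
    have re: "r e x a \<le> s" if a: "a \<in> A" for a
    proof -
      have "r e x a \<le> r (\<lambda>y. g y + h y) x a"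
        by (rule r_mono[OF we wbounded_add[OF wg wh] e_le xX a])
      also have "\<dots> = r g x a + r h x a" by (rule r_add[OF wg wh xX a])
      also have "\<dots> \<le> r g x a + (\<integral>y. h y \<partial>p x a)"
        using r_le_integral[OF wh h_nonneg xX a] by simp
      also have "\<dots> \<le> s" using h_int[OF xX a] s[OF a] by simp
      finally show ?thesis .
    qed
    \<comment> \<open>Two infima differ by at most a common bound on the differences of their terms.
      Each direction is proved separately, with \<open>s\<close> as this bound.\<close>
    have "u x - s \<le> T.F \<rho> f x"
    proof (rule T.F_ge, unfold Tr)
      fix a assume a: "a \<in> A"
      have "r u x a - r f x a \<le> r e x a"
        using r_mono[OF wbounded_diff[OF wu wf] we _ xX a] r_diff[OF wu wf xX a] by (simp add: e_def)
      then show "u x - s \<le> c x a - \<rho> + r f x a"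
        using F_le[OF wu xX a, of \<rho>] is_fixedD(2)[OF u xX] re[OF a] by simp
    qed
    moreover have "f x - s \<le> F \<rho> u x"
    proof (rule F_ge)
      fix a assume a: "a \<in> A"
      have "r f x a - r u x a \<le> r e x a"
        using r_mono[OF wbounded_diff[OF wf wu] we _ xX a] r_diff[OF wf wu xX a] by (simp add: e_def)
      then show "f x - s \<le> c x a - \<rho> + r u x a"
        using T.F_le[OF T.is_fixedD(1)[OF f] xX a, of \<rho>] T.is_fixedD(2)[OF f xX] re[OF a] Tr[of a] by simp
    qed
    ultimately have "e x \<le> s" using is_fixedD(2)[OF u xX] T.is_fixedD(2)[OF f xX] by (simp add: e_def)
    then show ?thesis using x by (simp add: g_eq)
  qed
  have "\<bar>\<integral>y. f y \<partial>\<eta>\<bar> \<le> \<bar>\<integral>y. u y \<partial>\<eta>\<bar> + \<bar>\<integral>y. u y - f y \<partial>\<eta>\<bar>"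
    using wbounded_integrable_\<eta>[OF wu] wbounded_integrable_\<eta>[OF wf] by simp
  also have "\<bar>\<integral>y. u y - f y \<partial>\<eta>\<bar> \<le> (\<integral>y. e y \<partial>\<eta>)" unfolding e_def by (rule integral_abs_bound)
  also have "\<dots> \<le> (\<integral>y. g y + h y \<partial>\<eta>)" by (intro integral_\<eta>_mono we wbounded_add wg wh e_le)
  also have "\<dots> = (\<integral>y. g y \<partial>\<eta>) + (\<integral>y. h y \<partial>\<eta>)"
    using wbounded_integrable_\<eta>[OF wg] wbounded_integrable_\<eta>[OF wh] by simp
  also have "(\<integral>y. h y \<partial>\<eta>) = B * (\<integral>y. \<gamma> * indicator (X - K) y + indicator (X - K) y * w y \<partial>\<eta>)"
    unfolding integral_mult_right_zero[symmetric]
    by (rule Bochner_Integration.integral_cong[OF refl]) (simp add: h_def algebra_simps)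
  also have "(\<integral>y. \<gamma> * indicator (X - K) y + indicator (X - K) y * w y \<partial>\<eta>) = \<gamma> * measure \<eta> (X - K) + \<sigma>"
    using wbounded_integrable_\<eta>[OF wbounded_outside[OF wbounded_w]]
      wbounded_integrable_\<eta>[OF wbounded_outside[OF wbounded_const[of 1]]]
    by (simp add: \<sigma> set_lebesgue_integral_def space_\<eta> Int_absorb2)
  finally show "\<bar>\<integral>y. f y \<partial>\<eta>\<bar> \<le> \<bar>\<integral>y. u y \<partial>\<eta>\<bar> + (\<integral>y. g y \<partial>\<eta>) + B * (\<gamma> * measure \<eta> (X - K) + \<sigma>)"
    by simp
qed

end

context truncated_mdp
begin

text \<open>Everything is expressed through \<open>r\<close> and \<open>w\<close> of the original
  model, with the error function under an existential quantifier. Sequences over all levels can then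
  be chosen and treated in one fixed weighted model.\<close>

lemma truncated_value_error:
  assumes u: "is_fixed \<rho> u" "(\<integral>y. u y \<partial>\<eta>) = 0" "\<And>y. y \<in> X \<Longrightarrow> \<bar>u y\<bar> \<le> B * w y"
    and B: "(M + \<bar>\<rho>\<bar>) / (1 - \<beta>) \<le> B"
  shows "\<exists>\<rho>' g. (\<forall>x\<in>X. value_function X A q b x = ereal \<rho>') \<and>
    g \<in> borel_measurable (borel_on X) \<and> (\<forall>y\<in>X. 0 \<le> g y \<and> g y \<le> 2 * B * w y) \<and>
    (\<forall>x\<in>K. \<forall>s. (\<forall>a\<in>A. r g x a + B * (\<tau> + 2 * (\<integral>y. indicator (X - K) y * w y \<partial>p x a)) \<le> s) \<longrightarrow> g x \<le> s) \<and>
    \<bar>\<rho>' - \<rho>\<bar> \<le> (\<integral>y. g y \<partial>\<eta>) + B * (\<gamma> * measure \<eta> (X - K) + \<sigma>)"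
proof -
  \<comment> \<open>Two truncated solutions occur: \<open>h\<close> belongs to the zero \<rho>' and
    identifies the truncated value, whereas \<open>f\<close> below belongs to the original \<rho>
    and is the one compared with \<open>u\<close>.\<close>
  obtain \<rho>' h where h: "T.is_fixed \<rho>' h" "(\<integral>y. h y \<partial>\<eta>) = 0" by (rule T.root_exists)
  obtain f where f: "T.is_fixed \<rho> f" "\<And>y. y \<in> X \<Longrightarrow> \<bar>f y\<bar> \<le> (M + \<bar>\<rho>\<bar>) / (1 - \<beta>) * v y"
    using T.fixed_point_exists by blast
  have fB: "\<bar>f y\<bar> \<le> B * v y" if "y \<in> X" for y
    using f(2)[OF that] mult_right_mono[OF B, of "v y"] v_ge_1[OF that] by simp
  have B0: "0 \<le> B"
    by (rule order_trans[OF _ B]) (use M_nonneg \<beta> in simp)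
  define g where "g = (\<lambda>y. indicator K y * \<bar>u y - f y\<bar>)"
  note e = truncated_fixed_point_error[OF u(1) f(1) B0 u(3) fB g_def]
  have "\<bar>\<rho>' - \<rho>\<bar> \<le> (\<integral>y. g y \<partial>\<eta>) + B * (\<gamma> * measure \<eta> (X - K) + \<sigma>)"
    using T.root_perturbation[OF h f(1)] e(4) u(2) by simp
  moreover have "0 \<le> g y" for y by (simp add: g_def)
  ultimately show ?thesis
    using T.value_function_constant[OF h] e(1,2,3) by (intro exI[of _ \<rho>'] exI[of _ g]) blast
qed

end

section \<open>The limit over the truncation levels\<close>

context weighted_mdp
begin

lemma tail_indicator_tendsto:
  assumes K: "\<And>n. K n \<subseteq> K (Suc n)" "X = (\<Union>n. K n)" and y: "y \<in> X"
  shows "(\<lambda>n. indicator (X - K n) y * s) \<longlonglongrightarrow> (0 :: real)"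
proof -
  obtain m where "y \<in> K m" using y K(2) by blast
  then have "indicator (X - K n) y * s = 0" if "m \<le> n" for n
    using lift_Suc_mono_le[of K, OF K(1) that] by (auto simp: indicator_def)
  then show ?thesis by (intro tendsto_eventually eventually_sequentiallyI[of m])
qed

theorem truncated_values_converge:
  assumes A: "compact A"
    and trunc: "\<And>n. truncated_mdp X A p c w M \<eta> \<phi> \<alpha> (K n) (\<nu> n) (\<gamma> n) (\<tau> n) (\<sigma> n) \<beta>"
    and K: "\<And>n. K n \<subseteq> K (Suc n)" "X = (\<Union>n. K n)"
    and lim: "\<tau> \<longlonglongrightarrow> 0" "\<sigma> \<longlonglongrightarrow> 0" "(\<lambda>n. \<gamma> n * measure \<eta> (X - K n)) \<longlonglongrightarrow> 0"
  shows "\<exists>v vbar. (\<forall>x\<in>X. value_function X A p c x = ereal v) \<and>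
    (\<forall>n. \<forall>x\<in>X. value_function X A (approx_kernel X p (K n) (\<nu> n)) (approx_cost X c (K n) (\<nu> n)) x
      = ereal (vbar n)) \<and> (\<lambda>n. \<bar>vbar n - v\<bar>) \<longlonglongrightarrow> 0"
proof -
  obtain \<rho> u where u: "is_fixed \<rho> u" "(\<integral>y. u y \<partial>\<eta>) = 0" by (rule root_exists)
  obtain C where C: "0 < C" "\<And>x. x \<in> X \<Longrightarrow> \<bar>u x\<bar> \<le> C * w x"
    using is_fixedD(1)[OF u(1)] by (metis wboundedE)
  \<comment> \<open>One constant for both solutions: \<open>C\<close> bounds \<open>u\<close>, and
    the quotient bounds all truncated solutions because \<beta> is the same for every level.\<close>
  define B where "B = max C ((M + \<bar>\<rho>\<bar>) / (1 - \<beta>))"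
  have B: "0 < B" "(M + \<bar>\<rho>\<bar>) / (1 - \<beta>) \<le> B" using C(1) by (auto simp: B_def)
  have uB: "\<bar>u y\<bar> \<le> B * w y" if "y \<in> X" for y
    using C(2)[OF that] mult_right_mono[of C B "w y"] w_nonneg[OF that] by (simp add: B_def)
  define I where "I n x a = (\<integral>y. indicator (X - K n) y * w y \<partial>p x a)" for n x a
  define P where "P n \<rho>' g \<longleftrightarrow> (\<forall>x\<in>X. value_function X A (approx_kernel X p (K n) (\<nu> n))
      (approx_cost X c (K n) (\<nu> n)) x = ereal \<rho>') \<and>
    g \<in> borel_measurable (borel_on X) \<and> (\<forall>y\<in>X. 0 \<le> g y \<and> g y \<le> 2 * B * w y) \<and>
    (\<forall>x\<in>K n. \<forall>s. (\<forall>a\<in>A. r g x a + B * (\<tau> n + 2 * I n x a) \<le> s) \<longrightarrow> g x \<le> s) \<and>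
    \<bar>\<rho>' - \<rho>\<bar> \<le> (\<integral>y. g y \<partial>\<eta>) + B * (\<gamma> n * measure \<eta> (X - K n) + \<sigma> n)" for n \<rho>' g
  have "\<exists>\<rho>' g. P n \<rho>' g" for n
    unfolding P_def I_def by (rule truncated_mdp.truncated_value_error[OF trunc u uB B(2)])
  then obtain \<rho>' g where P: "\<And>n. P n (\<rho>' n) (g n)" by metis
  have wtail: "wbounded (\<lambda>y. indicator (X - K n) y * w y)" for n
    by (rule truncated_mdp.wbounded_outside[OF trunc wbounded_w])
  have Kmono: "K m \<subseteq> K n" if "m \<le> n" for m n by (rule lift_Suc_mono_le[of K, OF K(1) that])
  \<comment> \<open>The tails of \<open>w\<close> must vanish uniformly in the action. They decrease
    in n and are continuous on the compact action space, so Dini applies.\<close>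
  have I_tail: "\<exists>m. \<forall>n\<ge>m. \<forall>a\<in>A. I n x a \<le> \<delta>" if x: "x \<in> X" and \<delta>: "0 < \<delta>" for x \<delta>
  proof -
    have dec: "I n x a \<le> I m x a" if "m \<le> n" "a \<in> A" for m n a
      unfolding I_def
      by (rule integral_p_mono[OF wtail wtail _ x that(2)])
        (use Kmono[OF that(1)] w_nonneg in \<open>auto simp: indicator_def\<close>)
    obtain m where "\<And>a. a \<in> A \<Longrightarrow> I m x a \<le> 0 + \<delta>"
    proof (rule Dini_upper_bound[OF A _ _ _ _ \<delta>])
      show "continuous_on A (I n x)" for n
        unfolding I_def by (rule continuous_integral[OF wtail x])
      show "I (Suc n) x a \<le> I n x a" if "a \<in> A" for n a by (rule dec[OF _ that]) simp
      show "(\<lambda>n. I n x a) \<longlonglongrightarrow> (\<integral>y. 0 \<partial>p x a)" if "a \<in> A" for a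
        unfolding I_def
        by (rule integral_tendsto_wbounded[OF sets_p[OF x that] w_integrable[OF x that], of _ 1])
          (use wbounded_measurable[OF wtail] tail_indicator_tendsto[OF K] w_nonneg in \<open>auto simp: indicator_def\<close>)
      show "(\<integral>y. 0 \<partial>p x a) \<le> (0::real)" for a by simp
    qed blast
    then show ?thesis using dec by (metis add_0 order_trans)
  qed
  have g0: "(\<lambda>n. \<integral>y. g n y \<partial>\<eta>) \<longlonglongrightarrow> 0"
  proof (rule subinvariant_errors_vanish[OF A, of "2 * B"])
    show "\<exists>m. \<forall>n\<ge>m. \<forall>s. (\<forall>a\<in>A. r (g n) x a + \<epsilon> \<le> s) \<longrightarrow> g n x \<le> s" if x: "x \<in> X" and "0 < \<epsilon>" for x \<epsilon>
    proof -
      \<comment> \<open>The defect consists of \<open>B\<close> times three terms, \<tau> and twice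
        the tail, each of which is made at most \<delta>.\<close>
      define \<delta> where "\<delta> = \<epsilon> / (3 * B)"
      have \<delta>: "0 < \<delta>" "B * (\<delta> + 2 * \<delta>) = \<epsilon>" using B(1) \<open>0 < \<epsilon>\<close> by (auto simp: \<delta>_def field_simps)
      obtain m0 where m0: "x \<in> K m0" using x K(2) by blast
      obtain m1 where m1: "\<And>n a. m1 \<le> n \<Longrightarrow> a \<in> A \<Longrightarrow> I n x a \<le> \<delta>" using I_tail[OF x \<delta>(1)] by blast
      obtain m2 where m2: "\<And>n. m2 \<le> n \<Longrightarrow> \<tau> n < \<delta>"
        using order_tendstoD(2)[OF lim(1) \<delta>(1)] unfolding eventually_sequentially by blast
      have "g n x \<le> s" if n: "max m0 (max m1 m2) \<le> n" and s: "\<forall>a\<in>A. r (g n) x a + \<epsilon> \<le> s" for n s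
      proof -
        have "x \<in> K n" using m0 Kmono[of m0 n] n by auto
        moreover have "r (g n) x a + B * (\<tau> n + 2 * I n x a) \<le> s" if a: "a \<in> A" for a
        proof -
          have "B * (\<tau> n + 2 * I n x a) \<le> B * (\<delta> + 2 * \<delta>)"
            using m1[of n a] m2[of n] n a B(1) by (intro mult_left_mono add_mono) auto
          then show ?thesis using s a \<delta>(2) by force
        qed
        ultimately show ?thesis using P[of n] unfolding P_def by blast
      qed
      then show ?thesis by blast
    qed
  qed (use P B(1) in \<open>auto simp: P_def\<close>)
  have "(\<lambda>n. (\<integral>y. g n y \<partial>\<eta>) + B * (\<gamma> n * measure \<eta> (X - K n) + \<sigma> n)) \<longlonglongrightarrow> 0 + B * (0 + 0)"
    by (intro tendsto_intros g0 lim)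
  then have bound: "(\<lambda>n. (\<integral>y. g n y \<partial>\<eta>) + B * (\<gamma> n * measure \<eta> (X - K n) + \<sigma> n)) \<longlonglongrightarrow> 0" by simp
  have "(\<lambda>n. \<bar>\<rho>' n - \<rho>\<bar>) \<longlonglongrightarrow> 0"
    by (rule tendsto_sandwich[OF _ _ tendsto_const bound]) (use P in \<open>auto simp: P_def\<close>)
  moreover have "\<forall>x\<in>X. value_function X A p c x = ereal \<rho>" using value_function_constant[OF u] by blast
  ultimately show ?thesis using P unfolding P_def by blast
qed

end

subsection \<open>Passage from the assumptions\<close>

text \<open>The setwise inequality says that the scaled measure lies below \<open>P\<close> in the
  order of measures, along which nonnegative integrals are monotone.\<close>

lemma integral_minorization:
  fixes g :: "'b \<Rightarrow> real"
  assumes P: "prob_space P" and N: "prob_space N" and sets: "sets N = sets P" and s: "0 \<le> s"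
    and le: "\<And>D. D \<in> sets P \<Longrightarrow> measure N D * s \<le> measure P D"
    and g: "integrable P g" "integrable N g" "\<And>y. y \<in> space P \<Longrightarrow> 0 \<le> g y"
  shows "s * (\<integral>y. g y \<partial>N) \<le> (\<integral>y. g y \<partial>P)"
proof -
  interpret P: prob_space P by (rule P)
  interpret N: prob_space N by (rule N)
  have sp: "space N = space P" by (rule sets_eq_imp_space_eq[OF sets])
  have pos: "0 \<le> (\<integral>y. g y \<partial>N)" "0 \<le> (\<integral>y. g y \<partial>P)"
    using g(3) sp by (auto intro!: integral_nonneg_AE AE_I2)
  have "scale_measure (ennreal s) N \<le> P"
  proof (subst le_measure)
    show "\<forall>D\<in>sets (scale_measure (ennreal s) N). emeasure (scale_measure (ennreal s) N) D \<le> emeasure P D"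
      using le s by (auto simp: sets N.emeasure_eq_measure P.emeasure_eq_measure mult.commute
          simp flip: ennreal_mult intro!: ennreal_leI)
  qed (simp add: sets)
  then have "(\<integral>\<^sup>+y. g y \<partial>scale_measure (ennreal s) N) \<le> (\<integral>\<^sup>+y. g y \<partial>P)"
    by (intro nn_integral_mono_measure) (simp add: sets)
  also have "(\<integral>\<^sup>+y. g y \<partial>scale_measure (ennreal s) N) = ennreal s * (\<integral>\<^sup>+y. g y \<partial>N)"
    by (rule nn_integral_scale_measure) (use g(2) in measurable)
  also have "\<dots> = ennreal (s * (\<integral>y. g y \<partial>N))"
    using g(2,3) sp s pos by (subst nn_integral_eq_integral) (auto simp: ennreal_mult intro!: AE_I2)
  also have "(\<integral>\<^sup>+y. g y \<partial>P) = ennreal (\<integral>y. g y \<partial>P)"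
    using g(1,3) by (intro nn_integral_eq_integral) (auto intro!: AE_I2)
  finally show ?thesis using pos by (simp add: ennreal_le_iff)
qed

lemma continuous_on_section:
  assumes "continuous_on (X \<times> A) (\<lambda>(x, a). f x a)" "x \<in> X"
  shows "continuous_on A (f x)"
proof -
  have "continuous_on A ((\<lambda>(x, a). f x a) \<circ> Pair x)"
    by (intro continuous_on_compose continuous_on_subset[OF assms(1)] continuous_intros) (use assms(2) in auto)
  then show ?thesis by (simp add: comp_def)
qed

text \<open>The function \<open>g\<close> competes in the supremum that defines the weighted norm,
  so this norm dominates the change of its integral along the slice over \<open>x\<close>.\<close>

lemma continuous_on_kernel_integral:
  fixes g :: "'x::polish_space \<Rightarrow> real" and A :: "'a::polish_space set"
  assumes lim: "\<And>a. a \<in> A \<Longrightarrow>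
      ((\<lambda>(x', a'). w_norm_diff X w (p x' a') (p x a)) \<longlongrightarrow> 0) (at (x, a) within X \<times> A)"
    and x: "x \<in> X" and g: "g \<in> borel_measurable (borel_on X)" "\<And>y. y \<in> X \<Longrightarrow> \<bar>g y\<bar> \<le> w y"
  shows "continuous_on A (\<lambda>a. \<integral>y. g y \<partial>p x a)"
  unfolding continuous_on_def
proof
  fix a assume a: "a \<in> A"
  let ?G = "\<lambda>a. \<integral>y. g y \<partial>p x a"
  \<comment> \<open>The embedding of the slice is injective and so respects punctured
    neighbourhoods; the joint limit restricts to a limit in the action.\<close>
  have "filterlim (Pair x) (at (x, a) within X \<times> A) (at a within A)"
    unfolding filterlim_at
    by (intro conjI tendsto_intros) (use x in \<open>auto simp: eventually_at_filter\<close>)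
  from filterlim_compose[OF lim[OF a] this]
  have D: "((\<lambda>a'. w_norm_diff X w (p x a') (p x a)) \<longlongrightarrow> 0) (at a within A)" by simp
  have le: "ereal \<bar>?G a' - ?G a\<bar> \<le> w_norm_diff X w (p x a') (p x a)" for a'
    unfolding w_norm_diff_def by (rule SUP_upper2[where i=g]) (use g in auto)
  have "((\<lambda>a'. ereal \<bar>?G a' - ?G a\<bar>) \<longlongrightarrow> 0) (at a within A)"
    by (rule tendsto_sandwich[OF _ _ tendsto_const D]) (use le in \<open>auto intro!: always_eventually\<close>)
  then have "((\<lambda>a'. \<bar>?G a' - ?G a\<bar>) \<longlongrightarrow> 0) (at a within A)"
    by (simp add: zero_ereal_def)
  then show "(?G \<longlongrightarrow> ?G a) (at a within A)"
    by (simp add: tendsto_rabs_zero_iff LIM_zero_iff)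
qed

theorem theorem3p4:
  fixes X :: "'x::polish_space set" and A :: "'a::polish_space set"
    and p :: "'x \<Rightarrow> 'a \<Rightarrow> 'x measure" and c :: "'x \<Rightarrow> 'a \<Rightarrow> real"
    and w :: "'x \<Rightarrow> real" and M :: real
    and \<eta> :: "'x measure" and \<phi> :: "'x \<Rightarrow> 'a \<Rightarrow> real" and \<alpha> :: real
    and K :: "nat \<Rightarrow> 'x set" and \<nu> :: "nat \<Rightarrow> 'x measure"
    and \<gamma> :: "nat \<Rightarrow> real" and \<tau> :: "nat \<Rightarrow> ereal" and \<sigma> :: "nat \<Rightarrow> real"
  assumes mdp: "mdp X A p c"
    and A1: "continuous_on (X \<times> A) (\<lambda>(x, a). c x a)"
    and A2: "locally compact X" "\<not> compact X" "compact A"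
    and A3: "M \<ge> 0" "continuous_on X w" "\<forall>x\<in>X. 1 \<le> w x"
      "\<forall>x\<in>X. \<forall>a\<in>A. \<bar>c x a\<bar> \<le> M * w x"
      "\<forall>x\<in>X. \<forall>a\<in>A. integrable (p x a) w"
      "continuous_on (X \<times> A) (\<lambda>(x, a). \<integral>y. w y \<partial>p x a)"
    and \<eta>: "\<eta> \<in> space (prob_algebra (borel_on X))" "integrable \<eta> w"
    and \<phi>: "(\<lambda>(x, a). \<phi> x a) \<in> borel_measurable (state_action_space X A)"
      "\<forall>x\<in>X. \<forall>a\<in>A. 0 < \<phi> x a"
    and \<alpha>: "0 < \<alpha>" "\<alpha> < 1"
    and A4: "\<forall>x\<in>X. \<forall>a\<in>A. (\<integral>y. w y \<partial>p x a) \<le> \<alpha> * w x + (\<integral>y. w y \<partial>\<eta>) * \<phi> x a"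
    and A5: "\<forall>x\<in>X. \<forall>a\<in>A. \<forall>D\<in>sets (borel_on X). measure (p x a) D \<ge> measure \<eta> D * \<phi> x a"
    and K: "\<forall>n. compact (K n)" "\<forall>n. K n \<subseteq> (top_of_set X) interior_of (K (Suc n))"
      "X = (\<Union>n. K n)"
    and A6: "\<forall>n. (INF (x, a)\<in>K n \<times> A. ereal (\<phi> x a)) > 0"
    and A7: "\<forall>x\<in>X. \<forall>a\<in>A.
      ((\<lambda>(x', a'). w_norm_diff X w (p x' a') (p x a)) \<longlongrightarrow> 0) (at (x, a) within X \<times> A)"
    and \<nu>: "\<forall>n. \<nu> n \<in> space (prob_algebra (borel_on X))" "\<forall>n. measure (\<nu> n) (X - K n) = 1"
      "\<forall>n. set_integrable (\<nu> n) (X - K n) w"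
    and \<gamma>: "\<forall>n. \<gamma> n = (LINT y:(X - K n)|\<nu> n. w y)"
    and \<tau>: "\<forall>n. \<tau> n =
      max 0 (SUP (x, a)\<in>X \<times> A. ereal (LINT y:(X - K n)|p x a. \<gamma> n - w y))"
    and \<sigma>: "\<forall>n. \<sigma> n = (LINT y:(X - K n)|\<eta>. w y)"
    and \<tau>_bounded: "(SUP n. \<tau> n) < \<infinity>"
    and \<tau>\<sigma>_lim: "(\<lambda>n. \<tau> n + ereal (\<sigma> n)) \<longlonglongrightarrow> 0"
  shows "\<exists>(v::real) (vbar::nat \<Rightarrow> real).
    (\<forall>x\<in>X. value_function X A p c x = ereal v) \<and>
    (\<forall>\<^sub>F n in sequentially. \<forall>x\<in>X.
       value_function X A (approx_kernel X p (K n) (\<nu> n)) (approx_cost X c (K n) (\<nu> n)) x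
         = ereal (vbar n)) \<and>
    (\<lambda>n. \<bar>vbar n - v\<bar>) \<longlonglongrightarrow> 0"
proof -
  let ?S = "state_action_space X A"
  have Xb: "X \<in> sets borel" "X \<noteq> {}" "A \<noteq> {}"
    and kernel: "(\<lambda>(x, a). p x a) \<in> ?S \<rightarrow>\<^sub>M prob_algebra (borel_on X)"
    using mdp unfolding mdp_def by auto
  have p: "prob_space (p x a)" "sets (p x a) = sets (borel_on X)" if "x \<in> X" "a \<in> A" for x a
    using measurable_space[OF kernel, of "(x, a)"] that
    by (auto simp: space_prob_algebra space_pair_measure space_restrict_space)
  have \<eta>': "prob_space \<eta>" "sets \<eta> = sets (borel_on X)" using \<eta>(1) by (auto simp: space_prob_algebra)
  have space: "space N = X" if "sets N = sets (borel_on X)" for N :: "'x measure"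
    using sets_eq_imp_space_eq[OF that] by (simp add: space_restrict_space)
  have w_meas: "w \<in> borel_measurable (borel_on X)"
    by (rule borel_measurable_continuous_on_restrict[OF A3(2)])
  have bounded: "integrable N g" if "sets N = sets (borel_on X)" "integrable N w"
    "g \<in> borel_measurable (borel_on X)" "\<And>y. y \<in> X \<Longrightarrow> 0 \<le> g y \<and> g y \<le> w y" for N and g :: "'x \<Rightarrow> real"
    by (rule Bochner_Integration.integrable_bound[OF that(2)])
      (use that space[OF that(1)] in \<open>auto cong: measurable_cong_sets intro!: AE_I2 intro: order_trans[OF _ abs_ge_self]\<close>)

  define L where "L = (\<integral>y. w y \<partial>\<eta>)"
  have L: "1 \<le> L"
    unfolding L_def
    by (rule prob_space.integral_ge_const[OF \<eta>'(1) \<eta>(2)], rule AE_I2) (use A3(3) space[OF \<eta>'(2)] in auto)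
  \<comment> \<open>\<open>\<phi>\<close> need not be continuous in the action, so it is replaced by the least nonnegative function
    for which (A4) holds; this one is continuous and inherits (A5) from \<open>\<phi>\<close>.\<close>
  define \<psi> where "\<psi> x a = max 0 (((\<integral>y. w y \<partial>p x a) - \<alpha> * w x) / L)" for x a
  have \<psi>_le: "\<psi> x a \<le> \<phi> x a" if "x \<in> X" "a \<in> A" for x a
    using A4[rule_format, OF that] \<phi>(2)[rule_format, OF that] L
    unfolding \<psi>_def L_def[symmetric] by (simp add: divide_le_eq mult.commute diff_le_eq add.commute)
  interpret W: weighted_mdp X A p c w M \<eta> \<psi> \<alpha>
  proof unfold_locales
    show "(\<lambda>(x, a). \<psi> x a) \<in> borel_measurable ?S"
    proof -
      have 1: "(\<lambda>z. \<integral>y. w y \<partial>p (fst z) (snd z)) \<in> borel_measurable ?S"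
        using measurable_compose[OF measurable_prob_algebraD[OF kernel] integral_measurable_subprob_algebra[OF w_meas]]
        by (simp add: case_prod_beta')
      have 2: "(\<lambda>z. w (fst z)) \<in> borel_measurable ?S" by (rule measurable_compose[OF measurable_fst w_meas])
      show ?thesis unfolding \<psi>_def case_prod_beta' using 1 2 by measurable
    qed
    show "(\<integral>y. w y \<partial>p x a) \<le> \<alpha> * w x + (\<integral>y. w y \<partial>\<eta>) * \<psi> x a" for x a
    proof -
      have "((\<integral>y. w y \<partial>p x a) - \<alpha> * w x) / L \<le> \<psi> x a" by (simp add: \<psi>_def)
      then show ?thesis using L unfolding L_def[symmetric] by (simp add: divide_le_eq mult.commute)
    qed
    show "\<psi> x a * (\<integral>y. g y \<partial>\<eta>) \<le> (\<integral>y. g y \<partial>p x a)"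
      if g: "g \<in> borel_measurable (borel_on X)" "\<And>y. y \<in> X \<Longrightarrow> 0 \<le> g y \<and> g y \<le> w y" and x: "x \<in> X" "a \<in> A" for g x a
    proof (rule integral_minorization[OF p(1)[OF x] \<eta>'(1)])
      show "measure \<eta> D * \<psi> x a \<le> measure (p x a) D" if "D \<in> sets (p x a)" for D
      proof -
        have "measure \<eta> D * \<psi> x a \<le> measure \<eta> D * \<phi> x a" by (intro mult_left_mono \<psi>_le x) simp
        then show ?thesis using A5 x that p(2)[OF x] by fastforce
      qed
    qed (use bounded[OF p(2)[OF x] _ g] bounded[OF \<eta>'(2) \<eta>(2) g] A3(5) x \<eta>'(2) p(2)[OF x] space[OF p(2)[OF x]] g
        in \<open>auto simp: \<psi>_def\<close>)
    show "continuous_on A (c x)" if "x \<in> X" for x by (rule continuous_on_section[OF A1 that])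
    show "continuous_on A (\<psi> x)" if "x \<in> X" for x
      unfolding \<psi>_def using continuous_on_section[OF A3(6) that] L by (intro continuous_intros) auto
    show "continuous_on A (\<lambda>a. \<integral>y. g y \<partial>p x a)"
      if "g \<in> borel_measurable (borel_on X)" "\<And>y. y \<in> X \<Longrightarrow> \<bar>g y\<bar> \<le> w y" "x \<in> X" for g x
      by (rule continuous_on_kernel_integral[of A X w p x g]) (use that A7 in auto)
    show "mdp X A p c" by (rule mdp)
    show "1 \<le> w x" if "x \<in> X" for x using A3(3) that by blast
    show "\<bar>c x a\<bar> \<le> M * w x" if "x \<in> X" "a \<in> A" for x a using A3(4) that by blast
    show "integrable (p x a) w" if "x \<in> X" "a \<in> A" for x a using A3(5) that by blast
    show "0 \<le> \<psi> x a" for x a by (simp add: \<psi>_def)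
    show "0 \<le> \<alpha>" using \<alpha>(1) by simp
  qed (fact w_meas A3(1) \<eta> \<alpha>(2))+

  have K_Suc: "K n \<subseteq> K (Suc n)" for n by (rule order_trans[OF K(2)[rule_format] interior_of_subset])
  have K_mono: "K m \<subseteq> K n" if "m \<le> n" for m n by (rule lift_Suc_mono_le[of K, OF K_Suc that])
  have K_sets: "K n \<in> sets (borel_on X)" for n
    using borel_closed[OF compact_imp_closed[OF K(1)[rule_format, of n]]] Xb(1) K(3)
    by (subst sets_restrict_space_iff) auto
  define t where "t n = real_of_ereal (\<tau> n)" for n
  have \<tau>0: "0 \<le> \<tau> n" for n using \<tau> by simp
  have \<tau>_t: "\<tau> n = ereal (t n)" for n
  proof -
    have "\<tau> n \<le> (SUP n. \<tau> n)" by (rule SUP_upper) simp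
    then show ?thesis using \<tau>_bounded \<tau>0[of n] unfolding t_def by (cases "\<tau> n") auto
  qed
  have t0: "0 \<le> t n" for n using \<tau>0[of n] by (simp add: \<tau>_t)
  have \<sigma>0: "0 \<le> \<sigma> n" for n
    unfolding \<sigma>[rule_format] set_lebesgue_integral_def
    by (rule integral_nonneg_AE, rule AE_I2) (use space[OF \<eta>'(2)] W.w_nonneg in \<open>auto simp: indicator_def\<close>)
  have t\<sigma>: "(\<lambda>n. t n + \<sigma> n) \<longlonglongrightarrow> 0" using \<tau>\<sigma>_lim by (simp add: \<tau>_t zero_ereal_def)
  have t_lim: "t \<longlonglongrightarrow> 0" and \<sigma>_lim: "\<sigma> \<longlonglongrightarrow> 0"
    by (rule tendsto_sandwich[OF _ _ tendsto_const t\<sigma>]; use t0 \<sigma>0 in simp)+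
  have t_ge: "(LINT y:(X - K n)|p x a. \<gamma> n - w y) \<le> t n" if "x \<in> X" "a \<in> A" for n x a
  proof -
    have "ereal (LINT y:(X - K n)|p x a. \<gamma> n - w y) \<le> (SUP (x, a)\<in>X \<times> A. ereal (LINT y:(X - K n)|p x a. \<gamma> n - w y))"
      by (rule SUP_upper2[where i="(x, a)"]) (use that in auto)
    also have "\<dots> \<le> \<tau> n" using \<tau> by simp
    finally show ?thesis by (simp add: \<tau>_t)
  qed

  \<comment> \<open>One arbitrary pair suffices: by (A5), the \<eta>-mass of the complement times
    \<open>\<phi> x a\<close> is at most its mass under \<open>p x a\<close>. Multiplied by
    \<open>\<gamma> n\<close>, the latter is at most \<open>t n\<close> plus the tail of
    \<open>w\<close>. The original \<phi> is used because it is positive, whereas \<psi> may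
    vanish.\<close>
  have \<gamma>\<eta>_lim: "(\<lambda>n. \<gamma> n * measure \<eta> (X - K n)) \<longlonglongrightarrow> 0"
  proof -
    obtain x a where x: "x \<in> X" "a \<in> A" using Xb by auto
    have D: "X - K n \<in> sets (borel_on X)" for n
      using sets.compl_sets[OF K_sets] by (simp add: space_restrict_space)
    note ind = W.wbounded_indicator[OF D]
    note i1 = W.wbounded_integrable_p[OF ind[OF W.wbounded_const[of 1]] x]
      and iw = W.wbounded_integrable_p[OF ind[OF W.wbounded_w] x]
    define I where "I n = (\<integral>y. indicator (X - K n) y * w y \<partial>p x a)" for n
    have "I \<longlonglongrightarrow> (\<integral>y. 0 \<partial>p x a)"
      unfolding I_def
      by (rule W.integral_tendsto_wbounded[OF p(2)[OF x] A3(5)[rule_format, OF x], of _ 1])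
        (use W.wbounded_measurable[OF ind[OF W.wbounded_w]] W.tail_indicator_tendsto[of K, OF K_Suc K(3)] W.w_nonneg
          in \<open>auto simp: indicator_def\<close>)
    then have "(\<lambda>n. (t n + I n) / \<phi> x a) \<longlonglongrightarrow> (0 + 0) / \<phi> x a"
      using \<phi>(2)[rule_format, OF x] by (intro tendsto_intros t_lim) auto
    then have lim: "(\<lambda>n. (t n + I n) / \<phi> x a) \<longlonglongrightarrow> 0" by simp
    have \<gamma>0: "0 \<le> \<gamma> n" for n
    proof -
      have "sets (\<nu> n) = sets (borel_on X)" using \<nu>(1) by (simp add: space_prob_algebra)
      then show ?thesis
        unfolding \<gamma>[rule_format] set_lebesgue_integral_def
        by (intro integral_nonneg_AE AE_I2) (use space W.w_nonneg in \<open>auto simp: indicator_def\<close>)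
    qed
    have "\<gamma> n * measure \<eta> (X - K n) \<le> (t n + I n) / \<phi> x a" for n
    proof -
      have "(LINT y:(X - K n)|p x a. \<gamma> n - w y)
          = (\<integral>y. \<gamma> n * (indicator (X - K n) y * 1) - indicator (X - K n) y * w y \<partial>p x a)"
        by (simp add: set_lebesgue_integral_def algebra_simps)
      also have "\<dots> = \<gamma> n * measure (p x a) (X - K n) - I n"
        using i1[of n] iw[of n] W.space_p[OF x] by (simp add: I_def Int_absorb2)
      finally have "\<gamma> n * measure (p x a) (X - K n) \<le> t n + I n" using t_ge[OF x, of n] by simp
      moreover have "\<gamma> n * (measure \<eta> (X - K n) * \<phi> x a) \<le> \<gamma> n * measure (p x a) (X - K n)"
        by (rule mult_left_mono[OF _ \<gamma>0]) (use A5 x D in auto)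
      ultimately show ?thesis using \<phi>(2)[rule_format, OF x] by (simp add: le_divide_eq mult.assoc)
    qed
    then show ?thesis
      by (intro tendsto_sandwich[OF _ _ tendsto_const lim] always_eventually allI) (use \<gamma>0 in auto)
  qed

  \<comment> \<open>Halfway between \<alpha> and 1, which leaves room for \<tau> and \<sigma> from
    some level on while keeping one contraction factor for all these levels.\<close>
  define \<beta> where "\<beta> = (1 + \<alpha>) / 2"
  have \<beta>: "\<alpha> < \<beta>" "\<beta> < 1" using \<alpha> by (auto simp: \<beta>_def)
  obtain m where m: "\<And>n. m \<le> n \<Longrightarrow> t n + \<sigma> n < \<beta> - \<alpha>"
    using order_tendstoD(2)[OF t\<sigma>, of "\<beta> - \<alpha>"] \<beta>(1) unfolding eventually_sequentially by auto
  have trunc: "truncated_mdp X A p c w M \<eta> \<psi> \<alpha> (K (n + m)) (\<nu> (n + m)) (\<gamma> (n + m)) (t (n + m)) (\<sigma> (n + m)) \<beta>" for n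
    by unfold_locales (use K_sets \<nu> \<gamma> t_ge t0 \<sigma> m[of "n + m"] \<beta> in auto)
  have K_shift: "X = (\<Union>n. K (n + m))"
  proof -
    have "K n \<subseteq> K (n + m)" for n by (rule K_mono) simp
    then show ?thesis using K(3) by blast
  qed
  have K_Suc_shift: "K (n + m) \<subseteq> K (Suc n + m)" for n by (rule K_mono) simp
  \<comment> \<open>The truncated models are known to be contractive only from level m on, so the
    convergence theorem is applied to the sequence shifted by m.\<close>
  note shift = LIMSEQ_ignore_initial_segment[of _ 0 m]
  obtain v vbar where v: "\<forall>x\<in>X. value_function X A p c x = ereal v"
    and vbar: "\<And>n x. x \<in> X \<Longrightarrow> value_function X A (approx_kernel X p (K (n + m)) (\<nu> (n + m)))
      (approx_cost X c (K (n + m)) (\<nu> (n + m))) x = ereal (vbar n)"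
    and lim: "(\<lambda>n. \<bar>vbar n - v\<bar>) \<longlonglongrightarrow> 0"
    using W.truncated_values_converge[OF A2(3) trunc K_Suc_shift K_shift
      shift[OF t_lim] shift[OF \<sigma>_lim] shift[OF \<gamma>\<eta>_lim]]
    by blast
  show ?thesis
  \<comment> \<open>The witness undoes the shift. For n below m the subtraction yields 0, an
    arbitrary default there, since the identity is claimed only eventually.\<close>
  proof (intro exI conjI)
    show "\<forall>x\<in>X. value_function X A p c x = ereal v" by (rule v)
    show "\<forall>\<^sub>F n in sequentially. \<forall>x\<in>X.
       value_function X A (approx_kernel X p (K n) (\<nu> n)) (approx_cost X c (K n) (\<nu> n)) x
         = ereal (vbar (n - m))"
    proof (rule eventually_sequentiallyI[of m], rule ballI)
      fix n x assume "m \<le> n" "x \<in> X"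
      then show "value_function X A (approx_kernel X p (K n) (\<nu> n)) (approx_cost X c (K n) (\<nu> n)) x
          = ereal (vbar (n - m))"
        using vbar[of x "n - m"] by simp
    qed
    show "(\<lambda>n. \<bar>vbar (n - m) - v\<bar>) \<longlonglongrightarrow> 0"
      by (rule LIMSEQ_offset[of _ m]) (simp add: lim)
  qed
qed

end
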